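(* Let $a<b$, let $n_0,n_1,n_2\ge0$ be integers, $n=n_0+n_1+n_2$, let $B\in\mathbb{R}^{(n_1+2n_2)\times(2n_1+4n_2)}$ be such that $BT$ is invertible, and let $A_0:[a,b]\to\mathbb{R}^{n\times n}$, $A_1:[a,b]\to\mathbb{R}^{n\times(n_1+n_2)}$, $A_2:[a,b]\to\mathbb{R}^{n\times n_2}$ be bounded measurable. Let $X$, $\mathcal{T}$, $\mathcal{A}$ be as defined in the context. Suppose there exist $\alpha,\delta>0$ and bounded measurable $N_0:[a,b]\to\mathbb{R}^{n\times n}$, $N_1,N_2:[a,b]^2\to\mathbb{R}^{n\times n}$ such that for $\mathcal{P}:=\mathcal{P}_{\{N_0,N_1,N_2\}}$ we have $\mathcal{P}=\mathcal{P}^*\ge\alpha I$ and $$\mathcal{A}^*\mathcal{P}\mathcal{T}+\mathcal{T}^*\mathcal{P}\mathcal{A}\le-\delta\,\mathcal{T}^*\mathcal{T}.$$ Then any solution $\mathbf{x}(t)$ of the PDE defined by $\{A_i,X\}$ satisfies, for all $t\ge0$, $$\|\mathbf{x}(t)\|_{L_2}^2\le\frac{\zeta}{\alpha}\,\|\mathbf{x}(0)\|_{L_2}^2\,e^{-(\delta/\zeta)t},$$ where $\zeta=\|\mathcal{P}\|_{\mathcal{L}(L_2)}$ is the operator norm of $\mathcal{P}$ on $L_2^n$.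
   Context: $L_2^m=L_2([a,b];\mathbb{R}^m)$ with its standard inner product; $H_k^m$ is the Sobolev space of $\mathbb{R}^m$-valued functions on $[a,b]$ whose weak derivatives up to order $k$ are in $L_2$. A subscript $s$ denotes $\partial_s$. Adjoints are with respect to the $L_2^n$ inner product, with all operators regarded as bounded operators $L_2^n\to L_2^n$; for self-adjoint operators, $\mathcal{Q}\ge\mathcal{R}$ means $\langle\mathbf{x},(\mathcal{Q}-\mathcal{R})\mathbf{x}\rangle_{L_2}\ge0$ for all $\mathbf{x}\in L_2^n$. 3-PI operators: for bounded measurable matrix-valued (possibly rectangular) functions $N_0$ on $[a,b]$ and $N_1,N_2$ on $[a,b]^2$, $$(\mathcal{P}_{\{N_0,N_1,N_2\}}\mathbf{x})(s)=N_0(s)\mathbf{x}(s)+\int_a^s N_1(s,\theta)\mathbf{x}(\theta)\,d\theta+\int_s^b N_2(s,\theta)\mathbf{x}(\theta)\,d\theta .$$ The matrix $T\in\mathbb{R}^{(2n_1+4n_2)\times(n_1+2n_2)}$ is $$T=\begin{bmatrix} I_{n_1}&0&0\\ I_{n_1}&0&0\\ 0&I_{n_2}&0\\ 0&I_{n_2}&(b-a)I_{n_2}\\ 0&0&I_{n_2}\\ 0&0&I_{n_2}\end{bmatrix}.$$ The space $X$ is the set of $\mathbf{x}=(x_0,x_1,x_2)\in L_2^{n_0}\times H_1^{n_1}\times H_2^{n_2}$ such that $$B\begin{bmatrix} x_1(a)\\ x_1(b)\\ x_2(a)\\ x_2(b)\\ x_{2s}(a)\\ x_{2s}(b)\end{bmatrix}=0,$$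 equipped with $\langle\mathbf{x},\mathbf{y}\rangle_X=\langle x_0,y_0\rangle_{L_2}+\langle\partial_s x_1,\partial_s y_1\rangle_{L_2}+\langle\partial_s^2x_2,\partial_s^2y_2\rangle_{L_2}$ (an inner product on $X$ when $BT$ is invertible) and the norm $\|\cdot\|_X$ it induces. Define (columns of $Q$ and rows of $K$ partitioned as $n_0,n_1,n_2$; columns of $K$ and of $V$ partitioned as $n_1,n_2,n_2$; rows of $V,G_3,G_4,G_5$ partitioned as $n_1,n_2$; columns of $G_0,\dots,G_5$ partitioned as $n_0,n_1,n_2$) $$Q(s,\theta)=\begin{bmatrix} 0&0&0\\ 0&I_{n_1}&0\\ 0&0&0\\ 0&0&(b-\theta)I_{n_2}\\ 0&0&0\\ 0&0&I_{n_2}\end{bmatrix},\quad K(s)=\begin{bmatrix} 0&0&0\\ I_{n_1}&0&0\\ 0&I_{n_2}&(s-a)I_{n_2}\end{bmatrix},\quad V=\begin{bmatrix} 0&0&0\\ 0&0&I_{n_2}\end{bmatrix},$$ $$G_0(s)=\begin{bmatrix} I_{n_0}&0&0\\ 0&0&0\\ 0&0&0\end{bmatrix},\quad G_2(s,\theta)=-K(s)(BT)^{-1}BQ(s,\theta),\quad G_1(s,\theta)=\begin{bmatrix} 0&0&0\\ 0&I_{n_1}&0\\ 0&0&(s-\theta)I_{n_2}\end{bmatrix}+G_2(s,\theta),$$ $$G_3(s)=\begin{bmatrix} 0&I_{n_1}&0\\ 0&0&0\end{bmatrix},\quad G_5(s,\theta)=-V(BT)^{-1}BQ(s,\theta),\quad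 G_4(s,\theta)=\begin{bmatrix} 0&0&0\\ 0&0&I_{n_2}\end{bmatrix}+G_5(s,\theta).$$ Then $\mathcal{T}:=\mathcal{P}_{\{G_0,G_1,G_2\}}$ and $\mathcal{A}:=\mathcal{P}_{\{H_0,H_1,H_2\}}$ with $H_0=A_0G_0+A_1G_3+A_{20}$, $A_{20}(s)=\begin{bmatrix} 0&0&A_2(s)\end{bmatrix}$, $H_1(s,\theta)=A_0(s)G_1(s,\theta)+A_1(s)G_4(s,\theta)$, $H_2(s,\theta)=A_0(s)G_2(s,\theta)+A_1(s)G_5(s,\theta)$. PDE solution: $\mathbf{x}$ is a solution of the PDE defined by $\{A_i,X\}$ with initial condition $\mathbf{x}_0\in X$ if $\mathbf{x}(0)=\mathbf{x}_0$, $\mathbf{x}(t)=(x_0(t),x_1(t),x_2(t))\in X$ for all $t\ge0$, $\mathbf{x}:[0,\infty)\to X$ is Fréchet differentiable (with respect to $\|\cdot\|_X$) for all $t\ge 0$, and for all $t\ge0$ (as an identity in $L_2^n$) $$\dot{\mathbf{x}}(t,s)=A_0(s)\mathbf{x}(t,s)+A_1(s)\begin{bmatrix} \partial_sx_1(t,s)\\ \partial_sx_2(t,s)\end{bmatrix}+A_2(s)\,\partial_s^2x_2(t,s).$$ *)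

theory Defs
  imports "HOL-Analysis.Analysis" "Jordan_Normal_Form.Gauss_Jordan_Elimination"
begin

text \<open>Dimensions are natural numbers and may be zero, so vectors and matrices are the
  explicitly sized ones of \<^theory>\<open>Jordan_Normal_Form.Matrix\<close>, not the type-indexed ones.\<close>

hide_type (open) Finite_Cartesian_Product.vec
hide_const (open) Finite_Cartesian_Product.vec
no_notation Finite_Cartesian_Product.vec_nth (infixl \<open>$\<close> 90)
no_notation Inner_Product.real_inner_class.inner (infix \<open>\<bullet>\<close> 70)

definition append_cols :: "real mat \<Rightarrow> real mat \<Rightarrow> real mat" (infixr \<open>@\<^sub>c\<close> 66) where
  "A @\<^sub>c B = four_block_mat A B (0\<^sub>m 0 (dim_col A)) (0\<^sub>m 0 (dim_col B))"

abbreviation mat_inv :: "real mat \<Rightarrow> real mat" where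
  "mat_inv A \<equiv> the (mat_inverse A)"


subsection \<open>The space \<open>L\<^sub>2([a,b];\<real>\<^sup>m)\<close> and its operators\<close>

text \<open>Elements of \<open>L\<^sub>2\<close> are represented by functions; only the values on \<open>[a,b]\<close> matter, and
  functions that agree almost everywhere on \<open>[a,b]\<close> represent the same element. Operators act
  on representatives.\<close>

type_synonym vfun = "real \<Rightarrow> real vec"

definition L2_space :: "real \<Rightarrow> real \<Rightarrow> nat \<Rightarrow> vfun set" where
  "L2_space a b m = {f.
     (\<forall>s\<in>{a..b}. f s \<in> carrier_vec m) \<and>
     (\<forall>i<m. (\<lambda>s. f s $ i) \<in> borel_measurable (lebesgue_on {a..b}) \<and>
            integrable (lebesgue_on {a..b}) (\<lambda>s. (f s $ i)\<^sup>2))}"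

definition L2_eq :: "real \<Rightarrow> real \<Rightarrow> vfun \<Rightarrow> vfun \<Rightarrow> bool" where
  "L2_eq a b f g \<longleftrightarrow> (AE s in lebesgue_on {a..b}. f s = g s)"

definition L2_inner :: "real \<Rightarrow> real \<Rightarrow> vfun \<Rightarrow> vfun \<Rightarrow> real" where
  "L2_inner a b f g = (LINT s|lebesgue_on {a..b}. f s \<bullet> g s)"

definition L2_norm :: "real \<Rightarrow> real \<Rightarrow> vfun \<Rightarrow> real" where
  "L2_norm a b f = sqrt (L2_inner a b f f)"

type_synonym vop = "vfun \<Rightarrow> vfun"

definition op_add :: "vop \<Rightarrow> vop \<Rightarrow> vop" where
  "op_add Q R = (\<lambda>x s. Q x s + R x s)"

definition op_smult :: "real \<Rightarrow> vop \<Rightarrow> vop" where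
  "op_smult c Q = (\<lambda>x s. c \<cdot>\<^sub>v Q x s)"

definition L2_op_eq :: "real \<Rightarrow> real \<Rightarrow> nat \<Rightarrow> vop \<Rightarrow> vop \<Rightarrow> bool" where
  "L2_op_eq a b n Q R \<longleftrightarrow> (\<forall>x\<in>L2_space a b n. L2_eq a b (Q x) (R x))"

definition L2_op_le :: "real \<Rightarrow> real \<Rightarrow> nat \<Rightarrow> vop \<Rightarrow> vop \<Rightarrow> bool" where
  "L2_op_le a b n Q R \<longleftrightarrow>
     (\<forall>x\<in>L2_space a b n. 0 \<le> L2_inner a b x (\<lambda>s. R x s - Q x s))"

text \<open>The adjoint of a bounded operator exists and is unique up to almost-everywhere equality
  of its values, which is why a choice of representative is harmless.\<close>

definition L2_adj :: "real \<Rightarrow> real \<Rightarrow> nat \<Rightarrow> vop \<Rightarrow> vop" where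
  "L2_adj a b n Q = (SOME R.
     (\<forall>y\<in>L2_space a b n. R y \<in> L2_space a b n) \<and>
     (\<forall>x\<in>L2_space a b n. \<forall>y\<in>L2_space a b n. L2_inner a b (Q x) y = L2_inner a b x (R y)))"

text \<open>Same shape as \<^const>\<open>onorm\<close>; the quotient is \<open>0\<close> when the denominator is.\<close>

definition L2_onorm :: "real \<Rightarrow> real \<Rightarrow> nat \<Rightarrow> vop \<Rightarrow> real" where
  "L2_onorm a b n Q = (SUP x\<in>L2_space a b n. L2_norm a b (Q x) / L2_norm a b x)"


subsection \<open>3-PI operators\<close>

definition bounded_measurable_mat ::
    "'a::euclidean_space set \<Rightarrow> nat \<Rightarrow> nat \<Rightarrow> ('a \<Rightarrow> real mat) \<Rightarrow> bool" where
  "bounded_measurable_mat S p q F \<longleftrightarrow>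
     (\<forall>u\<in>S. F u \<in> carrier_mat p q) \<and>
     (\<forall>i<p. \<forall>j<q. (\<lambda>u. F u $$ (i,j)) \<in> borel_measurable (lebesgue_on S)) \<and>
     (\<exists>C. \<forall>u\<in>S. \<forall>i<p. \<forall>j<q. \<bar>F u $$ (i,j)\<bar> \<le> C)"

definition vec_integral :: "nat \<Rightarrow> real set \<Rightarrow> vfun \<Rightarrow> real vec" where
  "vec_integral p S f = vec p (\<lambda>i. LINT \<theta>|lebesgue_on S. f \<theta> $ i)"

text \<open>\<open>p\<close> is the number of rows of the kernels.\<close>

definition PI_op :: "real \<Rightarrow> real \<Rightarrow> nat \<Rightarrow> (real \<Rightarrow> real mat) \<Rightarrow>
    (real \<Rightarrow> real \<Rightarrow> real mat) \<Rightarrow> (real \<Rightarrow> real \<Rightarrow> real mat) \<Rightarrow> vop" where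
  "PI_op a b p N0 N1 N2 x s =
     N0 s *\<^sub>v x s
     + vec_integral p {a..s} (\<lambda>\<theta>. N1 s \<theta> *\<^sub>v x \<theta>)
     + vec_integral p {s..b} (\<lambda>\<theta>. N2 s \<theta> *\<^sub>v x \<theta>)"


subsection \<open>Weak derivatives, Sobolev spaces and boundary values\<close>

definition test_function :: "real \<Rightarrow> real \<Rightarrow> (real \<Rightarrow> real) \<Rightarrow> bool" where
  "test_function a b \<phi> \<longleftrightarrow>
     (\<forall>k x. (deriv ^^ k) \<phi> differentiable (at x)) \<and>
     (\<exists>c d. a < c \<and> d < b \<and> (\<forall>x. x \<notin> {c..d} \<longrightarrow> \<phi> x = 0))"

definition is_weak_deriv :: "real \<Rightarrow> real \<Rightarrow> nat \<Rightarrow> nat \<Rightarrow> vfun \<Rightarrow> vfun \<Rightarrow> bool" where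
  "is_weak_deriv a b m k f g \<longleftrightarrow>
     (\<forall>i<m. \<forall>\<phi>. test_function a b \<phi> \<longrightarrow>
        (LINT s|lebesgue_on {a..b}. f s $ i * (deriv ^^ k) \<phi> s)
        = (-1) ^ k * (LINT s|lebesgue_on {a..b}. g s $ i * \<phi> s))"

definition sobolev :: "real \<Rightarrow> real \<Rightarrow> nat \<Rightarrow> nat \<Rightarrow> vfun set" where
  "sobolev a b k m = {f \<in> L2_space a b m.
     \<forall>j\<le>k. \<exists>g\<in>L2_space a b m. is_weak_deriv a b m j f g}"

text \<open>The weak derivative \<open>\<partial>\<^sub>s\<^sup>k f\<close>, unique up to almost-everywhere equality.\<close>

definition wderiv :: "real \<Rightarrow> real \<Rightarrow> nat \<Rightarrow> nat \<Rightarrow> vfun \<Rightarrow> vfun" where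
  "wderiv a b m k f = (SOME g. g \<in> L2_space a b m \<and> is_weak_deriv a b m k f g)"

text \<open>Point values of \<open>H\<^sub>1\<close> functions are those of the continuous representative, which is
  unique on \<open>[a,b]\<close> when \<open>a < b\<close>.\<close>

definition cont_rep :: "real \<Rightarrow> real \<Rightarrow> nat \<Rightarrow> vfun \<Rightarrow> vfun" where
  "cont_rep a b m f = (SOME g.
     (\<forall>s\<in>{a..b}. g s \<in> carrier_vec m) \<and>
     (\<forall>i<m. continuous_on {a..b} (\<lambda>s. g s $ i)) \<and>
     L2_eq a b f g)"


subsection \<open>The matrices and kernels\<close>

definition T_mat :: "real \<Rightarrow> real \<Rightarrow> nat \<Rightarrow> nat \<Rightarrow> real mat" where
  "T_mat a b n1 n2 =
        1\<^sub>m n1    @\<^sub>c 0\<^sub>m n1 n2 @\<^sub>c 0\<^sub>m n1 n2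
     @\<^sub>r 1\<^sub>m n1    @\<^sub>c 0\<^sub>m n1 n2 @\<^sub>c 0\<^sub>m n1 n2
     @\<^sub>r 0\<^sub>m n2 n1 @\<^sub>c 1\<^sub>m n2    @\<^sub>c 0\<^sub>m n2 n2
     @\<^sub>r 0\<^sub>m n2 n1 @\<^sub>c 1\<^sub>m n2    @\<^sub>c ((b - a) \<cdot>\<^sub>m 1\<^sub>m n2)
     @\<^sub>r 0\<^sub>m n2 n1 @\<^sub>c 0\<^sub>m n2 n2 @\<^sub>c 1\<^sub>m n2
     @\<^sub>r 0\<^sub>m n2 n1 @\<^sub>c 0\<^sub>m n2 n2 @\<^sub>c 1\<^sub>m n2"

definition Q_mat :: "real \<Rightarrow> nat \<Rightarrow> nat \<Rightarrow> nat \<Rightarrow> real \<Rightarrow> real \<Rightarrow> real mat" where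
  "Q_mat b n0 n1 n2 s \<theta> =
        0\<^sub>m n1 n0 @\<^sub>c 0\<^sub>m n1 n1 @\<^sub>c 0\<^sub>m n1 n2
     @\<^sub>r 0\<^sub>m n1 n0 @\<^sub>c 1\<^sub>m n1    @\<^sub>c 0\<^sub>m n1 n2
     @\<^sub>r 0\<^sub>m n2 n0 @\<^sub>c 0\<^sub>m n2 n1 @\<^sub>c 0\<^sub>m n2 n2
     @\<^sub>r 0\<^sub>m n2 n0 @\<^sub>c 0\<^sub>m n2 n1 @\<^sub>c ((b - \<theta>) \<cdot>\<^sub>m 1\<^sub>m n2)
     @\<^sub>r 0\<^sub>m n2 n0 @\<^sub>c 0\<^sub>m n2 n1 @\<^sub>c 0\<^sub>m n2 n2
     @\<^sub>r 0\<^sub>m n2 n0 @\<^sub>c 0\<^sub>m n2 n1 @\<^sub>c 1\<^sub>m n2"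

definition K_mat :: "real \<Rightarrow> nat \<Rightarrow> nat \<Rightarrow> nat \<Rightarrow> real \<Rightarrow> real mat" where
  "K_mat a n0 n1 n2 s =
        0\<^sub>m n0 n1 @\<^sub>c 0\<^sub>m n0 n2 @\<^sub>c 0\<^sub>m n0 n2
     @\<^sub>r 1\<^sub>m n1    @\<^sub>c 0\<^sub>m n1 n2 @\<^sub>c 0\<^sub>m n1 n2
     @\<^sub>r 0\<^sub>m n2 n1 @\<^sub>c 1\<^sub>m n2    @\<^sub>c ((s - a) \<cdot>\<^sub>m 1\<^sub>m n2)"

definition V_mat :: "nat \<Rightarrow> nat \<Rightarrow> real mat" where
  "V_mat n1 n2 =
        0\<^sub>m n1 n1 @\<^sub>c 0\<^sub>m n1 n2 @\<^sub>c 0\<^sub>m n1 n2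
     @\<^sub>r 0\<^sub>m n2 n1 @\<^sub>c 0\<^sub>m n2 n2 @\<^sub>c 1\<^sub>m n2"

definition G0 :: "nat \<Rightarrow> nat \<Rightarrow> nat \<Rightarrow> real \<Rightarrow> real mat" where
  "G0 n0 n1 n2 s =
        1\<^sub>m n0    @\<^sub>c 0\<^sub>m n0 n1 @\<^sub>c 0\<^sub>m n0 n2
     @\<^sub>r 0\<^sub>m n1 n0 @\<^sub>c 0\<^sub>m n1 n1 @\<^sub>c 0\<^sub>m n1 n2
     @\<^sub>r 0\<^sub>m n2 n0 @\<^sub>c 0\<^sub>m n2 n1 @\<^sub>c 0\<^sub>m n2 n2"

definition G2 :: "real \<Rightarrow> real \<Rightarrow> nat \<Rightarrow> nat \<Rightarrow> nat \<Rightarrow> real mat \<Rightarrow> real \<Rightarrow> real \<Rightarrow> real mat" where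
  "G2 a b n0 n1 n2 B s \<theta> =
     - (K_mat a n0 n1 n2 s * mat_inv (B * T_mat a b n1 n2) * B * Q_mat b n0 n1 n2 s \<theta>)"

definition G1 :: "real \<Rightarrow> real \<Rightarrow> nat \<Rightarrow> nat \<Rightarrow> nat \<Rightarrow> real mat \<Rightarrow> real \<Rightarrow> real \<Rightarrow> real mat" where
  "G1 a b n0 n1 n2 B s \<theta> =
     (   0\<^sub>m n0 n0 @\<^sub>c 0\<^sub>m n0 n1 @\<^sub>c 0\<^sub>m n0 n2
      @\<^sub>r 0\<^sub>m n1 n0 @\<^sub>c 1\<^sub>m n1    @\<^sub>c 0\<^sub>m n1 n2
      @\<^sub>r 0\<^sub>m n2 n0 @\<^sub>c 0\<^sub>m n2 n1 @\<^sub>c ((s - \<theta>) \<cdot>\<^sub>m 1\<^sub>m n2))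
     + G2 a b n0 n1 n2 B s \<theta>"

definition G3 :: "nat \<Rightarrow> nat \<Rightarrow> nat \<Rightarrow> real \<Rightarrow> real mat" where
  "G3 n0 n1 n2 s =
        0\<^sub>m n1 n0 @\<^sub>c 1\<^sub>m n1    @\<^sub>c 0\<^sub>m n1 n2
     @\<^sub>r 0\<^sub>m n2 n0 @\<^sub>c 0\<^sub>m n2 n1 @\<^sub>c 0\<^sub>m n2 n2"

definition G5 :: "real \<Rightarrow> real \<Rightarrow> nat \<Rightarrow> nat \<Rightarrow> nat \<Rightarrow> real mat \<Rightarrow> real \<Rightarrow> real \<Rightarrow> real mat" where
  "G5 a b n0 n1 n2 B s \<theta> =
     - (V_mat n1 n2 * mat_inv (B * T_mat a b n1 n2) * B * Q_mat b n0 n1 n2 s \<theta>)"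

definition G4 :: "real \<Rightarrow> real \<Rightarrow> nat \<Rightarrow> nat \<Rightarrow> nat \<Rightarrow> real mat \<Rightarrow> real \<Rightarrow> real \<Rightarrow> real mat" where
  "G4 a b n0 n1 n2 B s \<theta> =
     (   0\<^sub>m n1 n0 @\<^sub>c 0\<^sub>m n1 n1 @\<^sub>c 0\<^sub>m n1 n2
      @\<^sub>r 0\<^sub>m n2 n0 @\<^sub>c 0\<^sub>m n2 n1 @\<^sub>c 1\<^sub>m n2)
     + G5 a b n0 n1 n2 B s \<theta>"

definition T_op :: "real \<Rightarrow> real \<Rightarrow> nat \<Rightarrow> nat \<Rightarrow> nat \<Rightarrow> real mat \<Rightarrow> vop" where
  "T_op a b n0 n1 n2 B =
     PI_op a b (n0 + n1 + n2) (G0 n0 n1 n2) (G1 a b n0 n1 n2 B) (G2 a b n0 n1 n2 B)"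

definition H0 :: "nat \<Rightarrow> nat \<Rightarrow> nat \<Rightarrow> (real \<Rightarrow> real mat) \<Rightarrow> (real \<Rightarrow> real mat) \<Rightarrow>
    (real \<Rightarrow> real mat) \<Rightarrow> real \<Rightarrow> real mat" where
  "H0 n0 n1 n2 A0 A1 A2 s =
     A0 s * G0 n0 n1 n2 s + A1 s * G3 n0 n1 n2 s
     + (0\<^sub>m (n0 + n1 + n2) n0 @\<^sub>c 0\<^sub>m (n0 + n1 + n2) n1 @\<^sub>c A2 s)"

definition H1 :: "real \<Rightarrow> real \<Rightarrow> nat \<Rightarrow> nat \<Rightarrow> nat \<Rightarrow> real mat \<Rightarrow>
    (real \<Rightarrow> real mat) \<Rightarrow> (real \<Rightarrow> real mat) \<Rightarrow> real \<Rightarrow> real \<Rightarrow> real mat" where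
  "H1 a b n0 n1 n2 B A0 A1 s \<theta> =
     A0 s * G1 a b n0 n1 n2 B s \<theta> + A1 s * G4 a b n0 n1 n2 B s \<theta>"

definition H2 :: "real \<Rightarrow> real \<Rightarrow> nat \<Rightarrow> nat \<Rightarrow> nat \<Rightarrow> real mat \<Rightarrow>
    (real \<Rightarrow> real mat) \<Rightarrow> (real \<Rightarrow> real mat) \<Rightarrow> real \<Rightarrow> real \<Rightarrow> real mat" where
  "H2 a b n0 n1 n2 B A0 A1 s \<theta> =
     A0 s * G2 a b n0 n1 n2 B s \<theta> + A1 s * G5 a b n0 n1 n2 B s \<theta>"

definition A_op :: "real \<Rightarrow> real \<Rightarrow> nat \<Rightarrow> nat \<Rightarrow> nat \<Rightarrow> real mat \<Rightarrow> (real \<Rightarrow> real mat) \<Rightarrow>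
    (real \<Rightarrow> real mat) \<Rightarrow> (real \<Rightarrow> real mat) \<Rightarrow> vop" where
  "A_op a b n0 n1 n2 B A0 A1 A2 =
     PI_op a b (n0 + n1 + n2) (H0 n0 n1 n2 A0 A1 A2)
       (H1 a b n0 n1 n2 B A0 A1) (H2 a b n0 n1 n2 B A0 A1)"


subsection \<open>The space \<open>X\<close> and solutions of the PDE\<close>

text \<open>A triple \<open>(x\<^sub>0, x\<^sub>1, x\<^sub>2)\<close> is represented by the stacked function with values in
  \<open>\<real>\<^sup>n\<close>, \<open>n = n0 + n1 + n2\<close>. Its components are \<open>block 0 n0 x\<close>, \<open>block n0 n1 x\<close> and
  \<open>block (n0 + n1) n2 x\<close>.\<close>

definition block :: "nat \<Rightarrow> nat \<Rightarrow> vfun \<Rightarrow> vfun" where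
  "block off m x = (\<lambda>s. vec m (\<lambda>i. x s $ (off + i)))"

definition X_space :: "real \<Rightarrow> real \<Rightarrow> nat \<Rightarrow> nat \<Rightarrow> nat \<Rightarrow> real mat \<Rightarrow> vfun set" where
  "X_space a b n0 n1 n2 B = {x.
     (\<forall>s\<in>{a..b}. x s \<in> carrier_vec (n0 + n1 + n2)) \<and>
     block 0 n0 x \<in> L2_space a b n0 \<and>
     block n0 n1 x \<in> sobolev a b 1 n1 \<and>
     block (n0 + n1) n2 x \<in> sobolev a b 2 n2 \<and>
     (let x1 = cont_rep a b n1 (block n0 n1 x);
          x2 = cont_rep a b n2 (block (n0 + n1) n2 x);
          x2s = cont_rep a b n2 (wderiv a b n2 1 (block (n0 + n1) n2 x))
      in B *\<^sub>v (x1 a @\<^sub>v x1 b @\<^sub>v x2 a @\<^sub>v x2 b @\<^sub>v x2s a @\<^sub>v x2s b) = 0\<^sub>v (n1 + 2 * n2))}"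

definition X_inner :: "real \<Rightarrow> real \<Rightarrow> nat \<Rightarrow> nat \<Rightarrow> nat \<Rightarrow> vfun \<Rightarrow> vfun \<Rightarrow> real" where
  "X_inner a b n0 n1 n2 x y =
     L2_inner a b (block 0 n0 x) (block 0 n0 y)
     + L2_inner a b (wderiv a b n1 1 (block n0 n1 x)) (wderiv a b n1 1 (block n0 n1 y))
     + L2_inner a b (wderiv a b n2 2 (block (n0 + n1) n2 x)) (wderiv a b n2 2 (block (n0 + n1) n2 y))"

definition X_norm :: "real \<Rightarrow> real \<Rightarrow> nat \<Rightarrow> nat \<Rightarrow> nat \<Rightarrow> vfun \<Rightarrow> real" where
  "X_norm a b n0 n1 n2 x = sqrt (X_inner a b n0 n1 n2 x x)"

text \<open>\<open>v \<in> X\<close> is the Frechet derivative at \<open>t\<close> of the curve \<open>x : [0,\<infinity>) \<rightarrow> X\<close>, i.e. the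
  derivative is the linear map \<open>h \<mapsto> h v\<close> (one-sided at \<open>t = 0\<close>).\<close>

definition has_X_derivative :: "real \<Rightarrow> real \<Rightarrow> nat \<Rightarrow> nat \<Rightarrow> nat \<Rightarrow> real mat \<Rightarrow>
    (real \<Rightarrow> vfun) \<Rightarrow> vfun \<Rightarrow> real \<Rightarrow> bool" where
  "has_X_derivative a b n0 n1 n2 B x v t \<longleftrightarrow>
     v \<in> X_space a b n0 n1 n2 B \<and>
     ((\<lambda>\<tau>. X_norm a b n0 n1 n2 (\<lambda>s. x \<tau> s - x t s - (\<tau> - t) \<cdot>\<^sub>v v s) / \<bar>\<tau> - t\<bar>)
        \<longlongrightarrow> 0) (at t within {0..})"

definition PDE_solution :: "real \<Rightarrow> real \<Rightarrow> nat \<Rightarrow> nat \<Rightarrow> nat \<Rightarrow> real mat \<Rightarrow>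
    (real \<Rightarrow> real mat) \<Rightarrow> (real \<Rightarrow> real mat) \<Rightarrow> (real \<Rightarrow> real mat) \<Rightarrow>
    vfun \<Rightarrow> (real \<Rightarrow> vfun) \<Rightarrow> bool" where
  "PDE_solution a b n0 n1 n2 B A0 A1 A2 xinit x \<longleftrightarrow>
     L2_eq a b (x 0) xinit \<and>
     (\<forall>t\<ge>0. x t \<in> X_space a b n0 n1 n2 B) \<and>
     (\<forall>t\<ge>0. \<exists>v. has_X_derivative a b n0 n1 n2 B x v t \<and>
        L2_eq a b v (\<lambda>s.
          A0 s *\<^sub>v x t s
          + A1 s *\<^sub>v (wderiv a b n1 1 (block n0 n1 (x t)) s
                     @\<^sub>v wderiv a b n2 1 (block (n0 + n1) n2 (x t)) s)
          + A2 s *\<^sub>v wderiv a b n2 2 (block (n0 + n1) n2 (x t)) s))"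

end

theory Submission
  imports Defs "HOL-Real_Asymp.Real_Asymp"
begin

text \<open>Collect the highest derivatives of \<open>x \<in> X\<close> in \<open>hat x = (x\<^sub>0, \<partial>\<^sub>s x\<^sub>1, \<partial>\<^sub>s\<^sup>2 x\<^sub>2)\<close>. By Taylor's formula
  the boundary values are \<open>T c\<close> plus an integral of \<open>Q (hat x)\<close>, where \<open>c = (x\<^sub>1(a), x\<^sub>2(a), \<partial>\<^sub>s x\<^sub>2(a))\<close>;
  since \<open>B T\<close> is invertible, the boundary condition determines \<open>c\<close>, and one obtains
  \<open>x = \<T> (hat x)\<close>, while \<open>\<A> (hat x)\<close> is the right-hand side of the PDE. The Lyapunov function
  \<open>V(t) = \<langle>x(t), \<P> x(t)\<rangle>\<close> then satisfies \<open>V' = \<langle>\<A> (hat x), \<P> \<T> (hat x)\<rangle> + \<langle>\<T> (hat x), \<P> \<A> (hat x)\<rangle>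
  \<le> - \<delta> \<parallel>x\<parallel>\<^sup>2 \<le> - (\<delta>/\<zeta>) V\<close>, and \<open>\<alpha> \<parallel>x\<parallel>\<^sup>2 \<le> V \<le> \<zeta> \<parallel>x\<parallel>\<^sup>2\<close> gives the estimate.\<close>

section \<open>Integral operators with bounded kernels\<close>

text \<open>Three obstacles shape the proof. First, \<open>L2_adj\<close> picks some operator that
  satisfies the duality relation, so such an operator has to be exhibited for \<open>P\<close>,
  \<open>T\<close> and \<open>A\<close> before the operator inequality can be used at all. For
  integral operators this is Fubini's theorem, for kernels that are only Lebesgue measurable on the
  square. Second, boundary values are values of continuous representatives, so Taylor's formula has
  to be derived from weak derivatives. That rests on the lemma of du Bois-Reymond, hence on a supply
  of test functions. Third, the solution is differentiated in the norm of X while V is formed in L2;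
  the boundedness of T carries the derivative over. For \<open>A\<close>, the adjoint comes from
  splitting the operator as A0 T + A1 R + [0 0 A2], where R recovers the first derivatives.
  Operators act on representatives and are linear only up to null sets, so most identities are
  stated after pairing with a fixed function.\<close>

abbreviation Leb :: "real \<Rightarrow> real \<Rightarrow> real measure" where
  "Leb a b \<equiv> lebesgue_on {a..b}"

section \<open>Borel representatives of Lebesgue measurable functions\<close>

lemma borel_representative:
  fixes f :: "'a::euclidean_space \<Rightarrow> real"
  assumes "f \<in> borel_measurable (lebesgue_on S)" "S \<in> sets lebesgue"
  obtains g where "g \<in> borel_measurable borel"
    "AE x in lborel. (if x \<in> S then f x else 0) = g x"
proof -
  have "(\<lambda>x. if x \<in> S then f x else 0) \<in> borel_measurable lebesgue"
    using assms by (rule borel_measurable_if_I)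
  from completion_ex_borel_measurable_real[OF this] show ?thesis
    using that by auto
qed

text \<open>Measurability, integrability and the integral depend on the zero extension only up to
  null sets. Questions about Lebesgue functions on S can thus be moved to a Borel function on the
  whole space, where product measures are at hand.\<close>

lemma lebesgue_on_representative:
  fixes f :: "'a::euclidean_space \<Rightarrow> real"
  assumes g: "g \<in> borel_measurable borel" and S: "S \<in> sets lebesgue"
    and ae: "AE x in lborel. (if x \<in> S then f x else 0) = g x"
  shows "f \<in> borel_measurable (lebesgue_on S)"
    and "(LINT x|lebesgue_on S. f x) = (LINT x|lborel. g x)"
    and "integrable (lebesgue_on S) f \<longleftrightarrow> integrable lborel g"
proof -
  let ?f = "\<lambda>x. if x \<in> S then f x else 0"
  have g': "g \<in> borel_measurable lebesgue"
    using g by (simp add: measurable_completion)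
  have ae': "AE x in lebesgue. g x = ?f x"
    using AE_completion[OF ae] by eventually_elim (rule sym)
  \<comment> \<open>Lebesgue measure is complete, so agreeing almost everywhere with a measurable
    function is enough.\<close>
  have m: "?f \<in> borel_measurable lebesgue"
    by (rule borel_measurable_AE[OF g' ae'])
  then show "f \<in> borel_measurable (lebesgue_on S)"
    by (rule borel_measurable_if_D)
  have e: "(\<lambda>x. indicat_real S x * f x) = ?f"
    by (auto simp: indicator_def)
  have "(LINT x|lebesgue_on S. f x) = (LINT x|lebesgue. ?f x)"
    using S by (subst integral_restrict_space) (auto simp: e)
  also have "\<dots> = (LINT x|lebesgue. g x)"
    by (rule integral_cong_AE) (use m g' AE_completion[OF ae] in auto)
  also have "\<dots> = (LINT x|lborel. g x)"
    using g by (intro integral_completion) auto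
  finally show "(LINT x|lebesgue_on S. f x) = (LINT x|lborel. g x)" .
  have "integrable (lebesgue_on S) f \<longleftrightarrow> integrable lebesgue ?f"
    using S by (subst integrable_restrict_space) (auto simp: e)
  also have "\<dots> \<longleftrightarrow> integrable lebesgue g"
    by (rule integrable_cong_AE) (use m g' AE_completion[OF ae] in auto)
  also have "\<dots> \<longleftrightarrow> integrable lborel g"
    using g by (intro integrable_completion) auto
  finally show "integrable (lebesgue_on S) f \<longleftrightarrow> integrable lborel g" .
qed

lemma Icc_sets_lebesgue [simp]: "{a..b::real} \<in> sets lebesgue"
  and square_sets_lebesgue [simp]: "{a..b::real} \<times> {c..d::real} \<in> sets lebesgue"
proof -
  show "{a..b} \<in> sets lebesgue" by (simp add: sets_completionI_sets)
  have "{a..b} \<times> {c..d} = cbox (a, c) (b, d)" by (auto simp: cbox_Pair_eq)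
  then show "{a..b} \<times> {c..d} \<in> sets lebesgue" by (simp add: sets_completionI_sets)
qed

lemma integral_lebesgue_on_if:
  fixes f :: "'a::euclidean_space \<Rightarrow> real"
  assumes "S \<in> sets lebesgue" "R \<in> sets lebesgue" "R \<subseteq> S"
  shows "(LINT x|lebesgue_on R. f x) = (LINT x|lebesgue_on S. (if x \<in> R then f x else 0))"
    and "integrable (lebesgue_on R) f \<longleftrightarrow> integrable (lebesgue_on S) (\<lambda>x. if x \<in> R then f x else 0)"
proof -
  have e: "(\<lambda>x. indicat_real S x *\<^sub>R (if x \<in> R then f x else 0)) = (\<lambda>x. indicat_real R x *\<^sub>R f x)"
    using assms(3) by (auto simp: indicator_def fun_eq_iff)
  note e = e[simplified]
  show "(LINT x|lebesgue_on R. f x) = (LINT x|lebesgue_on S. (if x \<in> R then f x else 0))"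
    using assms by (subst (1 2) integral_restrict_space) (auto simp: e)
  show "integrable (lebesgue_on R) f \<longleftrightarrow> integrable (lebesgue_on S) (\<lambda>x. if x \<in> R then f x else 0)"
    using assms by (subst (1 2) integrable_restrict_space) (auto simp: e)
qed

lemma integrable_representative:
  fixes f :: "'a::euclidean_space \<Rightarrow> real"
  assumes "integrable (lebesgue_on S) f" "S \<in> sets lebesgue"
  obtains g where "g \<in> borel_measurable borel" "integrable lborel g"
    "AE x in lborel. (if x \<in> S then f x else 0) = g x"
proof -
  obtain g where g: "g \<in> borel_measurable borel"
    and ae: "AE x in lborel. (if x \<in> S then f x else 0) = g x"
    by (rule borel_representative[OF borel_measurable_integrable[OF assms(1)] assms(2)])
  from lebesgue_on_representative(3)[OF g assms(2) ae] assms(1) show ?thesis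
    by (intro that[OF g _ ae]) simp
qed

section \<open>Kernel operators and their adjoints\<close>

definition kernel_op :: "real \<Rightarrow> real \<Rightarrow> (real \<Rightarrow> real \<Rightarrow> real) \<Rightarrow> (real \<Rightarrow> real) \<Rightarrow> real \<Rightarrow> real" where
  "kernel_op a b K f s = (LINT \<theta>|Leb a b. K s \<theta> * f \<theta>)"

definition bounded_kernel :: "real \<Rightarrow> real \<Rightarrow> (real \<Rightarrow> real \<Rightarrow> real) \<Rightarrow> bool" where
  "bounded_kernel a b K \<longleftrightarrow>
     (\<lambda>(s, \<theta>). K s \<theta>) \<in> borel_measurable (lebesgue_on ({a..b} \<times> {a..b})) \<and>
     (\<exists>C. \<forall>s\<in>{a..b}. \<forall>\<theta>\<in>{a..b}. \<bar>K s \<theta>\<bar> \<le> C)"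

lemma bounded_kernel_representative:
  assumes "bounded_kernel a b K"
  obtains k C where "k \<in> borel_measurable borel" "\<And>u. \<bar>k u\<bar> \<le> C"
    "AE (s, \<theta>) in lborel. (if s \<in> {a..b} \<and> \<theta> \<in> {a..b} then K s \<theta> else 0) = k (s, \<theta>)"
proof -
  from assms obtain C where C: "\<forall>s\<in>{a..b}. \<forall>\<theta>\<in>{a..b}. \<bar>K s \<theta>\<bar> \<le> C"
    by (auto simp: bounded_kernel_def)
  from assms have "(\<lambda>(s, \<theta>). K s \<theta>) \<in> borel_measurable (lebesgue_on ({a..b} \<times> {a..b}))"
    by (auto simp: bounded_kernel_def)
  from borel_representative[OF this] obtain k
    where k[measurable]: "k \<in> borel_measurable borel"
      and ae: "AE x in lborel. (if x \<in> {a..b} \<times> {a..b} then (\<lambda>(s, \<theta>). K s \<theta>) x else 0) = k x"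
    by auto
  \<comment> \<open>On the null set where it differs from the kernel the Borel representative is
    uncontrolled; clamping makes it bounded everywhere. The level is |C|, since C may be negative
    when the square is empty.\<close>
  let ?k = "\<lambda>u. max (- \<bar>C\<bar>) (min \<bar>C\<bar> (k u))"
  show ?thesis
  proof
    show "?k \<in> borel_measurable borel" by measurable
    show "\<bar>?k u\<bar> \<le> \<bar>C\<bar>" for u by auto
    show "AE (s, \<theta>) in lborel. (if s \<in> {a..b} \<and> \<theta> \<in> {a..b} then K s \<theta> else 0) = ?k (s, \<theta>)"
      using ae
    proof eventually_elim
      case (elim x)
      obtain s \<theta> where x: "x = (s, \<theta>)" by force
      have "\<bar>k x\<bar> \<le> \<bar>C\<bar>"
        using elim C[rule_format, of s \<theta>] x by (cases "s \<in> {a..b} \<and> \<theta> \<in> {a..b}") auto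
      then have "?k x = k x" by auto
      with elim x show ?case by auto
    qed
  qed
qed

lemma AE_lborel_swap:
  fixes P :: "real \<Rightarrow> real \<Rightarrow> bool"
  assumes "AE (x, y) in lborel. P x y"
  shows "AE (y, x) in lborel. P x y"
proof -
  have "AE u in distr (lborel \<Otimes>\<^sub>M lborel) (lborel \<Otimes>\<^sub>M lborel) (\<lambda>(x, y). (y, x)). case_prod P (u :: real \<times> real)"
    using assms unfolding lborel_pair.distr_pair_swap[symmetric] by (simp only: lborel_prod)
  from AE_distrD[OF measurable_pair_swap' this]
  have "AE u in (lborel :: (real \<times> real) measure). case_prod P (case u of (x, y) \<Rightarrow> (y, x))"
    unfolding lborel_prod .
  then show ?thesis
    by eventually_elim auto
qed

lemma AE_lborel_pair:
  assumes "AE (x::real, y::real) in lborel. P x y"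
  shows "AE x in lborel. AE y in lborel. P x y"
  using lborel_pair.AE_pair[of "case_prod P"] assms unfolding lborel_prod by simp

lemma borel_measurable_swap:
  fixes k :: "real \<times> real \<Rightarrow> real"
  assumes "k \<in> borel_measurable borel"
  shows "(\<lambda>(s, \<theta>). k (\<theta>, s)) \<in> borel_measurable borel"
  unfolding case_prod_beta
  by (rule measurable_compose[OF borel_measurable_continuous_onI assms]) (intro continuous_intros)

lemma bounded_kernel_swap:
  assumes "bounded_kernel a b K"
  shows "bounded_kernel a b (\<lambda>s \<theta>. K \<theta> s)"
proof -
  obtain k C
    where k[measurable]: "k \<in> borel_measurable borel" and "\<And>u. \<bar>k u\<bar> \<le> C"
      and ae: "AE (s, \<theta>) in lborel. (if s \<in> {a..b} \<and> \<theta> \<in> {a..b} then K s \<theta> else 0) = k (s, \<theta>)"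
    using bounded_kernel_representative[OF assms] by blast
  have "(\<lambda>(s, \<theta>). K \<theta> s) \<in> borel_measurable (lebesgue_on ({a..b} \<times> {a..b}))"
  proof (rule lebesgue_on_representative(1))
    show "(\<lambda>(s, \<theta>). k (\<theta>, s)) \<in> borel_measurable borel"
      using k by (rule borel_measurable_swap)
    show "AE x in lborel. (if x \<in> {a..b} \<times> {a..b} then case x of (s, \<theta>) \<Rightarrow> K \<theta> s else 0)
        = (case x of (s, \<theta>) \<Rightarrow> k (\<theta>, s))"
      using AE_lborel_swap[OF ae] by eventually_elim (auto split: if_splits)
  qed simp
  with assms show ?thesis by (auto simp: bounded_kernel_def)
qed

text \<open>For almost every s the sections of \<open>k\<close> and \<open>K\<close> agree almost
  everywhere, so the two integrals agree. For almost every s outside the interval the section of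
  \<open>k\<close> vanishes almost everywhere, so the right-hand side represents the zero
  extension.\<close>

lemma kernel_op_representative:
  assumes k[measurable]: "k \<in> borel_measurable borel" and kC: "\<And>u. \<bar>k u\<bar> \<le> C"
    and ae: "AE (s, \<theta>) in lborel. (if s \<in> {a..b} \<and> \<theta> \<in> {a..b} then K s \<theta> else 0) = k (s, \<theta>)"
    and f'[measurable]: "f' \<in> borel_measurable borel"
    and aef: "AE \<theta> in lborel. (if \<theta> \<in> {a..b} then f \<theta> else 0) = f' \<theta>"
    and int: "integrable lborel f'"
  shows "AE s in lborel. (if s \<in> {a..b} then kernel_op a b K f s else 0) = (LINT \<theta>|lborel. k (s, \<theta>) * f' \<theta>)"
    and "AE s in Leb a b. integrable (Leb a b) (\<lambda>\<theta>. K s \<theta> * f \<theta>)"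
proof -
  have sec[measurable]: "(\<lambda>\<theta>. k (s, \<theta>)) \<in> borel_measurable borel" for s
    using k by (rule measurable_compose[OF borel_measurable_continuous_onI, rotated]) (intro continuous_intros)
  have I: "integrable lborel (\<lambda>\<theta>. k (s, \<theta>) * f' \<theta>)" for s
    by (rule Bochner_Integration.integrable_bound[OF integrable_mult_right[OF integrable_abs[OF int], of C]])
      (auto intro!: AE_I2 simp: abs_mult mult_right_mono order_trans[OF kC abs_ge_self])
  have *: "AE s in lborel. (if s \<in> {a..b} then kernel_op a b K f s = (LINT \<theta>|lborel. k (s, \<theta>) * f' \<theta>)
      \<and> integrable (Leb a b) (\<lambda>\<theta>. K s \<theta> * f \<theta>) else (LINT \<theta>|lborel. k (s, \<theta>) * f' \<theta>) = 0)"
    using AE_lborel_pair[OF ae]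
  proof eventually_elim
    case (elim s)
    show ?case
    proof (cases "s \<in> {a..b}")
      case True
      have "AE \<theta> in lborel. (if \<theta> \<in> {a..b} then K s \<theta> * f \<theta> else 0) = k (s, \<theta>) * f' \<theta>"
        using elim aef by eventually_elim (use True in \<open>auto split: if_splits\<close>)
      from lebesgue_on_representative(2,3)[OF _ _ this] True I show ?thesis
        by (simp add: kernel_op_def)
    next
      case False
      have "AE \<theta> in lborel. k (s, \<theta>) * f' \<theta> = 0"
        using elim by eventually_elim (use False in auto)
      then have "(LINT \<theta>|lborel. k (s, \<theta>) * f' \<theta>) = (LINT \<theta>::real|lborel. 0)"
        by (intro integral_cong_AE) auto
      with False show ?thesis by auto
    qed
  qed
  show "AE s in lborel. (if s \<in> {a..b} then kernel_op a b K f s else 0) = (LINT \<theta>|lborel. k (s, \<theta>) * f' \<theta>)"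
    using * by eventually_elim (auto split: if_splits)
  show "AE s in Leb a b. integrable (Leb a b) (\<lambda>\<theta>. K s \<theta> * f \<theta>)"
    unfolding AE_restrict_space_iff[of "{a..b}" lebesgue, simplified] AE_completion_iff
    using * by eventually_elim (auto split: if_splits)
qed

text \<open>A parameter integral of a jointly Borel function is measurable in the parameter, and
  \<open>kernel_op\<close> agrees with such an integral almost everywhere.\<close>

lemma kernel_op_properties:
  assumes K: "bounded_kernel a b K" and f: "integrable (Leb a b) f"
  shows kernel_op_measurable: "kernel_op a b K f \<in> borel_measurable (Leb a b)"
    and kernel_op_integrable: "AE s in Leb a b. integrable (Leb a b) (\<lambda>\<theta>. K s \<theta> * f \<theta>)"
proof -
  obtain k C
    where k[measurable]: "k \<in> borel_measurable borel" and kC: "\<And>u. \<bar>k u\<bar> \<le> C"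
      and ae: "AE (s, \<theta>) in lborel. (if s \<in> {a..b} \<and> \<theta> \<in> {a..b} then K s \<theta> else 0) = k (s, \<theta>)"
    using bounded_kernel_representative[OF K] by blast
  obtain f' where f'[measurable]: "f' \<in> borel_measurable borel" and intf: "integrable lborel f'"
    and aef: "AE \<theta> in lborel. (if \<theta> \<in> {a..b} then f \<theta> else 0) = f' \<theta>"
    by (rule integrable_representative[OF f Icc_sets_lebesgue])
  note R = kernel_op_representative[OF k kC ae f' aef intf]
  show "AE s in Leb a b. integrable (Leb a b) (\<lambda>\<theta>. K s \<theta> * f \<theta>)"
    by (rule R(2))
  have kp[measurable]: "k \<in> borel_measurable (borel \<Otimes>\<^sub>M borel)"
    using k by (simp add: borel_prod)
  show "kernel_op a b K f \<in> borel_measurable (Leb a b)"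
    by (rule lebesgue_on_representative(1)[OF _ _ R(1)]) simp_all
qed

text \<open>Fubini's theorem; the sections of a Lebesgue measurable kernel are only almost everywhere
  measurable, so the argument runs on Borel representatives.\<close>

lemma kernel_op_adjoint:
  assumes K: "bounded_kernel a b K" and f: "integrable (Leb a b) f"
    and g: "integrable (Leb a b) g"
  shows "(LINT s|Leb a b. kernel_op a b K f s * g s)
       = (LINT s|Leb a b. f s * kernel_op a b (\<lambda>s \<theta>. K \<theta> s) g s)"
proof -
  obtain k C
    where k[measurable]: "k \<in> borel_measurable borel" and kC: "\<And>u. \<bar>k u\<bar> \<le> C"
      and ae: "AE (s, \<theta>) in lborel. (if s \<in> {a..b} \<and> \<theta> \<in> {a..b} then K s \<theta> else 0) = k (s, \<theta>)"
    using bounded_kernel_representative[OF K] by blast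
  obtain f' where f'[measurable]: "f' \<in> borel_measurable borel" and intf: "integrable lborel f'"
    and aef: "AE \<theta> in lborel. (if \<theta> \<in> {a..b} then f \<theta> else 0) = f' \<theta>"
    by (rule integrable_representative[OF f Icc_sets_lebesgue])
  obtain g' where g'[measurable]: "g' \<in> borel_measurable borel" and intg: "integrable lborel g'"
    and aeg: "AE \<theta> in lborel. (if \<theta> \<in> {a..b} then g \<theta> else 0) = g' \<theta>"
    by (rule integrable_representative[OF g Icc_sets_lebesgue])
  have kp[measurable]: "k \<in> borel_measurable (borel \<Otimes>\<^sub>M borel)"
    using k by (simp add: borel_prod)
  have k2: "(\<lambda>(s, \<theta>). k (\<theta>, s)) \<in> borel_measurable borel"
    using k by (rule borel_measurable_swap)
  have ae2: "AE (s, \<theta>) in lborel. (if s \<in> {a..b} \<and> \<theta> \<in> {a..b} then K \<theta> s else 0) = (\<lambda>(s, \<theta>). k (\<theta>, s)) (s, \<theta>)"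
    using AE_lborel_swap[OF ae] by eventually_elim (auto split: if_splits)
  note R1 = kernel_op_representative(1)[OF k kC ae f' aef intf]
  have kC2: "\<bar>(\<lambda>(s, \<theta>). k (\<theta>, s)) u\<bar> \<le> C" for u
    using kC by (cases u) auto
  note R2 = kernel_op_representative(1)[OF k2 kC2 ae2 g' aeg intg]
  let ?F = "\<lambda>s. LINT \<theta>|lborel. k (s, \<theta>) * f' \<theta>"
  let ?G = "\<lambda>\<theta>. LINT s|lborel. k (s, \<theta>) * g' s"
  have "(LINT s|Leb a b. kernel_op a b K f s * g s) = (LINT s|lborel. ?F s * g' s)"
    by (rule lebesgue_on_representative(2))
      (measurable, simp, use R1 aeg in \<open>eventually_elim, auto split: if_splits\<close>)
  also have "\<dots> = (LINT s|lborel. LINT \<theta>|lborel. k (s, \<theta>) * f' \<theta> * g' s)"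
    by (simp add: mult.commute)
  also have "\<dots> = (LINT \<theta>|lborel. LINT s|lborel. k (s, \<theta>) * f' \<theta> * g' s)"
  proof (rule lborel_pair.Fubini_integral[symmetric])
    \<comment> \<open>Integrable functions of separate variables have an integrable product on the
      plane; the bounded kernel then costs only the factor \<open>C\<close>.\<close>
    have fg: "integrable (lborel \<Otimes>\<^sub>M lborel) (\<lambda>(s, \<theta>). \<bar>g' s\<bar> * \<bar>f' \<theta>\<bar>)"
    proof (rule lborel_pair.Fubini_integrable)
      show "integrable lborel (\<lambda>x. LINT y|lborel. norm (case (x, y) of (s, \<theta>) \<Rightarrow> \<bar>g' s\<bar> * \<bar>f' \<theta>\<bar>))"
        using intg intf by (simp add: integrable_abs abs_mult)
    qed (use intf in \<open>auto simp: case_prod_beta\<close>)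
    show "integrable (lborel \<Otimes>\<^sub>M lborel) (\<lambda>(s, \<theta>). k (s, \<theta>) * f' \<theta> * g' s)"
    proof (rule Bochner_Integration.integrable_bound[OF integrable_mult_right[OF fg, of C]])
      show "AE x in lborel \<Otimes>\<^sub>M lborel. norm (case x of (s, \<theta>) \<Rightarrow> k (s, \<theta>) * f' \<theta> * g' s)
          \<le> norm (C * (case x of (s, \<theta>) \<Rightarrow> \<bar>g' s\<bar> * \<bar>f' \<theta>\<bar>))"
      proof (rule AE_I2)
        fix x :: "real \<times> real"
        obtain s \<theta> where x: "x = (s, \<theta>)" by force
        have "C \<ge> 0" using kC[of x] by linarith
        then show "norm (case x of (s, \<theta>) \<Rightarrow> k (s, \<theta>) * f' \<theta> * g' s)
            \<le> norm (C * (case x of (s, \<theta>) \<Rightarrow> \<bar>g' s\<bar> * \<bar>f' \<theta>\<bar>))"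
          using mult_right_mono[OF kC[of x], of "\<bar>f' \<theta>\<bar> * \<bar>g' s\<bar>"]
          by (simp add: x abs_mult mult_ac)
      qed
    qed measurable
  qed
  also have "\<dots> = (LINT \<theta>|lborel. f' \<theta> * ?G \<theta>)"
    by (simp add: mult.assoc mult.left_commute)
  also have "\<dots> = (LINT s|Leb a b. f s * kernel_op a b (\<lambda>s \<theta>. K \<theta> s) g s)"
    by (rule lebesgue_on_representative(2)[symmetric])
      (measurable, simp, use R2 aef in \<open>eventually_elim, auto split: if_splits\<close>)
  finally show ?thesis .
qed

section \<open>Test functions\<close>

definition smooth :: "(real \<Rightarrow> real) \<Rightarrow> bool" where
  "smooth f \<longleftrightarrow> (\<forall>k x. (deriv ^^ k) f differentiable (at x))"

text \<open>By induction all iterated derivatives stay in S, so smoothness only requires a family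
  that contains a derivative of each of its members. No formula for a k-th derivative has to be
  written down.\<close>

lemma smooth_coinduct:
  assumes "f \<in> S" "\<And>f. f \<in> S \<Longrightarrow> (\<exists>f'\<in>S. \<forall>x. (f has_real_derivative f' x) (at x))"
  shows "smooth f"
proof -
  have "(deriv ^^ k) f \<in> S" for k
  proof (induction k)
    case (Suc k)
    from assms(2)[OF this] obtain f' where "f' \<in> S" "\<And>x. ((deriv ^^ k) f has_real_derivative f' x) (at x)"
      by blast
    moreover from this(2) have "deriv ((deriv ^^ k) f) = f'"
      by (intro ext DERIV_imp_deriv)
    ultimately show ?case by simp
  qed (use assms(1) in simp)
  with assms(2) show ?thesis
    unfolding smooth_def real_differentiable_def by blast
qed

lemma smooth_has_derivative:
  assumes "smooth f" shows "(f has_real_derivative deriv f x) (at x)"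
proof -
  have "f differentiable (at x)"
    using assms[unfolded smooth_def, rule_format, of 0 x] by simp
  then show ?thesis
    using DERIV_deriv_iff_real_differentiable by blast
qed

lemma smooth_deriv: "smooth f \<Longrightarrow> smooth (deriv f)"
  unfolding smooth_def by (metis comp_apply funpow_Suc_right)

lemma smooth_continuous_on: "smooth f \<Longrightarrow> continuous_on S f"
  by (meson DERIV_continuous_on smooth_has_derivative has_field_derivative_at_within)

lemma smooth_antideriv:
  assumes "smooth f'" "\<And>x. (f has_real_derivative f' x) (at x)"
  shows "smooth f"
proof -
  have d: "deriv f = f'" by (intro ext DERIV_imp_deriv assms(2))
  have "(deriv ^^ k) f differentiable (at x)" for k x
  proof (cases k)
    case 0 then show ?thesis using assms(2) real_differentiable_def by auto
  next
    case (Suc m) with assms(1) show ?thesis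
      by (simp add: funpow_Suc_right d smooth_def del: funpow.simps)
  qed
  then show ?thesis by (simp add: smooth_def)
qed

lemma smooth_linear:
  assumes "smooth f" "smooth g"
  shows "smooth (\<lambda>x. c * f x + d * g x)"
proof (rule smooth_coinduct)
  let ?S = "{\<lambda>x. c * f x + d * g x |f g. smooth f \<and> smooth g}"
  show "(\<lambda>x. c * f x + d * g x) \<in> ?S" using assms by blast
  fix h assume "h \<in> ?S"
  then obtain f g where h: "h = (\<lambda>x. c * f x + d * g x)" "smooth f" "smooth g" by blast
  show "\<exists>h'\<in>?S. \<forall>x. (h has_real_derivative h' x) (at x)"
  proof (rule bexI[of _ "\<lambda>x. c * deriv f x + d * deriv g x"])
    show "\<forall>x. (h has_real_derivative c * deriv f x + d * deriv g x) (at x)"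
      unfolding h(1) by (auto intro!: derivative_eq_intros smooth_has_derivative h)
  qed (use h smooth_deriv in blast)
qed

lemma smooth_affine:
  assumes "smooth f"
  shows "smooth (\<lambda>x. f (p * x + q))"
proof (rule smooth_coinduct)
  \<comment> \<open>The free factor \<open>c\<close> absorbs the inner derivative \<open>p\<close>
    that each differentiation produces.\<close>
  let ?S = "{\<lambda>x. c * f (p * x + q) |f c. smooth f}"
  show "(\<lambda>x. f (p * x + q)) \<in> ?S"
    using assms by (auto intro!: exI[of _ f] exI[of _ 1])
  fix h assume "h \<in> ?S"
  then obtain f c where h: "h = (\<lambda>x. c * f (p * x + q))" "smooth f" by blast
  show "\<exists>h'\<in>?S. \<forall>x. (h has_real_derivative h' x) (at x)"
  proof (rule bexI[of _ "\<lambda>x. c * p * deriv f (p * x + q)"])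
    show "\<forall>x. (h has_real_derivative c * p * deriv f (p * x + q)) (at x)"
      unfolding h(1)
      by (auto intro!: derivative_eq_intros DERIV_chain2[OF smooth_has_derivative[OF h(2)]])
  qed (use h smooth_deriv in blast)
qed

text \<open>The Leibniz rule turns a product into a sum of two products, so the family closed under
  differentiation consists of finite sums of products.\<close>

inductive_set product_sums :: "(real \<Rightarrow> real) set" where
  prod: "smooth f \<Longrightarrow> smooth g \<Longrightarrow> (\<lambda>x. f x * g x) \<in> product_sums"
| sum: "f \<in> product_sums \<Longrightarrow> g \<in> product_sums \<Longrightarrow> (\<lambda>x. f x + g x) \<in> product_sums"

lemma smooth_mult:
  assumes "smooth f" "smooth g"
  shows "smooth (\<lambda>x. f x * g x)"
proof (rule smooth_coinduct)
  show "(\<lambda>x. f x * g x) \<in> product_sums" using assms by (rule product_sums.prod)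
  fix h assume "h \<in> product_sums"
  then show "\<exists>h'\<in>product_sums. \<forall>x. (h has_real_derivative h' x) (at x)"
  proof induction
    case (prod f g)
    show ?case
    proof (rule bexI[of _ "\<lambda>x. deriv f x * g x + f x * deriv g x"])
      show "(\<lambda>x. deriv f x * g x + f x * deriv g x) \<in> product_sums"
        by (intro product_sums.intros smooth_deriv prod)
    qed (auto intro!: derivative_eq_intros smooth_has_derivative prod)
  next
    case (sum f g)
    then obtain f' g' where "f' \<in> product_sums" "g' \<in> product_sums"
      "\<forall>x. (f has_real_derivative f' x) (at x)" "\<forall>x. (g has_real_derivative g' x) (at x)" by blast
    then show ?case
      by (intro bexI[of _ "\<lambda>x. f' x + g' x"] product_sums.sum) (auto intro!: derivative_eq_intros)
  qed
qed

section \<open>Flat exponentials and plateau functions\<close>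

definition flat_exp :: "real poly \<Rightarrow> real \<Rightarrow> real" where
  "flat_exp p x = (if x > 0 then poly p (1 / x) * exp (- (1 / x)) else 0)"

lemma tendsto_poly_exp_0: "((\<lambda>y::real. poly p y * exp (- y)) \<longlongrightarrow> 0) at_top"
proof -
  have "((\<lambda>y. \<Sum>i\<le>degree p. coeff p i * (y ^ i / exp y)) \<longlongrightarrow> (\<Sum>i\<le>degree p. coeff p i * 0)) at_top"
    by (intro tendsto_sum tendsto_mult tendsto_const tendsto_power_div_exp_0)
  then show ?thesis
    by (simp add: poly_altdef sum_distrib_right exp_minus divide_inverse mult.assoc)
qed

text \<open>With y = 1/x, the function p(y) exp(-y) has x-derivative y^2 (p - p')(y) exp(-y).
  Carrying an arbitrary polynomial along closes the family under differentiation, so that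
  \<open>smooth_coinduct\<close> applies to exp(-1/x) extended by zero.\<close>

lemma flat_exp_has_derivative:
  "(flat_exp p has_real_derivative flat_exp ([:0, 0, 1:] * (p - pderiv p)) x) (at x)"
proof -
  let ?q = "[:0, 0, 1:] * (p - pderiv p)"
  consider "x > 0" | "x < 0" | "x = 0" by linarith
  then show ?thesis
  proof cases
    case 1
    have "((\<lambda>x. poly p (1 / x) * exp (- (1 / x))) has_real_derivative flat_exp ?q x) (at x)"
      using 1 by (auto intro!: derivative_eq_intros poly_DERIV[THEN DERIV_chain2]
        simp: flat_exp_def field_simps power2_eq_square)
    then show ?thesis
      by (rule has_field_derivative_transform_within_open[of _ _ _ "{0<..}"]) (use 1 in \<open>auto simp: flat_exp_def\<close>)
  next
    case 2
    have "((\<lambda>x. 0) has_real_derivative flat_exp ?q x) (at x)"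
      using 2 by (simp add: flat_exp_def)
    then show ?thesis
      by (rule has_field_derivative_transform_within_open[of _ _ _ "{..<0}"]) (use 2 in \<open>auto simp: flat_exp_def\<close>)
  next
    case 3
    \<comment> \<open>Dividing by h multiplies by y = 1/h, so the right difference quotient at 0 is
      again a polynomial times exp(-y), with y tending to infinity.\<close>
    have "((\<lambda>h. poly ([:0, 1:] * p) (inverse h) * exp (- inverse h)) \<longlongrightarrow> 0) (at_right 0)"
      using filterlim_compose[OF tendsto_poly_exp_0 filterlim_inverse_at_top_right] .
    then have r: "((\<lambda>h. flat_exp p h / h) \<longlongrightarrow> 0) (at_right 0)"
    proof (rule filterlim_cong[THEN iffD1, rotated -1, OF _ refl refl])
      show "\<forall>\<^sub>F h in at_right 0. poly ([:0, 1:] * p) (inverse h) * exp (- inverse h) = flat_exp p h / h"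
        by (auto simp: eventually_at_filter flat_exp_def field_simps)
    qed
    have l: "((\<lambda>h. flat_exp p h / h) \<longlongrightarrow> 0) (at_left 0)"
      by (rule tendsto_eventually) (auto simp: eventually_at_filter flat_exp_def)
    have "((\<lambda>h. flat_exp p h / h) \<longlongrightarrow> 0) (at 0)"
      using l r by (rule filterlim_split_at)
    then show ?thesis
      using 3 by (simp add: DERIV_def flat_exp_def)
  qed
qed

lemma smooth_flat_exp: "smooth (flat_exp p)"
  by (rule smooth_coinduct[of _ "range flat_exp"]) (auto intro: flat_exp_has_derivative)

text \<open>A smooth approximation of the indicator of the open interval from c to d. The factor n
  steepens the flanks. The shift by -1 puts the support into [c + 1/n, d - 1/n], which keeps it away
  from the endpoints even for c = a and d = b.\<close>

definition plateau :: "real \<Rightarrow> real \<Rightarrow> nat \<Rightarrow> real \<Rightarrow> real" where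
  "plateau c d n x = flat_exp 1 (real n * (x - c) - 1) * flat_exp 1 (real n * (d - x) - 1)"

lemma test_function_iff:
  "test_function a b \<phi> \<longleftrightarrow> smooth \<phi> \<and> (\<exists>c d. a < c \<and> d < b \<and> (\<forall>x. x \<notin> {c..d} \<longrightarrow> \<phi> x = 0))"
  by (simp add: test_function_def smooth_def)

lemma test_function_plateau:
  assumes "a \<le> c" "d \<le> b" "n > 0"
  shows "test_function a b (plateau c d n)"
proof -
  have "smooth (\<lambda>x. flat_exp 1 (real n * x + (- real n * c - 1)) * flat_exp 1 (- real n * x + (real n * d - 1)))"
    by (intro smooth_mult smooth_affine smooth_flat_exp)
  also have "(\<lambda>x. flat_exp 1 (real n * x + (- real n * c - 1)) * flat_exp 1 (- real n * x + (real n * d - 1)))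
      = plateau c d n"
    by (auto simp: plateau_def fun_eq_iff algebra_simps)
  finally have "smooth (plateau c d n)" .
  moreover have "plateau c d n x = 0" if "x \<notin> {c + 1 / n..d - 1 / n}" for x
  proof -
    have "real n * (x - c) - 1 \<le> 0 \<or> real n * (d - x) - 1 \<le> 0"
      using that assms(3) by (auto simp: field_simps not_le)
    then show ?thesis by (auto simp: plateau_def flat_exp_def)
  qed
  moreover have "0 < 1 / real n" using assms(3) by simp
  then have "a < c + 1 / n" "d - 1 / n < b"
    using assms(1,2) by linarith+
  ultimately show ?thesis
    unfolding test_function_iff by blast
qed

lemma flat_exp_1_tendsto:
  "(\<lambda>n. flat_exp 1 (real n * y - 1)) \<longlonglongrightarrow> (if y > 0 then 1 else 0)"
proof (cases "y > 0")
  case True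
  have lim: "filterlim (\<lambda>n. real n * y - 1) at_top sequentially"
    using True by real_asymp
  have "(\<lambda>n. exp (- (1 / (real n * y - 1)))) \<longlonglongrightarrow> exp (- 0)"
    using True by real_asymp
  moreover have "\<forall>\<^sub>F n in sequentially. exp (- (1 / (real n * y - 1))) = flat_exp 1 (real n * y - 1)"
    using filterlim_at_top_dense[THEN iffD1, OF lim, rule_format, of 0]
    by eventually_elim (simp add: flat_exp_def)
  ultimately have "(\<lambda>n. flat_exp 1 (real n * y - 1)) \<longlonglongrightarrow> exp (- 0)"
    using tendsto_cong by fast
  with True show ?thesis by simp
next
  case False
  then have "flat_exp 1 (real n * y - 1) = 0" for n
    by (auto simp: flat_exp_def) (smt (verit) mult_nonneg_nonpos of_nat_0_le_iff)
  with False show ?thesis by simp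
qed

lemma flat_exp_1_bounds: "0 \<le> flat_exp 1 x" "flat_exp 1 x \<le> 1"
  by (auto simp: flat_exp_def)

lemma plateau_tendsto: "(\<lambda>n. plateau c d n x) \<longlonglongrightarrow> (if c < x \<and> x < d then 1 else 0)"
  using tendsto_mult[OF flat_exp_1_tendsto[of "x - c"] flat_exp_1_tendsto[of "d - x"]]
  by (auto simp: plateau_def cong: if_cong split: if_splits)

lemma plateau_bound: "\<bar>plateau c d n x\<bar> \<le> 1"
  by (simp add: plateau_def abs_mult flat_exp_1_bounds abs_of_nonneg mult_le_one)

section \<open>From test functions to equality almost everywhere\<close>

lemma continuous_lebesgue_measurable:
  fixes f :: "real \<Rightarrow> real"
  assumes "continuous_on {a..b} f"
  shows "f \<in> borel_measurable (Leb a b)"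
  using assms by (intro continuous_imp_measurable_on_sets_lebesgue) auto

lemma integrable_mult_bounded:
  fixes f g :: "real \<Rightarrow> real"
  assumes "integrable (Leb a b) f" "g \<in> borel_measurable (Leb a b)"
    and C: "\<And>x. x \<in> {a..b} \<Longrightarrow> \<bar>g x\<bar> \<le> C"
  shows "integrable (Leb a b) (\<lambda>x. f x * g x)"
proof (rule Bochner_Integration.integrable_bound[OF integrable_mult_right[OF assms(1), of C]])
  show "AE x in Leb a b. norm (f x * g x) \<le> norm (C * f x)"
  proof (rule AE_I2)
    fix x assume "x \<in> space (Leb a b)"
    then have "\<bar>g x\<bar> \<le> \<bar>C\<bar>" using C[of x] by auto
    then show "norm (f x * g x) \<le> norm (C * f x)"
      by (simp add: abs_mult mult.commute[of "\<bar>f x\<bar>"] mult_right_mono)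
  qed
qed (use assms in auto)

lemma integrable_mult_continuous:
  fixes f g :: "real \<Rightarrow> real"
  assumes "integrable (Leb a b) f" "continuous_on {a..b} g"
  shows "integrable (Leb a b) (\<lambda>x. f x * g x)"
proof -
  have "bounded (g ` {a..b})"
    using assms(2) by (intro compact_imp_bounded compact_continuous_image) auto
  then obtain C where "\<forall>x\<in>{a..b}. \<bar>g x\<bar> \<le> C"
    by (auto simp: bounded_iff)
  then show ?thesis
    using assms continuous_lebesgue_measurable by (intro integrable_mult_bounded) auto
qed

lemma integrable_const_lebesgue_on [simp]: "integrable (Leb a b) (\<lambda>x. c :: real)"
proof -
  have "finite_measure (Leb a b)"
    by (rule finite_measure_lebesgue_on) auto
  then show ?thesis by (rule finite_measure.integrable_const)
qed

text \<open>Plateau functions approximate indicators, so by dominated convergence the integral of u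
  over every right end piece of the interval vanishes. The measures whose densities are the positive
  and the negative part of u then agree on half-lines, hence coincide; and if the two parts are
  equal, both are zero.\<close>

lemma fundamental_lemma:
  fixes u :: "real \<Rightarrow> real"
  assumes u: "integrable (Leb a b) u"
    and test: "\<And>\<phi>. test_function a b \<phi> \<Longrightarrow> (LINT s|Leb a b. u s * \<phi> s) = 0"
  shows "AE s in Leb a b. u s = 0"
proof -
  obtain v where v[measurable]: "v \<in> borel_measurable borel" and intv: "integrable lborel v"
    and ae: "AE x in lborel. (if x \<in> {a..b} then u x else 0) = v x"
    by (rule integrable_representative[OF u Icc_sets_lebesgue])
  have int0: "(LINT x|lborel. v x * indicator {c<..} x) = 0" for c
  proof -
    \<comment> \<open>The half-line from \<open>c\<close> meets the interval only beyond
      \<open>max a c\<close>; the endpoints lost by taking an open interval form a null set.\<close>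
    let ?c = "max a c"
    have tc: "continuous_on {a..b} (plateau ?c b n)" if "n > 0" for n
      using test_function_plateau[of a ?c b b n] that by (auto simp: test_function_iff smooth_continuous_on)
    have "(\<lambda>n. LINT s|Leb a b. u s * plateau ?c b (Suc n) s) \<longlonglongrightarrow>
      (LINT s|Leb a b. u s * (if ?c < s \<and> s < b then 1 else 0))"
    proof (rule integral_dominated_convergence[where w = "\<lambda>s. \<bar>u s\<bar>"])
      have "{?c<..<b} \<in> sets (Leb a b)"
        by (auto simp: sets_restrict_space_iff sets_completionI_sets)
      then have "indicat_real {?c<..<b} \<in> borel_measurable (Leb a b)"
        by (rule borel_measurable_indicator)
      also have "indicat_real {?c<..<b} = (\<lambda>s. if ?c < s \<and> s < b then 1 else 0)"
        by (auto simp: indicator_def fun_eq_iff)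
      finally show "(\<lambda>s. u s * (if ?c < s \<and> s < b then 1 else 0)) \<in> borel_measurable (Leb a b)"
        using u by (intro borel_measurable_times) auto
      show "(\<lambda>s. u s * plateau ?c b (Suc n) s) \<in> borel_measurable (Leb a b)" for n
        using u continuous_lebesgue_measurable[OF tc] by (intro borel_measurable_times) auto
      show "AE s in Leb a b. (\<lambda>n. u s * plateau ?c b (Suc n) s) \<longlonglongrightarrow>
          u s * (if ?c < s \<and> s < b then 1 else 0)"
        by (intro AE_I2 tendsto_mult tendsto_const LIMSEQ_Suc[OF plateau_tendsto])
      show "AE s in Leb a b. norm (u s * plateau ?c b (Suc n) s) \<le> \<bar>u s\<bar>" for n
        by (intro AE_I2) (simp add: abs_mult mult_left_le plateau_bound)
    qed (use u in auto)
    moreover have "(LINT s|Leb a b. u s * plateau ?c b (Suc n) s) = 0" for n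
      by (intro test test_function_plateau) auto
    ultimately have "(\<lambda>n. 0) \<longlonglongrightarrow> (LINT s|Leb a b. u s * (if ?c < s \<and> s < b then 1 else 0))"
      by (simp only:)
    then have "(LINT s|Leb a b. u s * (if ?c < s \<and> s < b then 1 else 0)) = 0"
      by (rule LIMSEQ_unique[OF _ tendsto_const])
    moreover have "(LINT s|Leb a b. u s * (if ?c < s \<and> s < b then 1 else 0)) = (LINT x|lborel. v x * indicator {c<..} x)"
    proof (rule lebesgue_on_representative(2))
      have "AE x in lborel. x \<noteq> a" "AE x in lborel. x \<noteq> b"
        by (auto intro: AE_lborel_singleton)
      with ae show "AE x in lborel. (if x \<in> {a..b} then u x * (if ?c < x \<and> x < b then 1 else 0) else 0) = v x * indicator {c<..} x"
        by eventually_elim (auto simp: indicator_def split: if_splits)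
    qed auto
    ultimately show ?thesis by simp
  qed
  \<comment> \<open>\<open>ennreal\<close> sends negative numbers to 0, so these two densities are
    the positive and the negative part of v.\<close>
  have "density lborel (\<lambda>x. ennreal (v x)) = density lborel (\<lambda>x. ennreal (- v x))"
  proof (rule measure_eqI_lessThan)
    fix c :: real
    have ei: "(\<integral>\<^sup>+x\<in>{c<..}. ennreal (w x) \<partial>lborel) = ennreal (LINT x|lborel. max 0 (w x) * indicator {c<..} x)"
      if [measurable]: "w \<in> borel_measurable borel" and w: "integrable lborel w" for w
    proof -
      have "integrable lborel (\<lambda>x. max 0 (w x) * indicator {c<..} x)"
        using w by (intro integrable_real_mult_indicator integrable_max) auto
      then show ?thesis
        by (subst nn_integral_eq_integral[symmetric])
          (auto intro!: nn_integral_cong simp: indicator_def ennreal_max_0 split: if_splits)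
    qed
    have i: "integrable lborel (\<lambda>x. max 0 (w x) * indicat_real {c<..} x)" if "integrable lborel w" for w
      using that by (intro integrable_real_mult_indicator integrable_max) auto
    have "(LINT x|lborel. max 0 (v x) * indicat_real {c<..} x) - (LINT x|lborel. max 0 (- v x) * indicat_real {c<..} x)
      = (LINT x|lborel. v x * indicator {c<..} x)"
      unfolding Bochner_Integration.integral_diff[OF i[OF intv] i[OF integrable_minus[OF intv]], symmetric]
      by (rule Bochner_Integration.integral_cong) (auto simp: max_def indicator_def)
    then have eq: "(LINT x|lborel. max 0 (v x) * indicat_real {c<..} x) = (LINT x|lborel. max 0 (- v x) * indicat_real {c<..} x)"
      using int0[of c] by simp
    show "emeasure (density lborel (\<lambda>x. ennreal (v x))) {c<..} < \<infinity>"
      using ei[OF v intv] by (simp add: emeasure_density)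
    show "emeasure (density lborel (\<lambda>x. ennreal (v x))) {c<..} = emeasure (density lborel (\<lambda>x. ennreal (- v x))) {c<..}"
      using ei[OF v intv] ei[OF _ integrable_minus[OF intv]] eq by (simp add: emeasure_density)
  qed auto
  then have "AE x in lborel. ennreal (v x) = ennreal (- v x)"
    by (subst (asm) sigma_finite_measure.density_unique_iff) (auto intro: sigma_finite_lborel)
  then have "AE x in lborel. v x = 0"
  proof eventually_elim
    case (elim x)
    then show ?case
      by (cases "v x \<ge> 0") (auto simp: ennreal_neg ennreal_eq_0_iff)
  qed
  with ae have "AE x in lborel. x \<in> {a..b} \<longrightarrow> u x = 0"
    by eventually_elim (auto split: if_splits)
  then show ?thesis
    unfolding AE_restrict_space_iff[of "{a..b}" lebesgue, simplified] AE_completion_iff by simp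
qed

text \<open>A primitive that starts to the left of the support is constant to the right of it, with
  the total integral as its value. Vanishing mean is exactly what keeps the primitive compactly
  supported.\<close>

lemma test_function_antiderivative:
  assumes "test_function a b \<rho>" and int0: "(LINT s|Leb a b. \<rho> s) = 0"
  obtains \<phi> where "test_function a b \<phi>" "deriv \<phi> = \<rho>"
proof -
  from assms(1) obtain c d where cd: "a < c" "d < b" and z: "\<And>x. x \<notin> {c..d} \<Longrightarrow> \<rho> x = 0"
    and sm: "smooth \<rho>"
    by (auto simp: test_function_iff)
  define \<phi> where "\<phi> x = integral {..x} \<rho>" for x
  \<comment> \<open>\<rho> vanishes to the left of \<open>c\<close>, so the unbounded interval may
    be cut off at any L < c, where the fundamental theorem for compact intervals applies.\<close>
  have \<phi>: "\<phi> x = integral {L..x} \<rho>" if "L < c" for L x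
    unfolding \<phi>_def
    by (subst (1 2) integral_restrict_UNIV[symmetric], rule arg_cong[of _ _ "integral UNIV"])
      (use that z in \<open>auto simp: fun_eq_iff\<close>)
  have der: "(\<phi> has_real_derivative \<rho> x) (at x)" for x
  proof -
    let ?L = "min c x - 1"
    have "((\<lambda>x. integral {?L..x} \<rho>) has_real_derivative \<rho> x) (at x within {?L..x + 1})"
      by (rule integral_has_real_derivative) (auto intro: smooth_continuous_on sm)
    then have "((\<lambda>x. integral {?L..x} \<rho>) has_real_derivative \<rho> x) (at x)"
      by (subst (asm) at_within_Icc_at) auto
    moreover have "\<phi> = (\<lambda>x. integral {?L..x} \<rho>)"
      by (intro ext \<phi>) auto
    ultimately show ?thesis by simp
  qed
  have "(\<rho> has_integral integral {c..d} \<rho>) {c..d}"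
    by (intro integrable_integral integrable_continuous_real smooth_continuous_on sm)
  then have super: "integral S \<rho> = integral {c..d} \<rho>" if "{c..d} \<subseteq> S" for S
    using has_integral_on_superset[of \<rho> _ "{c..d}" S] z that by (intro integral_unique) blast
  have "integral {c..d} \<rho> = integral {a..b} \<rho>"
    using cd by (intro super[symmetric]) auto
  also have "\<dots> = (LINT s|Leb a b. \<rho> s)"
    using integrable_mult_continuous[OF integrable_const_lebesgue_on[of a b 1] smooth_continuous_on[OF sm]]
    by (intro lebesgue_integral_eq_integral[symmetric]) auto
  finally have tot: "integral {c..d} \<rho> = 0" using int0 by simp
  have "\<phi> x = 0" if "x \<notin> {c..d}" for x
  proof (cases "x < c")
    case True
    then have "integral {..x} \<rho> = integral {..x} (\<lambda>_. 0)"
      by (intro integral_cong z) auto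
    then show ?thesis by (simp add: \<phi>_def)
  next
    case False
    with that have "{c..d} \<subseteq> {..x}" by auto
    from super[OF this] tot show ?thesis by (simp add: \<phi>_def)
  qed
  moreover have "smooth \<phi>" by (rule smooth_antideriv[OF sm der])
  ultimately have "test_function a b \<phi>"
    using cd unfolding test_function_iff by blast
  moreover have "deriv \<phi> = \<rho>"
    by (intro ext DERIV_imp_deriv der)
  ultimately show ?thesis by (rule that)
qed

lemma test_function_linear:
  assumes "test_function a b \<phi>" "test_function a b \<psi>"
  shows "test_function a b (\<lambda>x. p * \<phi> x + q * \<psi> x)"
proof -
  from assms obtain c d c' d' where "a < c" "d < b" "\<And>x. x \<notin> {c..d} \<Longrightarrow> \<phi> x = 0"
    "a < c'" "d' < b" "\<And>x. x \<notin> {c'..d'} \<Longrightarrow> \<psi> x = 0"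
    unfolding test_function_iff by blast
  then have "a < min c c'" "max d d' < b" "\<forall>x. x \<notin> {min c c'..max d d'} \<longrightarrow> p * \<phi> x + q * \<psi> x = 0"
    by (auto simp: not_le)
  with smooth_linear assms show ?thesis unfolding test_function_iff by blast
qed

lemma test_function_integrable:
  assumes "integrable (Leb a b) u" "test_function a b \<phi>"
  shows "integrable (Leb a b) (\<lambda>s. u s * \<phi> s)"
  using assms by (auto intro!: integrable_mult_continuous smooth_continuous_on simp: test_function_iff)

text \<open>Subtracting a multiple of one fixed test function \<eta> makes any test function
  mean-free, hence a derivative of a test function. The hypothesis then says that u minus a constant
  is orthogonal to all test functions.\<close>

lemma du_Bois_Reymond:
  fixes u :: "real \<Rightarrow> real"
  assumes u: "integrable (Leb a b) u" and "a < b"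
    and test: "\<And>\<phi>. test_function a b \<phi> \<Longrightarrow> (LINT s|Leb a b. u s * deriv \<phi> s) = 0"
  shows "\<exists>c. AE s in Leb a b. u s = c"
proof -
  let ?I = "\<lambda>f. LINT s|Leb a b. f s"
  note one = integrable_const_lebesgue_on[of a b 1]
  \<comment> \<open>Otherwise the constant 1 would be orthogonal to all test functions, hence zero
    almost everywhere on an interval of positive length.\<close>
  have "\<exists>\<eta>. test_function a b \<eta> \<and> ?I \<eta> \<noteq> 0"
  proof (rule ccontr)
    assume "\<nexists>\<eta>. test_function a b \<eta> \<and> ?I \<eta> \<noteq> 0"
    then have "AE s in Leb a b. (1::real) = 0"
      by (intro fundamental_lemma one) auto
    then have "emeasure lebesgue {s. a \<le> s \<and> s \<le> b} = 0"
      by (simp add: AE_restrict_space_iff AE_iff_null null_sets_def)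
    moreover have "{s. a \<le> s \<and> s \<le> b} = {a..b}" by auto
    ultimately show False using \<open>a < b\<close> by simp
  qed
  then obtain \<eta> where \<eta>: "test_function a b \<eta>" "?I \<eta> \<noteq> 0" by blast
  \<comment> \<open>If u is constant, testing it with \<eta> forces this value.\<close>
  define c where "c = ?I (\<lambda>s. u s * \<eta> s) / ?I \<eta>"
  have "AE s in Leb a b. u s - c = 0"
  proof (rule fundamental_lemma)
    fix \<psi> assume \<psi>: "test_function a b \<psi>"
    define r where "r = ?I \<psi> / ?I \<eta>"
    let ?\<rho> = "\<lambda>s. 1 * \<psi> s + (- r) * \<eta> s"
    have int: "integrable (Leb a b) \<psi>" "integrable (Leb a b) \<eta>"
      "integrable (Leb a b) (\<lambda>s. u s * \<psi> s)" "integrable (Leb a b) (\<lambda>s. u s * \<eta> s)"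
      using test_function_integrable[OF one] test_function_integrable[OF u] \<psi> \<eta> by auto
    have "?I ?\<rho> = 0"
      using int \<eta>(2) by (simp add: r_def)
    from test_function_antiderivative[OF test_function_linear[OF \<psi> \<eta>(1)] this]
    obtain \<phi> where "test_function a b \<phi>" "deriv \<phi> = ?\<rho>" by blast
    with test[of \<phi>] have "?I (\<lambda>s. u s * \<psi> s - r * (u s * \<eta> s)) = 0"
      by (simp add: algebra_simps)
    then have "?I (\<lambda>s. u s * \<psi> s) = r * ?I (\<lambda>s. u s * \<eta> s)"
      using int by simp
    then show "?I (\<lambda>s. (u s - c) * \<psi> s) = 0"
      using int by (simp add: left_diff_distrib r_def c_def)
  qed (use u in auto)
  then show ?thesis by (intro exI[of _ c]) auto
qed

section \<open>The space \<open>L\<^sub>2\<close> and bounded operators\<close>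

definition square_integrable :: "real \<Rightarrow> real \<Rightarrow> (real \<Rightarrow> real) set" where
  "square_integrable a b = {f. f \<in> borel_measurable (Leb a b) \<and>
     integrable (Leb a b) (\<lambda>s. (f s)\<^sup>2)}"

lemma square_integrableI_bound:
  assumes "f \<in> borel_measurable (Leb a b)" "integrable (Leb a b) g"
    and "\<And>s. s \<in> {a..b} \<Longrightarrow> (f s)\<^sup>2 \<le> g s"
  shows "f \<in> square_integrable a b"
  using assms unfolding square_integrable_def
  by (auto intro!: Bochner_Integration.integrable_bound[OF assms(2)] AE_I2 order_trans[OF _ abs_ge_self])

lemma square_integrable_mult:
  assumes "f \<in> square_integrable a b" "g \<in> square_integrable a b"
  shows "integrable (Leb a b) (\<lambda>s. f s * g s)"
proof (rule Bochner_Integration.integrable_bound)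
  show "integrable (Leb a b) (\<lambda>s. (f s)\<^sup>2 + (g s)\<^sup>2)"
    using assms by (auto simp: square_integrable_def)
  show "AE s in Leb a b. norm (f s * g s) \<le> norm ((f s)\<^sup>2 + (g s)\<^sup>2)"
  proof (intro AE_I2)
    fix s
    show "norm (f s * g s) \<le> norm ((f s)\<^sup>2 + (g s)\<^sup>2)"
      using sum_squares_bound[of "\<bar>f s\<bar>" "\<bar>g s\<bar>"] abs_ge_zero[of "f s * g s"]
      unfolding real_norm_def abs_mult power2_abs by linarith
  qed
qed (use assms in \<open>auto simp: square_integrable_def\<close>)

lemma square_integrable_bounded:
  assumes "f \<in> borel_measurable (Leb a b)" "\<And>s. s \<in> {a..b} \<Longrightarrow> \<bar>f s\<bar> \<le> C"
  shows "f \<in> square_integrable a b"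
  by (rule square_integrableI_bound[OF assms(1) integrable_const_lebesgue_on[of a b "C\<^sup>2"]])
    (metis abs_ge_zero assms(2) power2_abs power_mono)

lemma square_integrable_const [simp]: "(\<lambda>s. c) \<in> square_integrable a b"
  by (rule square_integrable_bounded[of _ _ _ "\<bar>c\<bar>"]) auto

lemma square_integrable_imp_integrable:
  assumes "f \<in> square_integrable a b"
  shows "integrable (Leb a b) f"
  using square_integrable_mult[OF assms square_integrable_const[of 1]] by simp

lemma square_integrable_add:
  assumes "f \<in> square_integrable a b" "g \<in> square_integrable a b"
  shows "(\<lambda>s. f s + g s) \<in> square_integrable a b"
proof (rule square_integrableI_bound)
  show "integrable (Leb a b) (\<lambda>s. 2 * (f s)\<^sup>2 + 2 * (g s)\<^sup>2)"
    using assms by (auto simp: square_integrable_def)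
  show "(f s + g s)\<^sup>2 \<le> 2 * (f s)\<^sup>2 + 2 * (g s)\<^sup>2" for s
    using sum_squares_bound[of "f s" "g s"] by (simp add: power2_sum)
qed (use assms in \<open>auto simp: square_integrable_def\<close>)

lemma square_integrable_bounded_mult:
  assumes f: "f \<in> square_integrable a b" and g: "g \<in> borel_measurable (Leb a b)"
    and C: "\<And>s. s \<in> {a..b} \<Longrightarrow> \<bar>g s\<bar> \<le> C"
  shows "(\<lambda>s. g s * f s) \<in> square_integrable a b"
    and "(LINT s|Leb a b. (g s * f s)\<^sup>2) \<le> C\<^sup>2 * (LINT s|Leb a b. (f s)\<^sup>2)"
proof -
  have i: "integrable (Leb a b) (\<lambda>s. C\<^sup>2 * (f s)\<^sup>2)"
    using f by (auto simp: square_integrable_def)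
  have le: "(g s * f s)\<^sup>2 \<le> C\<^sup>2 * (f s)\<^sup>2" if "s \<in> {a..b}" for s
    unfolding power_mult_distrib
    by (intro mult_right_mono) (use C[OF that] in \<open>auto simp: abs_le_square_iff[symmetric]\<close>)
  show si: "(\<lambda>s. g s * f s) \<in> square_integrable a b"
    by (rule square_integrableI_bound[OF _ i le]) (use f g in \<open>auto simp: square_integrable_def\<close>)
  have "(LINT s|Leb a b. (g s * f s)\<^sup>2) \<le> (LINT s|Leb a b. C\<^sup>2 * (f s)\<^sup>2)"
    by (rule integral_mono) (use si i le in \<open>auto simp: square_integrable_def\<close>)
  then show "(LINT s|Leb a b. (g s * f s)\<^sup>2) \<le> C\<^sup>2 * (LINT s|Leb a b. (f s)\<^sup>2)"
    by simp
qed

lemma square_integrable_cmult: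
  "f \<in> square_integrable a b \<Longrightarrow> (\<lambda>s. c * f s) \<in> square_integrable a b"
  using square_integrable_bounded_mult(1)[of f a b "\<lambda>_. c" "\<bar>c\<bar>"] by auto

lemma square_integrable_sum:
  assumes "\<And>i. i \<in> A \<Longrightarrow> f i \<in> square_integrable a b"
  shows "(\<lambda>s. \<Sum>i\<in>A. f i s) \<in> square_integrable a b"
  using assms by (induction A rule: infinite_finite_induct) (auto intro: square_integrable_add)

lemma square_integrable_cong_AE:
  assumes f: "f \<in> square_integrable a b" and ae: "AE s in Leb a b. f s = g s"
  shows "g \<in> square_integrable a b"
proof -
  have "f \<in> borel_measurable (Leb a b)"
    using f by (simp add: square_integrable_def)
  then obtain h
    where h: "h \<in> borel_measurable borel" and e: "AE x in lborel. (if x \<in> {a..b} then f x else 0) = h x"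
    by (rule borel_representative[OF _ Icc_sets_lebesgue])
  have "AE x in lborel. x \<in> {a..b} \<longrightarrow> f x = g x"
    using ae unfolding AE_restrict_space_iff[of "{a..b}" lebesgue, simplified] AE_completion_iff by simp
  with e have "AE x in lborel. (if x \<in> {a..b} then g x else 0) = h x"
    by eventually_elim (auto split: if_splits)
  from lebesgue_on_representative(1)[OF h _ this] have g: "g \<in> borel_measurable (Leb a b)"
    by simp
  have "integrable (Leb a b) (\<lambda>s. (f s)\<^sup>2) = integrable (Leb a b) (\<lambda>s. (g s)\<^sup>2)"
    by (rule integrable_cong_AE) (use f g ae in \<open>auto simp: square_integrable_def\<close>)
  with f g show ?thesis by (simp add: square_integrable_def)
qed

lemma abs_integral_squared_le:
  assumes f: "f \<in> square_integrable a b" and "a \<le> b"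
  shows "(LINT s|Leb a b. \<bar>f s\<bar>)\<^sup>2 \<le> (b - a) * (LINT s|Leb a b. (f s)\<^sup>2)"
proof (cases "a = b")
  case True
  have "(LINT s|Leb a b. \<bar>f s\<bar>) = (LINT s|Leb a b. 0)"
  proof (rule integral_cong_AE)
    have "AE s in lborel. s \<noteq> a" by (rule AE_lborel_singleton)
    then show "AE s in Leb a b. \<bar>f s\<bar> = 0"
      unfolding AE_restrict_space_iff[of "{a..b}" lebesgue, simplified] AE_completion_iff
      by eventually_elim (use True in auto)
  qed (use f in \<open>auto simp: square_integrable_def\<close>)
  then show ?thesis using True by simp
next
  case False
  with assms have ab: "b - a > 0" by simp
  let ?I = "\<lambda>f. LINT s|Leb a b. f s"
  have i: "integrable (Leb a b) (\<lambda>s. \<bar>f s\<bar>)" "integrable (Leb a b) (\<lambda>s. (f s)\<^sup>2)"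
    using square_integrable_imp_integrable[OF f] f by (auto simp: square_integrable_def)
  have one: "?I (\<lambda>s. c) = c * (b - a)" for c :: real
    using \<open>a \<le> b\<close> by (simp add: measure_restrict_space)
  \<comment> \<open>\<mu> is the mean of |f|; the inequality is the nonnegativity of the variance of
    |f|.\<close>
  define \<mu> where "\<mu> = ?I (\<lambda>s. \<bar>f s\<bar>) / (b - a)"
  have "0 \<le> ?I (\<lambda>s. (\<bar>f s\<bar> - \<mu>)\<^sup>2)" by simp
  also have "(\<lambda>s. (\<bar>f s\<bar> - \<mu>)\<^sup>2) = (\<lambda>s. (f s)\<^sup>2 - 2 * \<mu> * \<bar>f s\<bar> + \<mu>\<^sup>2)"
    by (auto simp: power2_diff fun_eq_iff)
  also have "?I \<dots> = ?I (\<lambda>s. (f s)\<^sup>2) - 2 * \<mu> * ?I (\<lambda>s. \<bar>f s\<bar>) + \<mu>\<^sup>2 * (b - a)"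
    using i by (simp only: Bochner_Integration.integral_add Bochner_Integration.integral_diff
      integrable_const_lebesgue_on one integral_mult_right_zero integrable_mult_right Bochner_Integration.integrable_diff)
  also have "\<dots> = ?I (\<lambda>s. (f s)\<^sup>2) - (?I (\<lambda>s. \<bar>f s\<bar>))\<^sup>2 / (b - a)"
  proof -
    have "J\<^sup>2 / d = 2 * (J / d) * J - (J / d)\<^sup>2 * d" if "d > 0" for J d :: real
      using that by (simp add: power2_eq_square)
    from this[OF ab] show ?thesis by (simp add: \<mu>_def)
  qed
  finally show ?thesis using ab by (simp add: field_simps)
qed

section \<open>Scalar operators with an adjoint\<close>

definition scalar_adjoint ::
    "real \<Rightarrow> real \<Rightarrow> ((real \<Rightarrow> real) \<Rightarrow> real \<Rightarrow> real) \<Rightarrow> ((real \<Rightarrow> real) \<Rightarrow> real \<Rightarrow> real) \<Rightarrow> real \<Rightarrow> bool" where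
  "scalar_adjoint a b q r C \<longleftrightarrow> C \<ge> 0 \<and>
     (\<forall>f\<in>square_integrable a b. q f \<in> square_integrable a b \<and> r f \<in> square_integrable a b \<and>
        (LINT s|Leb a b. (q f s)\<^sup>2) \<le> C * (LINT s|Leb a b. (f s)\<^sup>2)) \<and>
     (\<forall>f\<in>square_integrable a b. \<forall>g\<in>square_integrable a b.
        (LINT s|Leb a b. q f s * g s) = (LINT s|Leb a b. f s * r g s))"

definition scalar_op :: "real \<Rightarrow> real \<Rightarrow> ((real \<Rightarrow> real) \<Rightarrow> real \<Rightarrow> real) \<Rightarrow> bool" where
  "scalar_op a b q \<longleftrightarrow> (\<exists>r C. scalar_adjoint a b q r C)"

lemma scalar_op_mult:
  assumes "g \<in> borel_measurable (Leb a b)" "\<And>s. s \<in> {a..b} \<Longrightarrow> \<bar>g s\<bar> \<le> C"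
  shows "scalar_op a b (\<lambda>f s. g s * f s)"
  unfolding scalar_op_def scalar_adjoint_def
  using square_integrable_bounded_mult[OF _ assms]
  by (intro exI[of _ "\<lambda>f s. g s * f s"] exI[of _ "C\<^sup>2"]) (auto simp: mult_ac)

lemma kernel_op_square_integrable:
  assumes K: "bounded_kernel a b K" and "a \<le> b"
  obtains C where "C \<ge> 0"
    "\<And>f. f \<in> square_integrable a b \<Longrightarrow> kernel_op a b K f \<in> square_integrable a b \<and>
      (LINT s|Leb a b. (kernel_op a b K f s)\<^sup>2) \<le> C * (LINT s|Leb a b. (f s)\<^sup>2)"
proof -
  from K obtain C0 where "\<forall>s\<in>{a..b}. \<forall>\<theta>\<in>{a..b}. \<bar>K s \<theta>\<bar> \<le> C0"
    by (auto simp: bounded_kernel_def)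
  then have C: "\<bar>K s \<theta>\<bar> \<le> \<bar>C0\<bar>" if "s \<in> {a..b}" "\<theta> \<in> {a..b}" for s \<theta>
    using that by (metis abs_ge_self order_trans)
  \<comment> \<open>Pointwise the image is at most |C0| times the L1 norm of f. Integrating the
    square of this constant gives one factor b - a, and the Cauchy-Schwarz bound for the L1 norm
    gives the other.\<close>
  let ?C = "(C0 * (b - a))\<^sup>2"
  show ?thesis
  proof (rule that[of ?C])
    fix f assume f: "f \<in> square_integrable a b"
    note fi = square_integrable_imp_integrable[OF f]
    let ?N = "LINT s|Leb a b. \<bar>f s\<bar>" and ?S = "LINT s|Leb a b. (f s)\<^sup>2"
    have b: "\<bar>kernel_op a b K f s\<bar> \<le> \<bar>C0\<bar> * ?N" if s: "s \<in> {a..b}" for s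
    proof (cases "integrable (Leb a b) (\<lambda>\<theta>. K s \<theta> * f \<theta>)")
      case True
      have "\<bar>kernel_op a b K f s\<bar> \<le> (LINT \<theta>|Leb a b. \<bar>K s \<theta> * f \<theta>\<bar>)"
        unfolding kernel_op_def by (rule integral_abs_bound)
      also have "\<dots> \<le> (LINT \<theta>|Leb a b. \<bar>C0\<bar> * \<bar>f \<theta>\<bar>)"
        by (rule integral_mono) (use integrable_abs[OF True] fi C[OF s] in \<open>auto simp: abs_mult mult_right_mono\<close>)
      finally show ?thesis by simp
    next
      \<comment> \<open>Where the section is not integrable the integral is 0 by convention, so the
        bound holds at every point of the interval.\<close>
      case False
      then show ?thesis by (simp add: kernel_op_def not_integrable_integral_eq)
    qed
    have m: "kernel_op a b K f \<in> borel_measurable (Leb a b)"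
      by (rule kernel_op_measurable[OF K fi])
    have si: "kernel_op a b K f \<in> square_integrable a b"
      by (rule square_integrable_bounded[OF m b])
    have "(LINT s|Leb a b. (kernel_op a b K f s)\<^sup>2) \<le> (LINT s|Leb a b. (\<bar>C0\<bar> * ?N)\<^sup>2)"
    proof (rule integral_mono)
      fix s assume "s \<in> space (Leb a b)"
      then show "(kernel_op a b K f s)\<^sup>2 \<le> (\<bar>C0\<bar> * ?N)\<^sup>2"
        using power_mono[OF b[of s], of 2] by simp
    qed (use si in \<open>auto simp: square_integrable_def\<close>)
    also have "\<dots> = C0\<^sup>2 * (b - a) * ?N\<^sup>2"
      using \<open>a \<le> b\<close> by (simp add: measure_restrict_space power_mult_distrib)
    also have "\<dots> \<le> C0\<^sup>2 * (b - a) * ((b - a) * ?S)"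
      using abs_integral_squared_le[OF f \<open>a \<le> b\<close>] \<open>a \<le> b\<close> by (intro mult_left_mono) auto
    also have "\<dots> = ?C * ?S" by (simp add: power2_eq_square)
    finally show "kernel_op a b K f \<in> square_integrable a b \<and>
      (LINT s|Leb a b. (kernel_op a b K f s)\<^sup>2) \<le> ?C * ?S"
      using si by simp
  qed simp
qed

lemma scalar_op_kernel:
  assumes K: "bounded_kernel a b K" and "a \<le> b"
  shows "scalar_op a b (kernel_op a b K)"
proof -
  obtain C where C: "C \<ge> 0" "\<And>f. f \<in> square_integrable a b \<Longrightarrow> kernel_op a b K f \<in> square_integrable a b \<and>
      (LINT s|Leb a b. (kernel_op a b K f s)\<^sup>2) \<le> C * (LINT s|Leb a b. (f s)\<^sup>2)"
    using kernel_op_square_integrable[OF assms] by blast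
  have T: "kernel_op a b (\<lambda>s \<theta>. K \<theta> s) f \<in> square_integrable a b" if "f \<in> square_integrable a b" for f
    using kernel_op_square_integrable[OF bounded_kernel_swap[OF K] \<open>a \<le> b\<close>] that by blast
  show ?thesis
    unfolding scalar_op_def scalar_adjoint_def
    by (intro exI[of _ "kernel_op a b (\<lambda>s \<theta>. K \<theta> s)"] exI[of _ C])
      (use C T in \<open>auto intro!: kernel_op_adjoint[OF K] square_integrable_imp_integrable\<close>)
qed

section \<open>Vector-valued functions and their inner product\<close>

lemma L2_space_iff:
  "f \<in> L2_space a b m \<longleftrightarrow> (\<forall>s\<in>{a..b}. f s \<in> carrier_vec m) \<and> (\<forall>i<m. (\<lambda>s. f s $ i) \<in> square_integrable a b)"
  by (auto simp: L2_space_def square_integrable_def)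

lemma L2_spaceD:
  assumes "f \<in> L2_space a b m"
  shows "s \<in> {a..b} \<Longrightarrow> f s \<in> carrier_vec m" "s \<in> {a..b} \<Longrightarrow> dim_vec (f s) = m"
    "i < m \<Longrightarrow> (\<lambda>s. f s $ i) \<in> square_integrable a b"
  using assms by (auto simp: L2_space_iff)

lemma square_integrable_cong:
  assumes "\<And>s. s \<in> {a..b} \<Longrightarrow> f s = g s"
  shows "f \<in> square_integrable a b \<longleftrightarrow> g \<in> square_integrable a b"
proof -
  have "f \<in> borel_measurable (Leb a b) \<longleftrightarrow> g \<in> borel_measurable (Leb a b)"
    by (rule measurable_cong) (simp add: assms)
  moreover have "integrable (Leb a b) (\<lambda>s. (f s)\<^sup>2) \<longleftrightarrow> integrable (Leb a b) (\<lambda>s. (g s)\<^sup>2)"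
    by (rule Bochner_Integration.integrable_cong) (simp_all add: assms)
  ultimately show ?thesis by (simp add: square_integrable_def)
qed

lemma L2_space_add:
  assumes "f \<in> L2_space a b m" "g \<in> L2_space a b m"
  shows "(\<lambda>s. f s + g s) \<in> L2_space a b m"
  unfolding L2_space_iff
proof (intro conjI ballI allI impI)
  fix i assume "i < m"
  then have "(\<lambda>s. f s $ i + g s $ i) \<in> square_integrable a b"
    using assms by (intro square_integrable_add) (auto intro: L2_spaceD)
  then show "(\<lambda>s. (f s + g s) $ i) \<in> square_integrable a b"
    by (rule square_integrable_cong[THEN iffD1, rotated]) (use \<open>i < m\<close> L2_spaceD(2)[OF assms(2)] in auto)
qed (use L2_spaceD(1)[OF assms(1)] L2_spaceD(1)[OF assms(2)] in auto)

lemma L2_space_smult: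
  assumes "f \<in> L2_space a b m"
  shows "(\<lambda>s. c \<cdot>\<^sub>v f s) \<in> L2_space a b m"
  unfolding L2_space_iff
proof (intro conjI ballI allI impI)
  fix i assume "i < m"
  then have "(\<lambda>s. c * f s $ i) \<in> square_integrable a b"
    using assms by (intro square_integrable_cmult) (auto intro: L2_spaceD)
  then show "(\<lambda>s. (c \<cdot>\<^sub>v f s) $ i) \<in> square_integrable a b"
    by (rule square_integrable_cong[THEN iffD1, rotated]) (use \<open>i < m\<close> L2_spaceD(2)[OF assms] in auto)
qed (use L2_spaceD(1)[OF assms] in auto)

lemma L2_space_cong_AE:
  assumes "f \<in> L2_space a b m" "L2_eq a b f g" "\<And>s. s \<in> {a..b} \<Longrightarrow> g s \<in> carrier_vec m"
  shows "g \<in> L2_space a b m"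
  unfolding L2_space_iff
proof (intro conjI ballI allI impI)
  fix i assume "i < m"
  show "(\<lambda>s. g s $ i) \<in> square_integrable a b"
    by (rule square_integrable_cong_AE[OF L2_spaceD(3)[OF assms(1) \<open>i < m\<close>]])
      (use assms(2) in \<open>auto simp: L2_eq_def elim: eventually_mono\<close>)
qed (use assms in auto)

lemma L2_space_cong:
  assumes "\<And>s. s \<in> {a..b} \<Longrightarrow> f s = g s"
  shows "f \<in> L2_space a b m \<longleftrightarrow> g \<in> L2_space a b m"
proof -
  have "(\<lambda>s. f s $ i) \<in> square_integrable a b \<longleftrightarrow> (\<lambda>s. g s $ i) \<in> square_integrable a b" for i
    by (rule square_integrable_cong) (simp add: assms)
  with assms show ?thesis by (simp add: L2_space_iff)
qed

lemma L2_space_diff: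
  assumes "f \<in> L2_space a b m" "g \<in> L2_space a b m"
  shows "(\<lambda>s. f s - g s) \<in> L2_space a b m"
proof (rule L2_space_cong[THEN iffD1])
  show "(\<lambda>s. f s + (-1) \<cdot>\<^sub>v g s) \<in> L2_space a b m"
    by (intro L2_space_add L2_space_smult assms)
  show "f s + (-1) \<cdot>\<^sub>v g s = f s - g s" if "s \<in> {a..b}" for s
    using L2_spaceD(1)[OF assms(1) that] L2_spaceD(1)[OF assms(2) that] by (auto intro!: eq_vecI)
qed

lemma L2_inner_eq_sum:
  assumes "f \<in> L2_space a b m" "g \<in> L2_space a b m"
  shows "L2_inner a b f g = (\<Sum>i<m. (LINT s|Leb a b. f s $ i * g s $ i))"
proof -
  have "L2_inner a b f g = (LINT s|Leb a b. (\<Sum>i<m. f s $ i * g s $ i))"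
    unfolding L2_inner_def
    by (intro Bochner_Integration.integral_cong)
      (auto simp: scalar_prod_def L2_spaceD(2)[OF assms(2)] atLeast0LessThan)
  also have "\<dots> = (\<Sum>i<m. (LINT s|Leb a b. f s $ i * g s $ i))"
    by (intro Bochner_Integration.integral_sum square_integrable_mult) (use assms in \<open>auto intro: L2_spaceD\<close>)
  finally show ?thesis .
qed

lemma L2_inner_commute:
  assumes "f \<in> L2_space a b m" "g \<in> L2_space a b m"
  shows "L2_inner a b f g = L2_inner a b g f"
  by (simp add: L2_inner_eq_sum[OF assms] L2_inner_eq_sum[OF assms(2,1)] mult.commute)

lemma L2_inner_add_left:
  assumes "f \<in> L2_space a b m" "g \<in> L2_space a b m" "h \<in> L2_space a b m"
  shows "L2_inner a b (\<lambda>s. f s + g s) h = L2_inner a b f h + L2_inner a b g h"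
proof -
  have "(LINT s|Leb a b. (f s + g s) $ i * h s $ i)
      = (LINT s|Leb a b. f s $ i * h s $ i) + (LINT s|Leb a b. g s $ i * h s $ i)"
    if "i < m" for i
  proof -
    have "(LINT s|Leb a b. (f s + g s) $ i * h s $ i)
      = (LINT s|Leb a b. f s $ i * h s $ i + g s $ i * h s $ i)"
      by (intro Bochner_Integration.integral_cong) (use that L2_spaceD(2)[OF assms(2)] in \<open>auto simp: distrib_right\<close>)
    also have "\<dots> = (LINT s|Leb a b. f s $ i * h s $ i) + (LINT s|Leb a b. g s $ i * h s $ i)"
      by (intro Bochner_Integration.integral_add square_integrable_mult) (use assms that in \<open>auto intro: L2_spaceD\<close>)
    finally show ?thesis .
  qed
  then show ?thesis
    by (simp add: L2_inner_eq_sum[OF L2_space_add[OF assms(1,2)] assms(3)] L2_inner_eq_sum[OF assms(1,3)]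
        L2_inner_eq_sum[OF assms(2,3)] sum.distrib)
qed

lemma L2_inner_smult_left:
  assumes "f \<in> L2_space a b m" "h \<in> L2_space a b m"
  shows "L2_inner a b (\<lambda>s. c \<cdot>\<^sub>v f s) h = c * L2_inner a b f h"
proof -
  have "(LINT s|Leb a b. (c \<cdot>\<^sub>v f s) $ i * h s $ i) = c * (LINT s|Leb a b. f s $ i * h s $ i)"
    if "i < m" for i
  proof -
    have "(LINT s|Leb a b. (c \<cdot>\<^sub>v f s) $ i * h s $ i) = (LINT s|Leb a b. c * (f s $ i * h s $ i))"
      by (intro Bochner_Integration.integral_cong) (use that L2_spaceD(2)[OF assms(1)] in auto)
    then show ?thesis by simp
  qed
  then show ?thesis
    by (simp add: L2_inner_eq_sum[OF L2_space_smult[OF assms(1)] assms(2)] L2_inner_eq_sum[OF assms] sum_distrib_left)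
qed

lemma L2_inner_cong_AE:
  assumes "f \<in> L2_space a b m" "g \<in> L2_space a b m" "f' \<in> L2_space a b m" "g' \<in> L2_space a b m"
    and "L2_eq a b f f'" "L2_eq a b g g'"
  shows "L2_inner a b f g = L2_inner a b f' g'"
proof -
  have "(LINT s|Leb a b. f s $ i * g s $ i) = (LINT s|Leb a b. f' s $ i * g' s $ i)"
    if "i < m" for i
  proof (rule integral_cong_AE)
    show "AE s in Leb a b. f s $ i * g s $ i = f' s $ i * g' s $ i"
      using assms(5,6) unfolding L2_eq_def by eventually_elim simp
  qed (use assms(1-4) that in \<open>auto intro!: borel_measurable_times simp: L2_space_def\<close>)
  then show ?thesis
    by (simp add: L2_inner_eq_sum[OF assms(1,2)] L2_inner_eq_sum[OF assms(3,4)])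
qed

lemma L2_eq_refl [simp]: "L2_eq a b f f"
  by (simp add: L2_eq_def)

lemma L2_eq_sym: "L2_eq a b f g \<Longrightarrow> L2_eq a b g f"
  unfolding L2_eq_def by (auto elim: eventually_mono)

lemma L2_eq_trans: "L2_eq a b f g \<Longrightarrow> L2_eq a b g h \<Longrightarrow> L2_eq a b f h"
  by (auto simp: L2_eq_def elim: eventually_elim2)

lemma L2_inner_add_right:
  assumes "f \<in> L2_space a b m" "g \<in> L2_space a b m" "h \<in> L2_space a b m"
  shows "L2_inner a b h (\<lambda>s. f s + g s) = L2_inner a b h f + L2_inner a b h g"
  using L2_inner_add_left[OF assms] L2_inner_commute[OF assms(3)] L2_space_add assms by simp

lemma L2_inner_smult_right:
  assumes "f \<in> L2_space a b m" "h \<in> L2_space a b m"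
  shows "L2_inner a b h (\<lambda>s. c \<cdot>\<^sub>v f s) = c * L2_inner a b h f"
  using L2_inner_smult_left[OF assms] L2_inner_commute[OF assms(2)] L2_space_smult assms by simp

lemma L2_diff_eq:
  assumes "f \<in> L2_space a b m" "g \<in> L2_space a b m"
  shows "L2_eq a b (\<lambda>s. f s - g s) (\<lambda>s. f s + (-1) \<cdot>\<^sub>v g s)"
  unfolding L2_eq_def
proof (rule AE_I2)
  fix s assume "s \<in> space (Leb a b)"
  then have "s \<in> {a..b}" by simp
  from L2_spaceD(1)[OF assms(1) this] L2_spaceD(1)[OF assms(2) this]
  show "f s - g s = f s + (-1) \<cdot>\<^sub>v g s"
    by (auto intro!: eq_vecI)
qed

lemma L2_inner_diff_left:
  assumes "f \<in> L2_space a b m" "g \<in> L2_space a b m" "h \<in> L2_space a b m"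
  shows "L2_inner a b (\<lambda>s. f s - g s) h = L2_inner a b f h - L2_inner a b g h"
proof -
  have "L2_inner a b (\<lambda>s. f s - g s) h = L2_inner a b (\<lambda>s. f s + (-1) \<cdot>\<^sub>v g s) h"
    by (rule L2_inner_cong_AE[OF _ _ _ _ L2_diff_eq L2_eq_refl])
      (use assms in \<open>auto intro: L2_space_add L2_space_smult L2_space_diff\<close>)
  then show ?thesis
    using L2_inner_add_left[OF assms(1) L2_space_smult[OF assms(2)] assms(3)] L2_inner_smult_left[OF assms(2,3)]
    by simp
qed

lemma L2_inner_diff_right:
  assumes "f \<in> L2_space a b m" "g \<in> L2_space a b m" "h \<in> L2_space a b m"
  shows "L2_inner a b h (\<lambda>s. f s - g s) = L2_inner a b h f - L2_inner a b h g"
  using L2_inner_diff_left[OF assms] L2_inner_commute[OF assms(3)] L2_space_diff assms by simp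

lemma L2_inner_nonneg: "f \<in> L2_space a b m \<Longrightarrow> 0 \<le> L2_inner a b f f"
  by (simp add: L2_inner_eq_sum sum_nonneg)

lemma L2_norm_power2: "f \<in> L2_space a b m \<Longrightarrow> (L2_norm a b f)\<^sup>2 = L2_inner a b f f"
  by (simp add: L2_norm_def L2_inner_nonneg)

lemma L2_norm_nonneg: "f \<in> L2_space a b m \<Longrightarrow> 0 \<le> L2_norm a b f"
  by (simp add: L2_norm_def L2_inner_nonneg)

text \<open>On representatives the inner product is only positive semidefinite: a function of norm
  zero need not be zero everywhere. The degenerate case is therefore settled by the quadratic in t
  as well.\<close>

lemma L2_Cauchy_Schwarz:
  assumes f: "f \<in> L2_space a b m" and g: "g \<in> L2_space a b m"
  shows "\<bar>L2_inner a b f g\<bar> \<le> L2_norm a b f * L2_norm a b g"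
proof -
  let ?F = "L2_inner a b f f" and ?G = "L2_inner a b g g" and ?P = "L2_inner a b f g"
  have q: "0 \<le> ?F - 2 * t * ?P + t\<^sup>2 * ?G" for t
  proof -
    let ?h = "\<lambda>s. f s - t \<cdot>\<^sub>v g s"
    note tg = L2_space_smult[OF g, of t]
    have "0 \<le> L2_inner a b ?h ?h"
      by (rule L2_inner_nonneg[OF L2_space_diff[OF f tg]])
    also have "\<dots> = ?F - 2 * t * ?P + t\<^sup>2 * ?G"
      using f g tg L2_space_diff[OF f tg] L2_inner_commute[OF g f]
      by (simp add: L2_inner_diff_left[OF f tg] L2_inner_diff_right[OF f tg] L2_inner_smult_left
          L2_inner_smult_right power2_eq_square algebra_simps)
    finally show ?thesis .
  qed
  have "?P\<^sup>2 \<le> ?F * ?G"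
  proof (cases "?G = 0")
    case True
    have "?P = 0"
    proof (rule ccontr)
      assume "?P \<noteq> 0"
      \<comment> \<open>With \<open>?G = 0\<close> the quadratic is linear in t, and this t gives it
        the value -1.\<close>
      with q[of "(?F + 1) / (2 * ?P)"] True show False by simp
    qed
    with True show ?thesis by simp
  next
    case False
    then have "?G > 0" using L2_inner_nonneg[OF g] by linarith
    \<comment> \<open>This t minimises the quadratic.\<close>
    with q[of "?P / ?G"] show ?thesis
      by (simp add: power2_eq_square field_simps)
  qed
  then have "sqrt (?P\<^sup>2) \<le> sqrt (?F * ?G)" by (rule real_sqrt_le_mono)
  then show ?thesis by (simp add: L2_norm_def real_sqrt_mult)
qed

text \<open>Linearity is not demanded: the existence of an adjoint implies it almost everywhere.\<close>

definition L2_bounded_op :: "real \<Rightarrow> real \<Rightarrow> nat \<Rightarrow> nat \<Rightarrow> vop \<Rightarrow> bool" where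
  "L2_bounded_op a b m n Q \<longleftrightarrow>
     (\<forall>x\<in>L2_space a b m. Q x \<in> L2_space a b n) \<and>
     (\<exists>C\<ge>0. \<forall>x\<in>L2_space a b m. L2_norm a b (Q x) \<le> C * L2_norm a b x) \<and>
     (\<exists>R. (\<forall>y\<in>L2_space a b n. R y \<in> L2_space a b m) \<and>
        (\<forall>x\<in>L2_space a b m. \<forall>y\<in>L2_space a b n. L2_inner a b (Q x) y = L2_inner a b x (R y)))"

lemma L2_bounded_op_comp:
  assumes Q: "L2_bounded_op a b m n Q" and S: "L2_bounded_op a b n p S"
  shows "L2_bounded_op a b m p (\<lambda>x. S (Q x))"
proof -
  from Q obtain C R where C: "C \<ge> 0" "\<And>x. x \<in> L2_space a b m \<Longrightarrow> L2_norm a b (Q x) \<le> C * L2_norm a b x"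
    and QR: "\<And>x. x \<in> L2_space a b m \<Longrightarrow> Q x \<in> L2_space a b n" "\<And>y. y \<in> L2_space a b n \<Longrightarrow> R y \<in> L2_space a b m"
    "\<And>x y. x \<in> L2_space a b m \<Longrightarrow> y \<in> L2_space a b n \<Longrightarrow> L2_inner a b (Q x) y = L2_inner a b x (R y)"
    unfolding L2_bounded_op_def by blast
  from S obtain D U where D: "D \<ge> 0" "\<And>x. x \<in> L2_space a b n \<Longrightarrow> L2_norm a b (S x) \<le> D * L2_norm a b x"
    and SU: "\<And>x. x \<in> L2_space a b n \<Longrightarrow> S x \<in> L2_space a b p" "\<And>y. y \<in> L2_space a b p \<Longrightarrow> U y \<in> L2_space a b n"
    "\<And>x y. x \<in> L2_space a b n \<Longrightarrow> y \<in> L2_space a b p \<Longrightarrow> L2_inner a b (S x) y = L2_inner a b x (U y)"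
    unfolding L2_bounded_op_def by blast
  have bd: "L2_norm a b (S (Q x)) \<le> (D * C) * L2_norm a b x" if "x \<in> L2_space a b m" for x
    using D(2)[OF QR(1)[OF that]] mult_left_mono[OF C(2)[OF that] D(1)] by simp
  show ?thesis
    unfolding L2_bounded_op_def
    by (intro conjI exI[of _ "D * C"] exI[of _ "\<lambda>y. R (U y)"] ballI)
      (use C(1) D(1) QR SU bd in auto)
qed

lemma L2_norm_triangle:
  assumes f: "f \<in> L2_space a b m" and g: "g \<in> L2_space a b m"
  shows "L2_norm a b (\<lambda>s. f s + g s) \<le> L2_norm a b f + L2_norm a b g"
proof (rule power2_le_imp_le)
  have "(L2_norm a b (\<lambda>s. f s + g s))\<^sup>2 = L2_inner a b f f + 2 * L2_inner a b f g + L2_inner a b g g"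
    using f g L2_space_add[OF f g] L2_inner_commute[OF g f]
    by (simp add: L2_norm_power2 L2_inner_add_left[OF f g] L2_inner_add_right[OF f g])
  also have "\<dots> \<le> (L2_norm a b f + L2_norm a b g)\<^sup>2"
    using L2_Cauchy_Schwarz[OF f g] by (simp add: power2_sum L2_norm_power2[OF f] L2_norm_power2[OF g])
  finally show "(L2_norm a b (\<lambda>s. f s + g s))\<^sup>2 \<le> (L2_norm a b f + L2_norm a b g)\<^sup>2" .
qed (use L2_norm_nonneg f g in auto)

lemma L2_bounded_op_add:
  assumes Q: "L2_bounded_op a b m n Q" and S: "L2_bounded_op a b m n S"
  shows "L2_bounded_op a b m n (\<lambda>x s. Q x s + S x s)"
proof -
  from Q obtain C R where C: "C \<ge> 0" "\<And>x. x \<in> L2_space a b m \<Longrightarrow> L2_norm a b (Q x) \<le> C * L2_norm a b x"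
    and QR: "\<And>x. x \<in> L2_space a b m \<Longrightarrow> Q x \<in> L2_space a b n" "\<And>y. y \<in> L2_space a b n \<Longrightarrow> R y \<in> L2_space a b m"
    "\<And>x y. x \<in> L2_space a b m \<Longrightarrow> y \<in> L2_space a b n \<Longrightarrow> L2_inner a b (Q x) y = L2_inner a b x (R y)"
    unfolding L2_bounded_op_def by blast
  from S obtain D U where D: "D \<ge> 0" "\<And>x. x \<in> L2_space a b m \<Longrightarrow> L2_norm a b (S x) \<le> D * L2_norm a b x"
    and SU: "\<And>x. x \<in> L2_space a b m \<Longrightarrow> S x \<in> L2_space a b n" "\<And>y. y \<in> L2_space a b n \<Longrightarrow> U y \<in> L2_space a b m"
    "\<And>x y. x \<in> L2_space a b m \<Longrightarrow> y \<in> L2_space a b n \<Longrightarrow> L2_inner a b (S x) y = L2_inner a b x (U y)"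
    unfolding L2_bounded_op_def by blast
  have bd: "L2_norm a b (\<lambda>s. Q x s + S x s) \<le> (C + D) * L2_norm a b x" if "x \<in> L2_space a b m" for x
    using order_trans[OF L2_norm_triangle[OF QR(1)[OF that] SU(1)[OF that]] add_mono[OF C(2)[OF that] D(2)[OF that]]]
    by (simp add: distrib_right)
  show ?thesis
    unfolding L2_bounded_op_def
  proof (intro conjI exI[of _ "C + D"] exI[of _ "\<lambda>y s. R y s + U y s"] ballI)
    fix x y assume xy: "x \<in> L2_space a b m" "y \<in> L2_space a b n"
    show "L2_inner a b (\<lambda>s. Q x s + S x s) y = L2_inner a b x (\<lambda>s. R y s + U y s)"
      using QR(3)[OF xy] SU(3)[OF xy] L2_inner_add_left[OF QR(1)[OF xy(1)] SU(1)[OF xy(1)] xy(2)]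
        L2_inner_add_right[OF QR(2)[OF xy(2)] SU(2)[OF xy(2)] xy(1)] by simp
  qed (use C(1) D(1) QR(1,2) SU(1,2) bd in \<open>auto intro: L2_space_add\<close>)
qed

section \<open>From scalar entries to 3-PI operators\<close>

lemma sum_power2_le:
  fixes f :: "nat \<Rightarrow> real"
  shows "(\<Sum>j<m. f j)\<^sup>2 \<le> real m * (\<Sum>j<m. (f j)\<^sup>2)"
  using Cauchy_Schwarz_ineq_sum[of "\<lambda>_. 1" f "{..<m}"] by simp

text \<open>The adjoint is the transposed array of the scalar adjoints. The entrywise formula for
  \<open>Q\<close> is assumed almost everywhere, because the integral of a sum can be split only at
  points s where all sections are integrable.\<close>

lemma L2_bounded_op_matrix:
  assumes q: "\<And>i j. i < n \<Longrightarrow> j < m \<Longrightarrow> scalar_op a b (q i j)"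
    and car: "\<And>x s. x \<in> L2_space a b m \<Longrightarrow> s \<in> {a..b} \<Longrightarrow> Q x s \<in> carrier_vec n"
    and Q: "\<And>x i. x \<in> L2_space a b m \<Longrightarrow> i < n \<Longrightarrow>
      AE s in Leb a b. Q x s $ i = (\<Sum>j<m. q i j (\<lambda>s. x s $ j) s)"
  shows "L2_bounded_op a b m n Q"
proof -
  let ?I = "\<lambda>f. LINT s|Leb a b. f s"
  have "\<exists>r C. scalar_adjoint a b (q i j) r C" if "i < n" "j < m" for i j
    using q[OF that] unfolding scalar_op_def .
  then obtain r C where rC: "\<And>i j. i < n \<Longrightarrow> j < m \<Longrightarrow> scalar_adjoint a b (q i j) (r i j) (C i j)"
    by metis
  note rC = rC[unfolded scalar_adjoint_def]
  have C: "C i j \<ge> 0" if "i < n" "j < m" for i j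
    using rC[OF that] by blast
  have sq: "q i j f \<in> square_integrable a b" and sr: "r i j f \<in> square_integrable a b"
    and bd: "?I (\<lambda>s. (q i j f s)\<^sup>2) \<le> C i j * ?I (\<lambda>s. (f s)\<^sup>2)"
    if "i < n" "j < m" "f \<in> square_integrable a b" for i j f
    using rC[OF that(1,2)] that(3) by blast+
  have adj: "?I (\<lambda>s. q i j f s * g s) = ?I (\<lambda>s. f s * r i j g s)"
    if "i < n" "j < m" "f \<in> square_integrable a b" "g \<in> square_integrable a b" for i j f g
    using rC[OF that(1,2)] that(3,4) by blast
  have comp: "(\<lambda>s. x s $ j) \<in> square_integrable a b" if "x \<in> L2_space a b m" "j < m" for x j m
    by (rule L2_spaceD(3)[OF that])
  have sQ: "(\<lambda>s. \<Sum>j<m. q i j (\<lambda>s. x s $ j) s) \<in> square_integrable a b" if "x \<in> L2_space a b m" "i < n" for x i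
    using that by (intro square_integrable_sum sq comp) auto
  have QL: "Q x \<in> L2_space a b n" if x: "x \<in> L2_space a b m" for x
    unfolding L2_space_iff
  proof (intro conjI ballI allI impI)
    fix i assume "i < n"
    show "(\<lambda>s. Q x s $ i) \<in> square_integrable a b"
      by (rule square_integrable_cong_AE[OF sQ[OF x \<open>i < n\<close>]])
        (use Q[OF x \<open>i < n\<close>] in \<open>auto elim: eventually_mono\<close>)
  qed (use car x in auto)
  have Qi: "?I (\<lambda>s. Q x s $ i * g s) = (\<Sum>j<m. ?I (\<lambda>s. q i j (\<lambda>s. x s $ j) s * g s))"
    if x: "x \<in> L2_space a b m" and i: "i < n" and g: "g \<in> square_integrable a b" for x i g
  proof -
    have "?I (\<lambda>s. Q x s $ i * g s) = ?I (\<lambda>s. (\<Sum>j<m. q i j (\<lambda>s. x s $ j) s) * g s)"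
    proof (rule integral_cong_AE)
      show "(\<lambda>s. Q x s $ i * g s) \<in> borel_measurable (Leb a b)"
        using square_integrable_mult[OF L2_spaceD(3)[OF QL[OF x] i] g] by auto
      show "(\<lambda>s. (\<Sum>j<m. q i j (\<lambda>s. x s $ j) s) * g s) \<in> borel_measurable (Leb a b)"
        using square_integrable_mult[OF sQ[OF x i] g] by auto
      show "AE s in Leb a b. Q x s $ i * g s = (\<Sum>j<m. q i j (\<lambda>s. x s $ j) s) * g s"
        using Q[OF x i] by eventually_elim simp
    qed
    also have "\<dots> = (\<Sum>j<m. ?I (\<lambda>s. q i j (\<lambda>s. x s $ j) s * g s))"
      unfolding sum_distrib_right
      by (intro Bochner_Integration.integral_sum square_integrable_mult sq comp) (use x i g in auto)
    finally show ?thesis .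
  qed
  define R :: vop where "R y s = Matrix.vec m (\<lambda>j. \<Sum>i<n. r i j (\<lambda>s. y s $ i) s)" for y s
  have RL: "R y \<in> L2_space a b m" if "y \<in> L2_space a b n" for y
    unfolding L2_space_iff R_def using that
    by (auto intro!: square_integrable_sum sr comp)
  have QR: "L2_inner a b (Q x) y = L2_inner a b x (R y)" if x: "x \<in> L2_space a b m" and y: "y \<in> L2_space a b n" for x y
  proof -
    have "L2_inner a b (Q x) y = (\<Sum>i<n. \<Sum>j<m. ?I (\<lambda>s. q i j (\<lambda>s. x s $ j) s * y s $ i))"
      using Qi[OF x] comp[OF y] by (simp add: L2_inner_eq_sum[OF QL[OF x] y])
    also have "\<dots> = (\<Sum>i<n. \<Sum>j<m. ?I (\<lambda>s. x s $ j * r i j (\<lambda>s. y s $ i) s))"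
      by (intro sum.cong refl adj) (use x y in \<open>auto intro: comp\<close>)
    also have "\<dots> = (\<Sum>j<m. \<Sum>i<n. ?I (\<lambda>s. x s $ j * r i j (\<lambda>s. y s $ i) s))"
      by (rule sum.swap)
    also have "\<dots> = (\<Sum>j<m. ?I (\<lambda>s. x s $ j * R y s $ j))"
    proof (intro sum.cong refl)
      fix j assume "j \<in> {..<m}"
      then have "?I (\<lambda>s. x s $ j * R y s $ j) = ?I (\<lambda>s. \<Sum>i<n. x s $ j * r i j (\<lambda>s. y s $ i) s)"
        by (simp add: R_def sum_distrib_left)
      also have "\<dots> = (\<Sum>i<n. ?I (\<lambda>s. x s $ j * r i j (\<lambda>s. y s $ i) s))"
        by (intro Bochner_Integration.integral_sum square_integrable_mult sr comp) (use \<open>j \<in> _\<close> x y in auto)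
      finally show "(\<Sum>i<n. ?I (\<lambda>s. x s $ j * r i j (\<lambda>s. y s $ i) s)) = ?I (\<lambda>s. x s $ j * R y s $ j)" by simp
    qed
    also have "\<dots> = L2_inner a b x (R y)"
      by (simp add: L2_inner_eq_sum[OF x RL[OF y]])
    finally show ?thesis .
  qed
  \<comment> \<open>A squared sum of m terms is at most m times the sum of the squares. With this
    factor, the squared norm bounds \<open>C i j\<close> of the entries add up to a bound on the
    squared operator norm.\<close>
  define D where "D = (\<Sum>i<n. real m * (\<Sum>j<m. C i j))"
  have D0: "D \<ge> 0" unfolding D_def by (intro sum_nonneg mult_nonneg_nonneg) (auto intro: C)
  have bound: "L2_norm a b (Q x) \<le> sqrt D * L2_norm a b x" if x: "x \<in> L2_space a b m" for x
  proof -
    have nn: "?I (\<lambda>s. (x s $ j)\<^sup>2) \<le> L2_inner a b x x" if "j < m" for j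
      using member_le_sum[of j "{..<m}" "\<lambda>j. ?I (\<lambda>s. (x s $ j)\<^sup>2)"] that
      by (simp add: L2_inner_eq_sum[OF x x] power2_eq_square)
    have "L2_inner a b (Q x) (Q x) = (\<Sum>i<n. ?I (\<lambda>s. (Q x s $ i)\<^sup>2))"
      by (simp add: L2_inner_eq_sum[OF QL[OF x] QL[OF x]] power2_eq_square)
    also have "\<dots> \<le> (\<Sum>i<n. real m * (\<Sum>j<m. C i j) * L2_inner a b x x)"
    proof (rule sum_mono)
      fix i assume "i \<in> {..<n}"
      then have i: "i < n" by simp
      have iq: "integrable (Leb a b) (\<lambda>s. (q i j (\<lambda>s. x s $ j) s)\<^sup>2)" if "j < m" for j
        using sq[OF i that comp[OF x that]] by (simp add: square_integrable_def)
      have "?I (\<lambda>s. (Q x s $ i)\<^sup>2) = ?I (\<lambda>s. (\<Sum>j<m. q i j (\<lambda>s. x s $ j) s)\<^sup>2)"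
      proof (rule integral_cong_AE)
        show "AE s in Leb a b. (Q x s $ i)\<^sup>2 = (\<Sum>j<m. q i j (\<lambda>s. x s $ j) s)\<^sup>2"
          using Q[OF x i] by eventually_elim simp
      qed (use L2_spaceD(3)[OF QL[OF x] i] sQ[OF x i] in \<open>auto simp: square_integrable_def\<close>)
      also have "\<dots> \<le> ?I (\<lambda>s. real m * (\<Sum>j<m. (q i j (\<lambda>s. x s $ j) s)\<^sup>2))"
        by (rule integral_mono)
          (use sQ[OF x i] iq sum_power2_le in \<open>auto simp: square_integrable_def intro!: Bochner_Integration.integrable_sum\<close>)
      also have "\<dots> = real m * (\<Sum>j<m. ?I (\<lambda>s. (q i j (\<lambda>s. x s $ j) s)\<^sup>2))"
        using iq by (simp add: Bochner_Integration.integral_sum)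
      also have "\<dots> \<le> real m * (\<Sum>j<m. C i j * L2_inner a b x x)"
      proof (intro mult_left_mono sum_mono)
        fix j assume "j \<in> {..<m}"
        then have j: "j < m" by simp
        show "?I (\<lambda>s. (q i j (\<lambda>s. x s $ j) s)\<^sup>2) \<le> C i j * L2_inner a b x x"
          using bd[OF i j comp[OF x j]] mult_left_mono[OF nn[OF j] C[OF i j]] by linarith
      qed simp
      finally show "?I (\<lambda>s. (Q x s $ i)\<^sup>2) \<le> real m * (\<Sum>j<m. C i j) * L2_inner a b x x"
        by (simp add: sum_distrib_right mult.assoc)
    qed
    also have "\<dots> = D * L2_inner a b x x" by (simp add: D_def sum_distrib_right)
    finally show ?thesis
      unfolding L2_norm_def real_sqrt_mult[symmetric] by (rule real_sqrt_le_mono)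
  qed
  show ?thesis
    unfolding L2_bounded_op_def
    using QL RL QR bound D0 by (auto intro!: exI[of _ "sqrt D"] exI[of _ R])
qed

lemma L2_bounded_op_mult:
  assumes N: "bounded_measurable_mat {a..b} n m N"
  shows "L2_bounded_op a b m n (\<lambda>x s. N s *\<^sub>v x s)"
proof (rule L2_bounded_op_matrix)
  from N obtain C where C: "\<forall>s\<in>{a..b}. \<forall>i<n. \<forall>j<m. \<bar>N s $$ (i, j)\<bar> \<le> C"
    by (auto simp: bounded_measurable_mat_def)
  show "scalar_op a b (\<lambda>f s. N s $$ (i, j) * f s)" if "i < n" "j < m" for i j
    by (rule scalar_op_mult[of _ _ _ C]) (use N C that in \<open>auto simp: bounded_measurable_mat_def\<close>)
  fix x assume x: "x \<in> L2_space a b m"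
  have Nc: "N s \<in> carrier_mat n m" if "s \<in> {a..b}" for s
    using N that by (auto simp: bounded_measurable_mat_def)
  show "N s *\<^sub>v x s \<in> carrier_vec n" if "s \<in> {a..b}" for s
    using mult_mat_vec_carrier[OF Nc[OF that] L2_spaceD(1)[OF x that]] .
  show "AE s in Leb a b. (N s *\<^sub>v x s) $ i = (\<Sum>j<m. N s $$ (i, j) * x s $ j)" if "i < n" for i
  proof (rule AE_I2)
    fix s assume "s \<in> space (Leb a b)"
    then have s: "s \<in> {a..b}" by simp
    from Nc[OF s] L2_spaceD(2)[OF x s] that show "(N s *\<^sub>v x s) $ i = (\<Sum>j<m. N s $$ (i, j) * x s $ j)"
      by (auto simp: scalar_prod_def atLeast0LessThan)
  qed
qed

text \<open>The integrals over [a,s] and [s,b] in a 3-PI operator are integrals over [a,b] against a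
  kernel cut off along the diagonal. Closedness of the remaining region keeps the cut kernel
  measurable.\<close>

lemma bounded_kernel_if:
  assumes "bounded_kernel a b K" "closed {u :: real \<times> real. R (fst u) (snd u)}"
  shows "bounded_kernel a b (\<lambda>s \<theta>. if R s \<theta> then K s \<theta> else 0)"
  unfolding bounded_kernel_def
proof
  let ?S = "{a..b} \<times> {a..b}" and ?R = "{u :: real \<times> real. R (fst u) (snd u)}"
  have "?R \<inter> ?S \<in> sets (lebesgue_on ?S)"
  proof -
    have "?R \<in> sets lebesgue"
      using borel_closed[OF assms(2)] by (auto intro!: sets_completionI_sets)
    then show ?thesis by (simp add: sets_restrict_space_iff sets.Int)
  qed
  then have "indicat_real (?R \<inter> ?S) \<in> borel_measurable (lebesgue_on ?S)"
    by (rule borel_measurable_indicator)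
  moreover have "(\<lambda>(s, \<theta>). K s \<theta>) \<in> borel_measurable (lebesgue_on ?S)"
    using assms(1) by (simp add: bounded_kernel_def)
  ultimately have "(\<lambda>u. indicat_real (?R \<inter> ?S) u * (\<lambda>(s, \<theta>). K s \<theta>) u) \<in> borel_measurable (lebesgue_on ?S)"
    by (rule borel_measurable_times)
  then show "(\<lambda>(s, \<theta>). if R s \<theta> then K s \<theta> else 0) \<in> borel_measurable (lebesgue_on ?S)"
    by (rule measurable_cong[THEN iffD1, rotated]) (auto simp: indicator_def)
  from assms(1) obtain C where "\<forall>s\<in>{a..b}. \<forall>\<theta>\<in>{a..b}. \<bar>K s \<theta>\<bar> \<le> C"
    by (auto simp: bounded_kernel_def)
  then show "\<exists>C. \<forall>s\<in>{a..b}. \<forall>\<theta>\<in>{a..b}. \<bar>if R s \<theta> then K s \<theta> else 0\<bar> \<le> C"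
    by (intro exI[of _ "\<bar>C\<bar>"]) (auto intro: order_trans[OF _ abs_ge_self])
qed

lemma L2_bounded_op_kernel:
  assumes N: "bounded_measurable_mat ({a..b} \<times> {a..b}) n m (\<lambda>(s, \<theta>). N s \<theta>)" and "a \<le> b"
    and S: "\<And>s. s \<in> {a..b} \<Longrightarrow> S s \<in> sets lebesgue" "\<And>s. s \<in> {a..b} \<Longrightarrow> S s \<subseteq> {a..b}"
      "\<And>s \<theta>. s \<in> {a..b} \<Longrightarrow> \<theta> \<in> {a..b} \<Longrightarrow> \<theta> \<in> S s \<longleftrightarrow> R s \<theta>"
      "closed {u :: real \<times> real. R (fst u) (snd u)}"
  shows "L2_bounded_op a b m n (\<lambda>x s. vec_integral n (S s) (\<lambda>\<theta>. N s \<theta> *\<^sub>v x \<theta>))"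
proof (rule L2_bounded_op_matrix)
  let ?K = "\<lambda>i j s \<theta>. if R s \<theta> then N s \<theta> $$ (i, j) else 0"
  have Nc: "N s \<theta> \<in> carrier_mat n m" if "s \<in> {a..b}" "\<theta> \<in> {a..b}" for s \<theta>
    using N that by (auto simp: bounded_measurable_mat_def)
  from N obtain C where C: "\<forall>u\<in>{a..b} \<times> {a..b}. \<forall>i<n. \<forall>j<m. \<bar>(case u of (s, \<theta>) \<Rightarrow> N s \<theta>) $$ (i, j)\<bar> \<le> C"
    by (auto simp: bounded_measurable_mat_def)
  have K: "bounded_kernel a b (?K i j)" if "i < n" "j < m" for i j
  proof (rule bounded_kernel_if[OF _ S(4)])
    show "bounded_kernel a b (\<lambda>s \<theta>. N s \<theta> $$ (i, j))"
      unfolding bounded_kernel_def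
    proof
      show "(\<lambda>(s, \<theta>). N s \<theta> $$ (i, j)) \<in> borel_measurable (lebesgue_on ({a..b} \<times> {a..b}))"
        using N that unfolding bounded_measurable_mat_def case_prod_beta by auto
      show "\<exists>C. \<forall>s\<in>{a..b}. \<forall>\<theta>\<in>{a..b}. \<bar>N s \<theta> $$ (i, j)\<bar> \<le> C"
        using C that by (intro exI[of _ C]) force
    qed
  qed
  show "scalar_op a b (kernel_op a b (?K i j))" if "i < n" "j < m" for i j
    by (rule scalar_op_kernel[OF K[OF that] \<open>a \<le> b\<close>])
  fix x assume x: "x \<in> L2_space a b m"
  show "vec_integral n (S s) (\<lambda>\<theta>. N s \<theta> *\<^sub>v x \<theta>) \<in> carrier_vec n" for s
    by (simp add: vec_integral_def)
  fix i assume i: "i < n"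
  \<comment> \<open>Outside a null set of s all m sections are integrable at once, which permits the
    exchange of sum and integral.\<close>
  have "AE s in Leb a b. \<forall>j\<in>{..<m}. integrable (Leb a b) (\<lambda>\<theta>. ?K i j s \<theta> * x \<theta> $ j)"
    using kernel_op_integrable[OF K[OF i] square_integrable_imp_integrable[OF L2_spaceD(3)[OF x]]]
    by (intro AE_finite_allI) auto
  moreover have "AE s in Leb a b. s \<in> {a..b}"
    by (rule AE_I2) simp
  ultimately show "AE s in Leb a b. vec_integral n (S s) (\<lambda>\<theta>. N s \<theta> *\<^sub>v x \<theta>) $ i
      = (\<Sum>j<m. kernel_op a b (?K i j) (\<lambda>s. x s $ j) s)"
  proof eventually_elim
    case (elim s)
    have "vec_integral n (S s) (\<lambda>\<theta>. N s \<theta> *\<^sub>v x \<theta>) $ i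
        = (LINT \<theta>|Leb a b. (if \<theta> \<in> S s then (N s \<theta> *\<^sub>v x \<theta>) $ i else 0))"
      using i elim S(1,2) by (simp add: vec_integral_def integral_lebesgue_on_if(1)[OF Icc_sets_lebesgue])
    also have "\<dots> = (LINT \<theta>|Leb a b. (\<Sum>j<m. ?K i j s \<theta> * x \<theta> $ j))"
    proof (intro Bochner_Integration.integral_cong refl)
      fix \<theta> assume "\<theta> \<in> space (Leb a b)"
      then have \<theta>: "\<theta> \<in> {a..b}" by simp
      show "(if \<theta> \<in> S s then (N s \<theta> *\<^sub>v x \<theta>) $ i else 0) = (\<Sum>j<m. ?K i j s \<theta> * x \<theta> $ j)"
        using Nc[OF _ \<theta>, of s] elim i L2_spaceD(2)[OF x \<theta>] S(3)[OF _ \<theta>, of s]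
        by (auto simp: scalar_prod_def atLeast0LessThan)
    qed
    also have "\<dots> = (\<Sum>j<m. kernel_op a b (?K i j) (\<lambda>s. x s $ j) s)"
      unfolding kernel_op_def using elim by (intro Bochner_Integration.integral_sum) auto
    finally show ?case .
  qed
qed

lemma L2_bounded_op_PI:
  assumes "a \<le> b" "bounded_measurable_mat {a..b} n m N0"
    and "bounded_measurable_mat ({a..b} \<times> {a..b}) n m (\<lambda>(s, \<theta>). N1 s \<theta>)"
    and "bounded_measurable_mat ({a..b} \<times> {a..b}) n m (\<lambda>(s, \<theta>). N2 s \<theta>)"
  shows "L2_bounded_op a b m n (PI_op a b n N0 N1 N2)"
proof -
  have "L2_bounded_op a b m n (\<lambda>x s. vec_integral n {a..s} (\<lambda>\<theta>. N1 s \<theta> *\<^sub>v x \<theta>))"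
    by (rule L2_bounded_op_kernel[OF assms(3,1), where R = "\<lambda>s \<theta>. \<theta> \<le> s"]) (auto intro!: closed_Collect_le continuous_intros)
  moreover have "L2_bounded_op a b m n (\<lambda>x s. vec_integral n {s..b} (\<lambda>\<theta>. N2 s \<theta> *\<^sub>v x \<theta>))"
    by (rule L2_bounded_op_kernel[OF assms(4,1), where R = "\<lambda>s \<theta>. s \<le> \<theta>"]) (auto intro!: closed_Collect_le continuous_intros)
  ultimately have "L2_bounded_op a b m n (\<lambda>x s. N0 s *\<^sub>v x s
     + vec_integral n {a..s} (\<lambda>\<theta>. N1 s \<theta> *\<^sub>v x \<theta>)
     + vec_integral n {s..b} (\<lambda>\<theta>. N2 s \<theta> *\<^sub>v x \<theta>))"
    by (intro L2_bounded_op_add L2_bounded_op_mult assms)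
  then show ?thesis
    unfolding PI_op_def[abs_def] .
qed

section \<open>Adjoint, operator norm and linearity\<close>

lemma L2_adj:
  assumes Q: "L2_bounded_op a b n n Q" and "x \<in> L2_space a b n" "y \<in> L2_space a b n"
  shows "L2_adj a b n Q y \<in> L2_space a b n"
    and "L2_inner a b x (L2_adj a b n Q y) = L2_inner a b (Q x) y"
proof -
  have "\<exists>R. (\<forall>y\<in>L2_space a b n. R y \<in> L2_space a b n) \<and>
     (\<forall>x\<in>L2_space a b n. \<forall>y\<in>L2_space a b n. L2_inner a b (Q x) y = L2_inner a b x (R y))"
    using Q by (auto simp: L2_bounded_op_def)
  from someI_ex[OF this] assms(2,3)
  show "L2_adj a b n Q y \<in> L2_space a b n" "L2_inner a b x (L2_adj a b n Q y) = L2_inner a b (Q x) y"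
    unfolding L2_adj_def[symmetric] by auto
qed

lemma L2_norm_le_onorm:
  assumes Q: "L2_bounded_op a b m n Q" and x: "x \<in> L2_space a b m"
  shows "L2_norm a b (Q x) \<le> L2_onorm a b m Q * L2_norm a b x"
proof -
  from Q obtain C where C: "C \<ge> 0" "\<And>x. x \<in> L2_space a b m \<Longrightarrow> L2_norm a b (Q x) \<le> C * L2_norm a b x"
    by (auto simp: L2_bounded_op_def)
  show ?thesis
  proof (cases "L2_norm a b x = 0")
    \<comment> \<open>The quotient in \<open>L2_onorm\<close> is 0 by division by zero and says
      nothing about \<open>Q x\<close>; the bound by \<open>C\<close> makes the norm of
      \<open>Q x\<close> vanish.\<close>
    case True
    with C(2)[OF x] show ?thesis by simp
  next
    case False
    then have pos: "L2_norm a b x > 0" using L2_norm_nonneg[OF x] by linarith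
    have "L2_norm a b (Q x) / L2_norm a b x \<le> L2_onorm a b m Q"
      unfolding L2_onorm_def
    proof (rule cSUP_upper[OF x])
      have "L2_norm a b (Q y) / L2_norm a b y \<le> C" if "y \<in> L2_space a b m" for y
        using C(1) C(2)[OF that] L2_norm_nonneg[OF that]
        by (cases "L2_norm a b y = 0") (auto simp: divide_le_eq)
      then show "bdd_above ((\<lambda>x. L2_norm a b (Q x) / L2_norm a b x) ` L2_space a b m)"
        by (auto intro!: bdd_aboveI2[where M = C])
    qed
    with pos show ?thesis by (simp add: divide_le_eq)
  qed
qed

text \<open>Moving the operator to the other factor reduces the claim to the linearity of the inner
  product. Stating it after pairing with y yields exact equations in place of equalities almost
  everywhere.\<close>

lemma L2_bounded_op_linear:
  assumes Q: "L2_bounded_op a b m n Q" and f: "f \<in> L2_space a b m" and g: "g \<in> L2_space a b m"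
    and y: "y \<in> L2_space a b n"
  shows "L2_inner a b (Q (\<lambda>s. f s + g s)) y = L2_inner a b (Q f) y + L2_inner a b (Q g) y"
    and "L2_inner a b (Q (\<lambda>s. c \<cdot>\<^sub>v f s)) y = c * L2_inner a b (Q f) y"
proof -
  from Q obtain R where R: "R y \<in> L2_space a b m" "\<And>x. x \<in> L2_space a b m \<Longrightarrow> L2_inner a b (Q x) y = L2_inner a b x (R y)"
    using y unfolding L2_bounded_op_def by blast
  show "L2_inner a b (Q (\<lambda>s. f s + g s)) y = L2_inner a b (Q f) y + L2_inner a b (Q g) y"
    using R f g by (simp add: L2_space_add L2_inner_add_left[OF f g])
  show "L2_inner a b (Q (\<lambda>s. c \<cdot>\<^sub>v f s)) y = c * L2_inner a b (Q f) y"
    using R f by (simp add: L2_space_smult L2_inner_smult_left[OF f])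
qed

section \<open>Weak derivatives\<close>

lemma integrable_lebesgue_on_subinterval:
  fixes g :: "real \<Rightarrow> real"
  assumes g: "integrable (Leb a b) g" and cd: "{c..d} \<subseteq> {a..b}"
  shows "integrable (Leb c d) g"
proof -
  have "{c..d} \<in> sets (Leb a b)"
    using cd by (simp add: sets_restrict_space_iff)
  from integrable_mult_indicator[OF this g]
  have "integrable (Leb a b) (\<lambda>x. if x \<in> {c..d} then g x else 0)"
    by (rule Bochner_Integration.integrable_cong[THEN iffD1, rotated -1]) auto
  then show ?thesis
    using cd by (simp only: integral_lebesgue_on_if(2)[OF Icc_sets_lebesgue Icc_sets_lebesgue cd])
qed

lemma continuous_on_primitive:
  fixes g :: "real \<Rightarrow> real"
  assumes g: "integrable (Leb a b) g"
  shows "continuous_on {a..b} (\<lambda>s. LINT \<theta>|Leb a s. g \<theta>)"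
proof -
  have "g integrable_on {a..b}"
    using g by (simp add: integrable_on_lebesgue_on)
  then have "continuous_on {a..b} (\<lambda>s. integral {a..s} g)"
    by (rule indefinite_integral_continuous_1)
  moreover have "integral {a..s} g = (LINT \<theta>|Leb a s. g \<theta>)" if "s \<in> {a..b}" for s
    using that by (intro lebesgue_integral_eq_integral[symmetric] integrable_lebesgue_on_subinterval[OF g]) auto
  ultimately show ?thesis by (rule continuous_on_eq)
qed

lemma bounded_kernel_le: "bounded_kernel a b (\<lambda>s \<theta>. if \<theta> \<le> s then 1 else 0)"
proof (rule bounded_kernel_if)
  show "bounded_kernel a b (\<lambda>s \<theta>. 1)"
    by (auto simp: bounded_kernel_def case_prod_beta)
qed (auto intro!: closed_Collect_le continuous_intros)

text \<open>As a kernel operator, integration from \<open>a\<close> has integration up to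
  \<open>b\<close> as its adjoint. Through \<open>kernel_op_adjoint\<close> this provides both the
  exchange of iterated integrals over a triangle and integration by parts.\<close>

lemma primitive_eq_kernel_op:
  assumes "s \<le> b"
  shows "(LINT \<theta>|Leb a s. g \<theta>) = kernel_op a b (\<lambda>s \<theta>. if \<theta> \<le> s then 1 else 0) g s"
proof -
  have "{a..s} \<subseteq> {a..b}" using assms by auto
  from integral_lebesgue_on_if(1)[OF _ _ this] show ?thesis
    unfolding kernel_op_def by (auto intro!: Bochner_Integration.integral_cong)
qed

text \<open>Cauchy's formula for repeated integration. The primitive is paired with the constant 1;
  passing to the adjoint leaves the length s - \<theta> as a weight.\<close>

lemma primitive_of_primitive:
  fixes h :: "real \<Rightarrow> real"
  assumes h: "integrable (Leb a s) h"
  shows "(LINT r|Leb a s. (LINT \<theta>|Leb a r. h \<theta>)) = (LINT \<theta>|Leb a s. (s - \<theta>) * h \<theta>)"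
proof -
  let ?K = "\<lambda>s \<theta>. if \<theta> \<le> s then 1 else 0 :: real"
  have "(LINT r|Leb a s. (LINT \<theta>|Leb a r. h \<theta>)) = (LINT r|Leb a s. kernel_op a s ?K h r * 1)"
    by (intro Bochner_Integration.integral_cong) (auto simp: primitive_eq_kernel_op)
  also have "\<dots> = (LINT \<theta>|Leb a s. h \<theta> * kernel_op a s (\<lambda>s \<theta>. ?K \<theta> s) (\<lambda>_. 1) \<theta>)"
    by (intro kernel_op_adjoint bounded_kernel_le h integrable_const_lebesgue_on)
  also have "\<dots> = (LINT \<theta>|Leb a s. (s - \<theta>) * h \<theta>)"
  proof (intro Bochner_Integration.integral_cong refl)
    fix \<theta> assume "\<theta> \<in> space (Leb a s)"
    then have \<theta>: "{\<theta>..s} \<subseteq> {a..s}" "\<theta> \<le> s" by auto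
    have "kernel_op a s (\<lambda>s \<theta>. ?K \<theta> s) (\<lambda>_. 1) \<theta> = (LINT r|lebesgue_on {\<theta>..s}. 1)"
      unfolding kernel_op_def integral_lebesgue_on_if(1)[OF Icc_sets_lebesgue Icc_sets_lebesgue \<theta>(1)]
      by (intro Bochner_Integration.integral_cong) auto
    also have "\<dots> = s - \<theta>" using \<theta>(2) by (simp add: measure_restrict_space)
    finally show "h \<theta> * kernel_op a s (\<lambda>s \<theta>. ?K \<theta> s) (\<lambda>_. 1) \<theta> = (s - \<theta>) * h \<theta>" by simp
  qed
  finally show ?thesis .
qed

text \<open>The primitive of g has weak derivative g, so its difference from f has weak derivative
  zero and \<open>du_Bois_Reymond\<close> applies.\<close>

lemma weak_derivative_imp_primitive:
  fixes f g :: "real \<Rightarrow> real"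
  assumes f: "integrable (Leb a b) f" and g: "integrable (Leb a b) g" and "a < b"
    and weak: "\<And>\<phi>. test_function a b \<phi> \<Longrightarrow>
      (LINT s|Leb a b. f s * deriv \<phi> s) = - (LINT s|Leb a b. g s * \<phi> s)"
  shows "\<exists>c. AE s in Leb a b. f s = c + (LINT \<theta>|Leb a s. g \<theta>)"
proof -
  let ?I = "\<lambda>f. LINT s|Leb a b. f s" and ?K = "\<lambda>s \<theta>. if \<theta> \<le> s then 1 else 0 :: real"
  define G where "G s = (LINT \<theta>|Leb a s. g \<theta>)" for s
  have G: "continuous_on {a..b} G"
    unfolding G_def by (rule continuous_on_primitive[OF g])
  have intG: "integrable (Leb a b) G"
    using integrable_mult_continuous[OF integrable_const_lebesgue_on[of a b 1] G] by simp
  \<comment> \<open>Integration by parts without differentiating G: the adjoint of the primitive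
    sends \<phi>' to its integral over [s,b], which is -\<phi>(s) because \<phi>(b) = 0.\<close>
  have parts: "?I (\<lambda>s. G s * deriv \<phi> s) = - ?I (\<lambda>s. g s * \<phi> s)" if \<phi>: "test_function a b \<phi>" for \<phi>
  proof -
    have sm: "smooth \<phi>" "smooth (deriv \<phi>)" using \<phi> smooth_deriv by (auto simp: test_function_iff)
    have \<phi>b: "\<phi> b = 0" using \<phi> by (auto simp: test_function_iff)
    have id: "integrable (Leb a b) (deriv \<phi>)"
      using integrable_mult_continuous[OF integrable_const_lebesgue_on[of a b 1] smooth_continuous_on[OF sm(2)]] by simp
    have "?I (\<lambda>s. G s * deriv \<phi> s) = ?I (\<lambda>s. kernel_op a b ?K g s * deriv \<phi> s)"
      by (intro Bochner_Integration.integral_cong) (auto simp: G_def primitive_eq_kernel_op)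
    also have "\<dots> = ?I (\<lambda>s. g s * kernel_op a b (\<lambda>s \<theta>. ?K \<theta> s) (deriv \<phi>) s)"
      by (rule kernel_op_adjoint[OF bounded_kernel_le g id])
    also have "\<dots> = ?I (\<lambda>s. - (g s * \<phi> s))"
    proof (intro Bochner_Integration.integral_cong refl)
      fix s assume "s \<in> space (Leb a b)"
      then have s: "{s..b} \<subseteq> {a..b}" "s \<le> b" by auto
      have "kernel_op a b (\<lambda>s \<theta>. ?K \<theta> s) (deriv \<phi>) s = (LINT \<theta>|Leb s b. deriv \<phi> \<theta>)"
        unfolding kernel_op_def integral_lebesgue_on_if(1)[OF Icc_sets_lebesgue Icc_sets_lebesgue s(1)]
        by (intro Bochner_Integration.integral_cong) auto
      also have "\<dots> = integral {s..b} (deriv \<phi>)"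
        by (intro lebesgue_integral_eq_integral integrable_lebesgue_on_subinterval[OF id s(1)]) auto
      also have "\<dots> = \<phi> b - \<phi> s"
      proof (intro integral_unique fundamental_theorem_of_calculus s(2))
        show "(\<phi> has_vector_derivative deriv \<phi> x) (at x within {s..b})" for x
          using smooth_has_derivative[OF sm(1)] has_field_derivative_at_within
          unfolding has_real_derivative_iff_has_vector_derivative[symmetric] by blast
      qed
      finally show "g s * kernel_op a b (\<lambda>s \<theta>. ?K \<theta> s) (deriv \<phi>) s = - (g s * \<phi> s)"
        using \<phi>b by simp
    qed
    finally show ?thesis by simp
  qed
  have "\<exists>c. AE s in Leb a b. f s - G s = c"
  proof (rule du_Bois_Reymond[OF _ \<open>a < b\<close>])
    show "integrable (Leb a b) (\<lambda>s. f s - G s)"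
      using f intG by simp
    fix \<phi> assume \<phi>: "test_function a b \<phi>"
    have c: "continuous_on {a..b} (deriv \<phi>)"
      using \<phi> by (auto simp: test_function_iff intro: smooth_continuous_on smooth_deriv)
    show "?I (\<lambda>s. (f s - G s) * deriv \<phi> s) = 0"
      using integrable_mult_continuous[OF f c] integrable_mult_continuous[OF intG c] weak[OF \<phi>] parts[OF \<phi>]
      by (simp add: left_diff_distrib)
  qed
  then obtain c where "AE s in Leb a b. f s - G s = c" ..
  then have "AE s in Leb a b. f s = c + G s"
    by eventually_elim simp
  then show ?thesis unfolding G_def ..
qed

lemma continuous_AE_eq:
  fixes f g :: "real \<Rightarrow> real"
  assumes "continuous_on {a..b} f" "continuous_on {a..b} g" "a < b"
    and ae: "AE s in Leb a b. f s = g s" and s: "s \<in> {a..b}"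
  shows "f s = g s"
proof -
  let ?h = "\<lambda>s. \<bar>f s - g s\<bar>"
  have c: "continuous_on {a..b} ?h" by (intro continuous_intros assms)
  have i: "integrable (Leb a b) ?h"
    using integrable_mult_continuous[OF integrable_const_lebesgue_on[of a b 1] c] by simp
  have "integral {a..b} ?h = (LINT s|Leb a b. ?h s)"
    by (intro lebesgue_integral_eq_integral[symmetric] i) auto
  also have "\<dots> = (LINT s|Leb a b. 0)"
    by (rule integral_cong_AE) (use i ae in auto)
  finally have "integral {a..b} ?h = 0" by simp
  then have "\<forall>x\<in>{a..b}. ?h x = 0"
    using integral_eq_0_iff[OF c \<open>a < b\<close>] by simp
  with s show ?thesis by simp
qed

section \<open>Weak derivatives and continuous representatives of vector functions\<close>

lemma L2_eq_iff:
  assumes "f \<in> L2_space a b m" "g \<in> L2_space a b m"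
  shows "L2_eq a b f g \<longleftrightarrow> (\<forall>i<m. AE s in Leb a b. f s $ i = g s $ i)"
proof
  assume "L2_eq a b f g"
  then show "\<forall>i<m. AE s in Leb a b. f s $ i = g s $ i"
    by (auto simp: L2_eq_def elim: eventually_mono)
next
  assume "\<forall>i<m. AE s in Leb a b. f s $ i = g s $ i"
  then have "AE s in Leb a b. \<forall>i\<in>{..<m}. f s $ i = g s $ i"
    by (intro AE_finite_allI) auto
  moreover have "AE s in Leb a b. s \<in> {a..b}"
    by (rule AE_I2) simp
  ultimately show "L2_eq a b f g"
    unfolding L2_eq_def
    by eventually_elim (use L2_spaceD(2)[OF assms(1)] L2_spaceD(2)[OF assms(2)] in \<open>auto intro!: eq_vecI\<close>)
qed

lemma L2_comp_integrable:
  assumes "f \<in> L2_space a b m" "i < m"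
  shows "integrable (Leb a b) (\<lambda>s. f s $ i)"
  by (intro square_integrable_imp_integrable L2_spaceD(3)[OF assms])

lemma test_function_deriv:
  assumes "test_function a b \<phi>"
  shows "test_function a b ((deriv ^^ k) \<phi>)"
proof (induction k)
  case (Suc k)
  then obtain c d where cd: "a < c" "d < b" "\<And>x. x \<notin> {c..d} \<Longrightarrow> (deriv ^^ k) \<phi> x = 0"
    and sm: "smooth ((deriv ^^ k) \<phi>)"
    by (auto simp: test_function_iff)
  have "deriv ((deriv ^^ k) \<phi>) x = 0" if "x \<notin> {c..d}" for x
  proof (rule DERIV_imp_deriv)
    have "((\<lambda>_. 0) has_real_derivative 0) (at x)" by simp
    then show "((deriv ^^ k) \<phi> has_real_derivative 0) (at x)"
      by (rule has_field_derivative_transform_within_open[of _ _ _ "- {c..d}"]) (use cd that in auto)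
  qed
  with cd smooth_deriv[OF sm] show ?case
    by (auto simp: test_function_iff)
qed (use assms in simp)

lemma wderiv:
  assumes "g \<in> L2_space a b m" "is_weak_deriv a b m k f g"
  shows "wderiv a b m k f \<in> L2_space a b m" "is_weak_deriv a b m k f (wderiv a b m k f)"
proof -
  have "\<exists>g. g \<in> L2_space a b m \<and> is_weak_deriv a b m k f g" using assms by blast
  from someI_ex[OF this]
  show "wderiv a b m k f \<in> L2_space a b m" "is_weak_deriv a b m k f (wderiv a b m k f)"
    unfolding wderiv_def by auto
qed

lemma is_weak_deriv_unique:
  assumes g: "g \<in> L2_space a b m" and h: "h \<in> L2_space a b m"
    and "is_weak_deriv a b m k f g" "is_weak_deriv a b m k f h"
  shows "L2_eq a b g h"
  unfolding L2_eq_iff[OF g h]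
proof (intro allI impI)
  fix i assume i: "i < m"
  have "AE s in Leb a b. g s $ i - h s $ i = 0"
  proof (rule fundamental_lemma)
    show "integrable (Leb a b) (\<lambda>s. g s $ i - h s $ i)"
      using L2_comp_integrable[OF g i] L2_comp_integrable[OF h i] by simp
    fix \<phi> assume \<phi>: "test_function a b \<phi>"
    have "(-1) ^ k * (LINT s|Leb a b. g s $ i * \<phi> s) = (-1) ^ k * (LINT s|Leb a b. h s $ i * \<phi> s)"
      using assms(3)[unfolded is_weak_deriv_def, rule_format, OF i \<phi>]
        assms(4)[unfolded is_weak_deriv_def, rule_format, OF i \<phi>] by simp
    then have "(LINT s|Leb a b. g s $ i * \<phi> s) = (LINT s|Leb a b. h s $ i * \<phi> s)"
      by simp
    then show "(LINT s|Leb a b. (g s $ i - h s $ i) * \<phi> s) = 0"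
      using test_function_integrable[OF L2_comp_integrable[OF g i] \<phi>] test_function_integrable[OF L2_comp_integrable[OF h i] \<phi>]
      by (simp add: left_diff_distrib)
  qed
  then show "AE s in Leb a b. g s $ i = h s $ i"
    by eventually_elim simp
qed

lemma is_weak_deriv_linear:
  assumes L: "f \<in> L2_space a b m" "f' \<in> L2_space a b m" "g \<in> L2_space a b m" "g' \<in> L2_space a b m"
    and W: "is_weak_deriv a b m k f g" "is_weak_deriv a b m k f' g'"
  shows "is_weak_deriv a b m k (\<lambda>s. f s + c \<cdot>\<^sub>v f' s) (\<lambda>s. g s + c \<cdot>\<^sub>v g' s)"
  unfolding is_weak_deriv_def
proof (intro allI impI)
  fix i \<phi> assume i: "i < m" and \<phi>: "test_function a b \<phi>"
  have lin: "(LINT s|Leb a b. (u s + c \<cdot>\<^sub>v u' s) $ i * \<psi> s)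
      = (LINT s|Leb a b. u s $ i * \<psi> s) + c * (LINT s|Leb a b. u' s $ i * \<psi> s)"
    if u: "u \<in> L2_space a b m" "u' \<in> L2_space a b m" and \<psi>: "test_function a b \<psi>" for u u' \<psi>
  proof -
    have "(LINT s|Leb a b. (u s + c \<cdot>\<^sub>v u' s) $ i * \<psi> s)
        = (LINT s|Leb a b. u s $ i * \<psi> s + c * (u' s $ i * \<psi> s))"
      by (intro Bochner_Integration.integral_cong)
        (use i L2_spaceD(2)[OF u(2)] in \<open>auto simp: distrib_right\<close>)
    also have "\<dots> = (LINT s|Leb a b. u s $ i * \<psi> s) + c * (LINT s|Leb a b. u' s $ i * \<psi> s)"
      using test_function_integrable[OF L2_comp_integrable[OF u(1) i] \<psi>] test_function_integrable[OF L2_comp_integrable[OF u(2) i] \<psi>]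
      by simp
    finally show ?thesis .
  qed
  have
    "(LINT s|Leb a b. f s $ i * (deriv ^^ k) \<phi> s) = (-1) ^ k * (LINT s|Leb a b. g s $ i * \<phi> s)"
    "(LINT s|Leb a b. f' s $ i * (deriv ^^ k) \<phi> s) = (-1) ^ k * (LINT s|Leb a b. g' s $ i * \<phi> s)"
    using W(1)[unfolded is_weak_deriv_def, rule_format, OF i \<phi>]
      W(2)[unfolded is_weak_deriv_def, rule_format, OF i \<phi>] by auto
  then show "(LINT s|Leb a b. (f s + c \<cdot>\<^sub>v f' s) $ i * (deriv ^^ k) \<phi> s)
      = (-1) ^ k * (LINT s|Leb a b. (g s + c \<cdot>\<^sub>v g' s) $ i * \<phi> s)"
    unfolding lin[OF L(1,2) test_function_deriv[OF \<phi>]] lin[OF L(3,4) \<phi>] by (simp add: algebra_simps)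
qed

lemma is_weak_deriv_cong:
  assumes "\<And>s. s \<in> {a..b} \<Longrightarrow> f s = f' s" "is_weak_deriv a b m k f g"
  shows "is_weak_deriv a b m k f' g"
proof -
  have "(LINT s|Leb a b. f s $ i * \<psi> s) = (LINT s|Leb a b. f' s $ i * \<psi> s)" for i \<psi>
    by (intro Bochner_Integration.integral_cong) (auto simp: assms(1))
  with assms(2) show ?thesis by (simp add: is_weak_deriv_def)
qed

text \<open>Derivatives of test functions are test functions, so the first identity may be tested
  with \<phi>'. In \<open>sobolev\<close> each derivative refers to the function itself, whereas
  Taylor's formula needs the second derivative as the derivative of the first.\<close>

lemma is_weak_deriv_2:
  assumes W1: "is_weak_deriv a b m 1 f g" and W2: "is_weak_deriv a b m 2 f h"
  shows "is_weak_deriv a b m 1 g h"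
  unfolding is_weak_deriv_def
proof (intro allI impI)
  fix i \<phi> assume i: "i < m" and \<phi>: "test_function a b \<phi>"
  have "test_function a b (deriv \<phi>)" using test_function_deriv[OF \<phi>, of 1] by simp
  from W1[unfolded is_weak_deriv_def, rule_format, OF i this]
  have "(LINT s|Leb a b. f s $ i * deriv (deriv \<phi>) s) = - (LINT s|Leb a b. g s $ i * deriv \<phi> s)"
    by simp
  moreover from W2[unfolded is_weak_deriv_def, rule_format, OF i \<phi>] have "(LINT s|Leb a b. f s $ i * deriv (deriv \<phi>) s) = (LINT s|Leb a b. h s $ i * \<phi> s)"
    by (simp add: numeral_2_eq_2)
  ultimately show "(LINT s|Leb a b. g s $ i * (deriv ^^ 1) \<phi> s) = (-1) ^ 1 * (LINT s|Leb a b. h s $ i * \<phi> s)"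
    by simp
qed

text \<open>The primitive obtained from the weak derivative is a continuous representative, so the
  choice in \<open>cont_rep\<close> succeeds. Continuous functions that agree almost everywhere
  agree everywhere, so the chosen representative inherits the primitive formula.\<close>

lemma cont_rep:
  assumes "a < b" and f: "f \<in> L2_space a b m" and g: "g \<in> L2_space a b m" and W: "is_weak_deriv a b m 1 f g"
  shows cont_rep_carrier: "\<And>s. s \<in> {a..b} \<Longrightarrow> cont_rep a b m f s \<in> carrier_vec m"
    and cont_rep_eq: "L2_eq a b f (cont_rep a b m f)"
    and cont_rep_primitive: "\<And>s. s \<in> {a..b} \<Longrightarrow> cont_rep a b m f s = cont_rep a b m f a + vec_integral m {a..s} g"
proof -
  have "\<exists>c. AE s in Leb a b. f s $ i = c + (LINT \<theta>|Leb a s. g \<theta> $ i)" if i: "i < m" for i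
  proof (rule weak_derivative_imp_primitive[OF L2_comp_integrable[OF f i] L2_comp_integrable[OF g i] \<open>a < b\<close>])
    fix \<phi> assume "test_function a b \<phi>"
    from W[unfolded is_weak_deriv_def, rule_format, OF i this] show "(LINT s|Leb a b. f s $ i * deriv \<phi> s) = - (LINT s|Leb a b. g s $ i * \<phi> s)"
      by simp
  qed
  from someI_ex[OF this] obtain c
    where c: "\<And>i. i < m \<Longrightarrow> AE s in Leb a b. f s $ i = c i + (LINT \<theta>|Leb a s. g \<theta> $ i)"
    by (rule that)
  define F :: vfun where "F s = Matrix.vec m (\<lambda>i. c i + (LINT \<theta>|Leb a s. g \<theta> $ i))" for s
  have Fcont: "continuous_on {a..b} (\<lambda>s. F s $ i)" if "i < m" for i
    using continuous_on_primitive[OF L2_comp_integrable[OF g that]] that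
    by (simp add: F_def) (intro continuous_intros)
  have "AE s in Leb a b. \<forall>i\<in>{..<m}. f s $ i = F s $ i"
    by (intro AE_finite_allI) (auto simp: F_def c)
  moreover have "AE s in Leb a b. s \<in> {a..b}"
    by (rule AE_I2) simp
  ultimately have Feq: "L2_eq a b f F"
    unfolding L2_eq_def
    by eventually_elim (use L2_spaceD(2)[OF f] in \<open>auto intro!: eq_vecI simp: F_def\<close>)
  let ?G = "cont_rep a b m f"
  have "\<exists>g. (\<forall>s\<in>{a..b}. g s \<in> carrier_vec m) \<and> (\<forall>i<m. continuous_on {a..b} (\<lambda>s. g s $ i)) \<and> L2_eq a b f g"
    by (rule exI[of _ F]) (use Fcont Feq in \<open>auto simp: F_def\<close>)
  from someI_ex[OF this]
  have G: "\<And>s. s \<in> {a..b} \<Longrightarrow> ?G s \<in> carrier_vec m" "\<And>i. i < m \<Longrightarrow> continuous_on {a..b} (\<lambda>s. ?G s $ i)" "L2_eq a b f ?G"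
    unfolding cont_rep_def[symmetric] by auto
  have GF: "?G s $ i = F s $ i" if s: "s \<in> {a..b}" and i: "i < m" for s i
  proof (rule continuous_AE_eq[OF G(2)[OF i] Fcont[OF i] \<open>a < b\<close> _ s])
    have "L2_eq a b ?G F" using L2_eq_trans[OF L2_eq_sym[OF G(3)] Feq] .
    then show "AE s in Leb a b. ?G s $ i = F s $ i"
      by (auto simp: L2_eq_def elim: eventually_mono)
  qed
  show "?G s \<in> carrier_vec m" if "s \<in> {a..b}" for s using G(1) that .
  show "L2_eq a b f ?G" by (rule G(3))
  show "?G s = ?G a + vec_integral m {a..s} g" if s: "s \<in> {a..b}" for s
  proof (rule eq_vecI)
    \<comment> \<open>The integral over a single point vanishes, which identifies the unknown
      constants \<open>c i\<close> with the components of the value at \<open>a\<close>.\<close>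
    have z: "(LINT \<theta>|lebesgue_on {a..a}. g \<theta> $ i) = 0" for i
    proof -
      have "(LINT \<theta>|lebesgue_on {a..a}. g \<theta> $ i) = (LINT \<theta>|lebesgue_on {a..a}. g a $ i)"
        by (intro Bochner_Integration.integral_cong) auto
      then show ?thesis by (simp add: measure_restrict_space)
    qed
    fix i assume "i < dim_vec (?G a + vec_integral m {a..s} g)"
    then have i: "i < m" by (simp add: vec_integral_def)
    have "a \<in> {a..b}" using \<open>a < b\<close> by simp
    from GF[OF this i] GF[OF s i] i show "?G s $ i = (?G a + vec_integral m {a..s} g) $ i"
      by (simp add: F_def vec_integral_def z[simplified])
  qed (use G(1)[OF s] in \<open>simp add: vec_integral_def\<close>)
qed

section \<open>Matrix-valued functions\<close>

lemma dim_append_cols [simp]: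
  "dim_row (A @\<^sub>c B) = dim_row A" "dim_col (A @\<^sub>c B) = dim_col A + dim_col B"
  by (auto simp: append_cols_def)

lemma dim_append_rows [simp]:
  "dim_row (A @\<^sub>r B) = dim_row A + dim_row B" "dim_col (A @\<^sub>r B) = dim_col A"
  by (auto simp: append_rows_def)

lemma append_rows_mult_vec:
  fixes A B :: "real mat"
  assumes "dim_col A = dim_vec v" "dim_col B = dim_vec v"
  shows "(A @\<^sub>r B) *\<^sub>v v = (A *\<^sub>v v) @\<^sub>v (B *\<^sub>v v)"
  by (rule mat_mult_append[of A "dim_row A" "dim_vec v" B "dim_row B" v]) (auto simp only: carrier_matI carrier_vecI assms)

lemma append_cols_mult_vec:
  fixes A B :: "real mat"
  assumes "dim_row A = dim_row B" "dim_col A = dim_vec v" "dim_col B = dim_vec w"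
  shows "(A @\<^sub>c B) *\<^sub>v (v @\<^sub>v w) = A *\<^sub>v v + B *\<^sub>v w"
proof -
  have "(A @\<^sub>c B) *\<^sub>v (v @\<^sub>v w) = (A *\<^sub>v v + B *\<^sub>v w) @\<^sub>v (0\<^sub>m 0 (dim_col A) *\<^sub>v v + 0\<^sub>m 0 (dim_col B) *\<^sub>v w)"
    unfolding append_cols_def
    by (rule four_block_mat_mult_vec[of _ "dim_row A" "dim_vec v" _ "dim_vec w" _ 0])
      (simp_all only: carrier_matI carrier_vecI assms index_zero_mat)
  \<comment> \<open>\<open>append_cols\<close> is a four-block matrix whose lower blocks have no
    rows, so the product carries an empty tail.\<close>
  moreover have "v @\<^sub>v w = v" if "dim_vec w = 0" for v w :: "real Matrix.vec"
    using that by (auto intro!: eq_vecI)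
  ultimately show ?thesis by simp
qed

lemma zero_mult_vec: "dim_vec v = q \<Longrightarrow> (0\<^sub>m p q :: real mat) *\<^sub>v v = 0\<^sub>v p"
  by (auto intro!: eq_vecI simp: scalar_prod_def)

lemma one_mult_vec: "dim_vec v = q \<Longrightarrow> (1\<^sub>m q :: real mat) *\<^sub>v v = v"
  by (intro one_mult_mat_vec carrier_vecI)

lemma smult_one_mult_vec:
  fixes c :: real
  assumes "dim_vec v = q"
  shows "(c \<cdot>\<^sub>m 1\<^sub>m q) *\<^sub>v v = c \<cdot>\<^sub>v v"
proof (rule eq_vecI)
  fix i assume "i < dim_vec (c \<cdot>\<^sub>v v)"
  then have i: "i < q" using assms by simp
  have v: "v \<in> carrier_vec q" using assms by (rule carrier_vecI)
  have "((c \<cdot>\<^sub>m 1\<^sub>m q) *\<^sub>v v) $ i = (c \<cdot>\<^sub>v unit_vec q i) \<bullet> v"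
    using i by simp
  also have "\<dots> = c * (unit_vec q i \<bullet> v)"
    using v by (intro smult_scalar_prod_distrib) auto
  also have "\<dots> = (c \<cdot>\<^sub>v v) $ i"
    using v i by (simp add: scalar_prod_left_unit)
  finally show "((c \<cdot>\<^sub>m 1\<^sub>m q) *\<^sub>v v) $ i = (c \<cdot>\<^sub>v v) $ i" .
qed (use assms in simp)

lemma add_zero_vec:
  fixes v :: "real Matrix.vec"
  shows "dim_vec v = p \<Longrightarrow> 0\<^sub>v p + v = v" "dim_vec v = p \<Longrightarrow> v + 0\<^sub>v p = v"
  by (auto intro!: eq_vecI)

lemma append_vec_add_dim:
  fixes v w :: "real Matrix.vec"
  assumes "dim_vec v = dim_vec v'" "dim_vec w = dim_vec w'"
  shows "(v @\<^sub>v w) + (v' @\<^sub>v w') = (v + v') @\<^sub>v (w + w')"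
  using assms by (auto intro!: eq_vecI)

lemmas block_simps = append_rows_mult_vec append_cols_mult_vec zero_mult_vec one_mult_vec
  smult_one_mult_vec add_zero_vec append_vec_add_dim add.assoc

section \<open>Continuous matrix functions\<close>

definition continuous_mat :: "'a::topological_space set \<Rightarrow> nat \<Rightarrow> nat \<Rightarrow> ('a \<Rightarrow> real mat) \<Rightarrow> bool" where
  "continuous_mat S p q F \<longleftrightarrow> (\<forall>u\<in>S. F u \<in> carrier_mat p q) \<and>
     (\<forall>i<p. \<forall>j<q. continuous_on S (\<lambda>u. F u $$ (i, j)))"

lemma continuous_matI:
  assumes "\<And>u. u \<in> S \<Longrightarrow> F u \<in> carrier_mat p q"
    "\<And>i j. i < p \<Longrightarrow> j < q \<Longrightarrow> continuous_on S (g i j)"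
    "\<And>i j u. i < p \<Longrightarrow> j < q \<Longrightarrow> u \<in> S \<Longrightarrow> g i j u = F u $$ (i, j)"
  shows "continuous_mat S p q F"
  unfolding continuous_mat_def
  using assms(1) continuous_on_eq[OF assms(2) assms(3)] by auto

lemma continuous_matD:
  assumes "continuous_mat S p q F"
  shows "u \<in> S \<Longrightarrow> F u \<in> carrier_mat p q" "u \<in> S \<Longrightarrow> dim_row (F u) = p" "u \<in> S \<Longrightarrow> dim_col (F u) = q"
    "i < p \<Longrightarrow> j < q \<Longrightarrow> continuous_on S (\<lambda>u. F u $$ (i, j))"
  using assms by (auto simp: continuous_mat_def)

lemma continuous_mat_const: "A \<in> carrier_mat p q \<Longrightarrow> continuous_mat S p q (\<lambda>_. A)"
  by (auto simp: continuous_mat_def)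

lemma continuous_mat_zero: "continuous_mat S p q (\<lambda>_. 0\<^sub>m p q)"
  and continuous_mat_one: "continuous_mat S p p (\<lambda>_. 1\<^sub>m p)"
  by (auto intro: continuous_mat_const)

lemma continuous_mat_smult:
  assumes "continuous_on S f" "A \<in> carrier_mat p q"
  shows "continuous_mat S p q (\<lambda>u. f u \<cdot>\<^sub>m A)"
  by (rule continuous_matI[of _ _ _ _ "\<lambda>i j u. f u * A $$ (i, j)"])
    (use assms in \<open>auto intro!: continuous_intros\<close>)

lemma continuous_mat_smult_one: "continuous_on S f \<Longrightarrow> continuous_mat S p p (\<lambda>u. f u \<cdot>\<^sub>m 1\<^sub>m p)"
  by (auto intro: continuous_mat_smult)

lemma continuous_mat_append_rows:
  assumes F: "continuous_mat S p1 q F" and G: "continuous_mat S p2 q G" and p: "p = p1 + p2"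
  shows "continuous_mat S p q (\<lambda>u. F u @\<^sub>r G u)"
proof (rule continuous_matI[of _ _ _ _ "\<lambda>i j u. if i < p1 then F u $$ (i, j) else G u $$ (i - p1, j)"])
  fix i j assume "i < p" "j < q"
  then show "continuous_on S (\<lambda>u. if i < p1 then F u $$ (i, j) else G u $$ (i - p1, j))"
    using continuous_matD(4)[OF F, of i j] continuous_matD(4)[OF G, of "i - p1" j] p by (cases "i < p1") simp_all
qed (use continuous_matD(1-3)[OF F] continuous_matD(1-3)[OF G] p in \<open>auto simp: append_rows_def\<close>)

lemma continuous_mat_append_cols:
  assumes F: "continuous_mat S p q1 F" and G: "continuous_mat S p q2 G" and q: "q = q1 + q2"
  shows "continuous_mat S p q (\<lambda>u. F u @\<^sub>c G u)"
proof (rule continuous_matI[of _ _ _ _ "\<lambda>i j u. if j < q1 then F u $$ (i, j) else G u $$ (i, j - q1)"])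
  fix i j assume "i < p" "j < q"
  then show "continuous_on S (\<lambda>u. if j < q1 then F u $$ (i, j) else G u $$ (i, j - q1))"
    using continuous_matD(4)[OF F, of i j] continuous_matD(4)[OF G, of i "j - q1"] q by (cases "j < q1") simp_all
qed (use continuous_matD(1-3)[OF F] continuous_matD(1-3)[OF G] q in \<open>auto simp: append_cols_def intro!: carrier_matI\<close>)

lemma continuous_mat_mult:
  assumes F: "continuous_mat S p r F" and G: "continuous_mat S r q G"
  shows "continuous_mat S p q (\<lambda>u. F u * G u)"
  by (rule continuous_matI[of _ _ _ _ "\<lambda>i j u. \<Sum>k\<in>{0..<r}. F u $$ (i, k) * G u $$ (k, j)"])
    (use continuous_matD[OF F] continuous_matD[OF G] in
      \<open>auto intro!: continuous_intros mult_carrier_mat[of _ _ r] simp: scalar_prod_def\<close>)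

lemma continuous_mat_add:
  assumes F: "continuous_mat S p q F" and G: "continuous_mat S p q G"
  shows "continuous_mat S p q (\<lambda>u. F u + G u)"
  by (rule continuous_matI[of _ _ _ _ "\<lambda>i j u. F u $$ (i, j) + G u $$ (i, j)"])
    (use continuous_matD[OF F] continuous_matD[OF G] in \<open>auto intro!: continuous_intros\<close>)

lemma continuous_mat_uminus:
  assumes F: "continuous_mat S p q F"
  shows "continuous_mat S p q (\<lambda>u. - F u)"
  by (rule continuous_matI[of _ _ _ _ "\<lambda>i j u. - F u $$ (i, j)"])
    (use continuous_matD[OF F] in \<open>auto intro!: continuous_intros\<close>)

lemmas continuous_mat_intros = continuous_mat_zero continuous_mat_one continuous_mat_smult_one
  continuous_mat_append_rows continuous_mat_append_cols

text \<open>Continuity passes to every section of a kernel, Lebesgue measurability only to almost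
  every one. The kernels \<open>G1\<close>, \<open>G2\<close>, \<open>G4\<close>, \<open>G5\<close>
  are polynomial, so identities for T and R can be proved at each point s.\<close>

lemma continuous_mat_section:
  assumes "continuous_mat ({a..b} \<times> {a..b}) p q (\<lambda>u. N (fst u) (snd u))" "s \<in> {a..b}" "S \<subseteq> {a..b}"
  shows "continuous_mat S p q (N s)"
  unfolding continuous_mat_def
proof (intro conjI allI impI ballI)
  fix i j assume "i < p" "j < q"
  then have "continuous_on ({a..b} \<times> {a..b}) (\<lambda>u. N (fst u) (snd u) $$ (i, j))"
    using assms(1) by (simp add: continuous_mat_def)
  moreover have "continuous_on S (\<lambda>\<theta>. (s, \<theta>))" by (intro continuous_intros)
  moreover have "(\<lambda>\<theta>. (s, \<theta>)) ` S \<subseteq> {a..b} \<times> {a..b}" using assms(2,3) by auto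
  ultimately show "continuous_on S (\<lambda>\<theta>. N s \<theta> $$ (i, j))"
    using continuous_on_compose2[of "{a..b} \<times> {a..b}" "\<lambda>u. N (fst u) (snd u) $$ (i, j)" S "\<lambda>\<theta>. (s, \<theta>)"]
    by simp
qed (use assms continuous_matD(1)[OF assms(1), of "(s, _)"] in auto)

lemma continuous_mat_bounded_measurable:
  fixes F :: "'a::euclidean_space \<Rightarrow> real mat"
  assumes F: "continuous_mat S p q F" and "compact S"
  shows "bounded_measurable_mat S p q F"
  unfolding bounded_measurable_mat_def
proof (intro conjI allI impI ballI)
  have S: "S \<in> sets lebesgue"
    using borel_closed[OF compact_imp_closed[OF \<open>compact S\<close>]] by (simp add: sets_completionI_sets)
  show "(\<lambda>u. F u $$ (i, j)) \<in> borel_measurable (lebesgue_on S)" if "i < p" "j < q" for i j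
    by (rule continuous_imp_measurable_on_sets_lebesgue[OF continuous_matD(4)[OF F that] S])
  have "\<exists>C. \<forall>u\<in>S. \<bar>F u $$ (i, j)\<bar> \<le> C" if "i < p" "j < q" for i j
  proof -
    have "bounded ((\<lambda>u. F u $$ (i, j)) ` S)"
      by (intro compact_imp_bounded compact_continuous_image continuous_matD(4)[OF F that] \<open>compact S\<close>)
    then show ?thesis by (auto simp: bounded_iff)
  qed
  then obtain C where C: "\<And>i j u. i < p \<Longrightarrow> j < q \<Longrightarrow> u \<in> S \<Longrightarrow> \<bar>F u $$ (i, j)\<bar> \<le> C i j"
    by metis
  show "\<exists>C. \<forall>u\<in>S. \<forall>i<p. \<forall>j<q. \<bar>F u $$ (i, j)\<bar> \<le> C"
  proof (intro exI ballI allI impI)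
    fix u i j assume u: "u \<in> S" and ij: "i < p" "j < q"
    have "\<bar>F u $$ (i, j)\<bar> \<le> \<bar>C i j\<bar>" using C[OF ij u] by linarith
    also have "\<dots> \<le> (\<Sum>j<q. \<bar>C i j\<bar>)"
      using ij by (intro member_le_sum) auto
    also have "\<dots> \<le> (\<Sum>i<p. \<Sum>j<q. \<bar>C i j\<bar>)"
      using ij member_le_sum[of i "{..<p}" "\<lambda>i. \<Sum>j<q. \<bar>C i j\<bar>"] by (auto intro: sum_nonneg)
    finally show "\<bar>F u $$ (i, j)\<bar> \<le> (\<Sum>i<p. \<Sum>j<q. \<bar>C i j\<bar>)" .
  qed
qed (use continuous_matD(1)[OF F] in auto)

section \<open>Integrals of vector functions\<close>

definition vec_integrable :: "nat \<Rightarrow> real set \<Rightarrow> vfun \<Rightarrow> bool" where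
  "vec_integrable m S f \<longleftrightarrow> (\<forall>\<theta>\<in>S. dim_vec (f \<theta>) = m) \<and>
     (\<forall>i<m. integrable (lebesgue_on S) (\<lambda>\<theta>. f \<theta> $ i))"

lemma L2_vec_integrable:
  assumes "f \<in> L2_space a b m" "{c..d} \<subseteq> {a..b}"
  shows "vec_integrable m {c..d} f"
  unfolding vec_integrable_def
  using integrable_lebesgue_on_subinterval[OF L2_comp_integrable[OF assms(1)] assms(2)]
    L2_spaceD(2)[OF assms(1)] assms(2) by blast

lemma dim_vec_integral [simp]: "dim_vec (vec_integral p S f) = p"
  by (simp add: vec_integral_def)

lemma vec_integral_carrier [simp]: "vec_integral p S f \<in> carrier_vec p"
  by (simp add: vec_integral_def)

lemma vec_integrable_mult_continuous:
  assumes F: "continuous_mat {c..d} p q F" and f: "vec_integrable q {c..d} f"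
  shows "vec_integrable p {c..d} (\<lambda>\<theta>. F \<theta> *\<^sub>v f \<theta>)"
  unfolding vec_integrable_def
proof (intro conjI ballI allI impI)
  fix i assume i: "i < p"
  have "integrable (Leb c d) (\<lambda>\<theta>. \<Sum>j\<in>{0..<q}. f \<theta> $ j * F \<theta> $$ (i, j))"
    using f i by (intro Bochner_Integration.integrable_sum integrable_mult_continuous continuous_matD(4)[OF F])
      (auto simp: vec_integrable_def)
  then show "integrable (Leb c d) (\<lambda>\<theta>. (F \<theta> *\<^sub>v f \<theta>) $ i)"
    by (rule Bochner_Integration.integrable_cong[THEN iffD1, rotated -1])
      (use f i continuous_matD(2,3)[OF F] in \<open>auto simp: scalar_prod_def vec_integrable_def mult.commute\<close>)
qed (use continuous_matD(2)[OF F] in auto)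

lemma vec_integral_cong:
  assumes "\<And>\<theta>. \<theta> \<in> S \<Longrightarrow> f \<theta> = g \<theta>"
  shows "vec_integral p S f = vec_integral p S g"
  unfolding vec_integral_def
  by (intro arg_cong[of _ _ "Matrix.vec p"] ext Bochner_Integration.integral_cong) (auto simp: assms)

lemma vec_integral_mult:
  assumes A: "A \<in> carrier_mat p q" and f: "vec_integrable q S f"
  shows "vec_integral p S (\<lambda>\<theta>. A *\<^sub>v f \<theta>) = A *\<^sub>v vec_integral q S f"
proof (rule eq_vecI)
  fix i assume "i < dim_vec (A *\<^sub>v vec_integral q S f)"
  then have i: "i < p" using A by simp
  have "(LINT \<theta>|lebesgue_on S. (A *\<^sub>v f \<theta>) $ i) = (LINT \<theta>|lebesgue_on S. (\<Sum>j\<in>{0..<q}. A $$ (i, j) * f \<theta> $ j))"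
    by (intro Bochner_Integration.integral_cong)
      (use A i f in \<open>auto simp: scalar_prod_def vec_integrable_def\<close>)
  also have "\<dots> = (\<Sum>j\<in>{0..<q}. A $$ (i, j) * (LINT \<theta>|lebesgue_on S. f \<theta> $ j))"
    using f by (subst Bochner_Integration.integral_sum) (auto simp: vec_integrable_def)
  finally show "vec_integral p S (\<lambda>\<theta>. A *\<^sub>v f \<theta>) $ i = (A *\<^sub>v vec_integral q S f) $ i"
    using A i by (simp add: vec_integral_def scalar_prod_def)
qed (use A in simp)

lemma vec_integral_add:
  assumes f: "vec_integrable p S f" and g: "vec_integrable p S g"
  shows "vec_integral p S (\<lambda>\<theta>. f \<theta> + g \<theta>) = vec_integral p S f + vec_integral p S g"
proof (rule eq_vecI)
  fix i assume "i < dim_vec (vec_integral p S f + vec_integral p S g)"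
  then have i: "i < p" by simp
  have "(LINT \<theta>|lebesgue_on S. (f \<theta> + g \<theta>) $ i) = (LINT \<theta>|lebesgue_on S. f \<theta> $ i + g \<theta> $ i)"
    by (intro Bochner_Integration.integral_cong) (use g i in \<open>auto simp: vec_integrable_def\<close>)
  also have "\<dots> = (LINT \<theta>|lebesgue_on S. f \<theta> $ i) + (LINT \<theta>|lebesgue_on S. g \<theta> $ i)"
    using f g i by (intro Bochner_Integration.integral_add) (auto simp: vec_integrable_def)
  finally show "vec_integral p S (\<lambda>\<theta>. f \<theta> + g \<theta>) $ i = (vec_integral p S f + vec_integral p S g) $ i"
    using i by (simp add: vec_integral_def)
qed simp

lemma vec_integral_append:
  assumes "\<And>\<theta>. \<theta> \<in> S \<Longrightarrow> dim_vec (f \<theta>) = p" "\<And>\<theta>. \<theta> \<in> S \<Longrightarrow> dim_vec (g \<theta>) = q"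
  shows "vec_integral (p + q) S (\<lambda>\<theta>. f \<theta> @\<^sub>v g \<theta>) = vec_integral p S f @\<^sub>v vec_integral q S g"
proof (rule eq_vecI)
  fix i assume "i < dim_vec (vec_integral p S f @\<^sub>v vec_integral q S g)"
  then have i: "i < p + q" by simp
  have "(LINT \<theta>|lebesgue_on S. (f \<theta> @\<^sub>v g \<theta>) $ i) = (LINT \<theta>|lebesgue_on S. (if i < p then f \<theta> $ i else g \<theta> $ (i - p)))"
    by (intro Bochner_Integration.integral_cong) (use assms i in auto)
  then show "vec_integral (p + q) S (\<lambda>\<theta>. f \<theta> @\<^sub>v g \<theta>) $ i = (vec_integral p S f @\<^sub>v vec_integral q S g) $ i"
    using i by (auto simp: vec_integral_def)
qed simp

lemma vec_integral_zero [simp]: "vec_integral p S (\<lambda>_. 0\<^sub>v p) = 0\<^sub>v p"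
  by (auto simp: vec_integral_def intro!: eq_vecI)

lemma vec_integral_split:
  assumes f: "vec_integrable p {a..b} f" and s: "s \<in> {a..b}"
  shows "vec_integral p {a..s} f + vec_integral p {s..b} f = vec_integral p {a..b} f"
proof (rule eq_vecI)
  fix i assume "i < dim_vec (vec_integral p {a..b} f)"
  then have i: "i < p" by simp
  let ?f = "\<lambda>\<theta>. f \<theta> $ i"
  have int: "integrable (Leb a b) ?f"
    using f i by (simp add: vec_integrable_def)
  have *: "(LINT \<theta>|Leb c d. ?f \<theta>) = integral {c..d} ?f" if "{c..d} \<subseteq> {a..b}" for c d
    by (intro lebesgue_integral_eq_integral integrable_lebesgue_on_subinterval[OF int that]) auto
  have "integral {a..s} ?f + integral {s..b} ?f = integral {a..b} ?f"
    using int s by (intro Henstock_Kurzweil_Integration.integral_combine) (auto simp: integrable_on_lebesgue_on)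
  then show "(vec_integral p {a..s} f + vec_integral p {s..b} f) $ i = vec_integral p {a..b} f $ i"
    using i s *[of a s] *[of s b] *[of a b] by (simp add: vec_integral_def)
qed simp

lemma vec_integral_smult:
  "vec_integral p S (\<lambda>\<theta>. c \<theta> \<cdot>\<^sub>v f \<theta>) = Matrix.vec p (\<lambda>i. LINT \<theta>|lebesgue_on S. c \<theta> * f \<theta> $ i)"
  if "\<And>\<theta>. \<theta> \<in> S \<Longrightarrow> dim_vec (f \<theta>) = p"
proof (rule eq_vecI)
  fix i assume "i < dim_vec (Matrix.vec p (\<lambda>i. LINT \<theta>|lebesgue_on S. c \<theta> * f \<theta> $ i))"
  then have i: "i < p" by simp
  have "(LINT \<theta>|lebesgue_on S. (c \<theta> \<cdot>\<^sub>v f \<theta>) $ i) = (LINT \<theta>|lebesgue_on S. c \<theta> * f \<theta> $ i)"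
    by (intro Bochner_Integration.integral_cong) (use that i in auto)
  with i show "vec_integral p S (\<lambda>\<theta>. c \<theta> \<cdot>\<^sub>v f \<theta>) $ i = Matrix.vec p (\<lambda>i. LINT \<theta>|lebesgue_on S. c \<theta> * f \<theta> $ i) $ i"
    by (simp add: vec_integral_def)
qed simp

lemma vec_integral_vec_integral:
  assumes h: "h \<in> L2_space a b m" and s: "s \<in> {a..b}"
  shows "vec_integral m {a..s} (\<lambda>r. vec_integral m {a..r} h) = vec_integral m {a..s} (\<lambda>\<theta>. (s - \<theta>) \<cdot>\<^sub>v h \<theta>)"
proof -
  have sub: "{a..s} \<subseteq> {a..b}" using s by auto
  have "vec_integral m {a..s} (\<lambda>\<theta>. (s - \<theta>) \<cdot>\<^sub>v h \<theta>) = Matrix.vec m (\<lambda>i. LINT \<theta>|Leb a s. (s - \<theta>) * h \<theta> $ i)"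
    by (rule vec_integral_smult) (use sub L2_spaceD(2)[OF h] in auto)
  also have "\<dots> = vec_integral m {a..s} (\<lambda>r. vec_integral m {a..r} h)"
  proof (rule eq_vecI)
    fix i assume "i < dim_vec (vec_integral m {a..s} (\<lambda>r. vec_integral m {a..r} h))"
    then have i: "i < m" by simp
    have "integrable (Leb a s) (\<lambda>\<theta>. h \<theta> $ i)"
      by (rule integrable_lebesgue_on_subinterval[OF L2_comp_integrable[OF h i] sub])
    from primitive_of_primitive[OF this] i
    show "Matrix.vec m (\<lambda>i. LINT \<theta>|Leb a s. (s - \<theta>) * h \<theta> $ i) $ i
        = vec_integral m {a..s} (\<lambda>r. vec_integral m {a..r} h) $ i"
      by (simp add: vec_integral_def)
  qed simp
  finally show ?thesis by simp
qed

text \<open>\<open>mat_inv\<close> is meaningful only where \<open>mat_inverse\<close> succeeds; an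
  invertible matrix is a unit of the matrix ring, which guarantees this.\<close>

lemma mat_inverse_of_invertible:
  fixes A :: "real mat"
  assumes A: "A \<in> carrier_mat k k" and inv: "invertible_mat A"
  shows "mat_inv A \<in> carrier_mat k k" "mat_inv A * A = 1\<^sub>m k"
proof -
  from inv obtain C where C: "A * C = 1\<^sub>m (dim_row A)" "C * A = 1\<^sub>m (dim_row C)"
    by (auto simp: invertible_mat_def inverts_mat_def)
  from arg_cong[OF C(1), of dim_col] arg_cong[OF C(2), of dim_col] A
  have Cc: "C \<in> carrier_mat k k" by auto
  have "A \<in> Units (ring_mat TYPE(real) k ())"
    unfolding Units_def using A Cc C by (auto simp: ring_mat_def)
  with mat_inverse(1)[OF A, of "()"] obtain D where "mat_inverse A = Some D"
    by (cases "mat_inverse A") auto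
  with mat_inverse(2)[OF A this]
  show "mat_inv A \<in> carrier_mat k k" "mat_inv A * A = 1\<^sub>m k" by auto
qed

lemma L2_bounded_op_cong:
  assumes Q: "L2_bounded_op a b m n Q"
    and eq: "\<And>x s. x \<in> L2_space a b m \<Longrightarrow> s \<in> {a..b} \<Longrightarrow> S x s = Q x s"
  shows "L2_bounded_op a b m n S"
proof -
  have inner: "L2_inner a b (S x) y = L2_inner a b (Q x) y" "L2_norm a b (S x) = L2_norm a b (Q x)"
    if "x \<in> L2_space a b m" for x y
    unfolding L2_norm_def L2_inner_def
    using eq[OF that] by (auto intro!: arg_cong[of _ _ sqrt] Bochner_Integration.integral_cong)
  moreover have "S x \<in> L2_space a b n \<longleftrightarrow> Q x \<in> L2_space a b n" if "x \<in> L2_space a b m" for x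
    by (rule L2_space_cong[OF eq[OF that]])
  ultimately show ?thesis
    using Q by (simp add: L2_bounded_op_def cong: ball_cong)
qed

section \<open>Boundedness of the operators T, R and A\<close>

locale boundary_conditions =
  fixes a b :: real and n0 n1 n2 :: nat and B :: "real mat"
  assumes ab: "a < b"
    and B: "B \<in> carrier_mat (n1 + 2 * n2) (2 * n1 + 4 * n2)"
    and inv: "invertible_mat (B * T_mat a b n1 n2)"
begin

abbreviation "n \<equiv> n0 + n1 + n2"
abbreviation "square \<equiv> {a..b} \<times> {a..b}"

lemma T_mat_carrier: "T_mat a b n1 n2 \<in> carrier_mat (2 * n1 + 4 * n2) (n1 + 2 * n2)"
  by (intro carrier_matI) (simp_all add: T_mat_def)

lemma inv_carrier: "mat_inv (B * T_mat a b n1 n2) \<in> carrier_mat (n1 + 2 * n2) (n1 + 2 * n2)"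
  and inv_mult: "mat_inv (B * T_mat a b n1 n2) * (B * T_mat a b n1 n2) = 1\<^sub>m (n1 + 2 * n2)"
  using mat_inverse_of_invertible[OF mult_carrier_mat[OF B T_mat_carrier] inv] by auto

lemma continuous_G:
  "continuous_mat S n n (G0 n0 n1 n2)"
  "continuous_mat square n n (\<lambda>u. G1 a b n0 n1 n2 B (fst u) (snd u))"
  "continuous_mat square n n (\<lambda>u. G2 a b n0 n1 n2 B (fst u) (snd u))"
  "continuous_mat S (n1 + n2) n (G3 n0 n1 n2)"
  "continuous_mat square (n1 + n2) n (\<lambda>u. G4 a b n0 n1 n2 B (fst u) (snd u))"
  "continuous_mat square (n1 + n2) n (\<lambda>u. G5 a b n0 n1 n2 B (fst u) (snd u))"
proof -
  show "continuous_mat S n n (G0 n0 n1 n2)"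
    unfolding G0_def[abs_def] by (rule continuous_mat_intros | intro continuous_intros | simp)+
  show "continuous_mat S (n1 + n2) n (G3 n0 n1 n2)"
    unfolding G3_def[abs_def] by (rule continuous_mat_intros | intro continuous_intros | simp)+
  have K: "continuous_mat square n (n1 + 2 * n2) (\<lambda>u. K_mat a n0 n1 n2 (fst u))"
    unfolding K_mat_def by (rule continuous_mat_intros | intro continuous_intros | simp)+
  have Q: "continuous_mat square (2 * n1 + 4 * n2) n (\<lambda>u. Q_mat b n0 n1 n2 (fst u) (snd u))"
    unfolding Q_mat_def by (rule continuous_mat_intros | intro continuous_intros | simp)+
  have V: "continuous_mat square (n1 + n2) (n1 + 2 * n2) (\<lambda>u. V_mat n1 n2)"
    unfolding V_mat_def by (rule continuous_mat_intros | intro continuous_intros | simp)+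
  have D: "continuous_mat square n n (\<lambda>u. 0\<^sub>m n0 n0 @\<^sub>c 0\<^sub>m n0 n1 @\<^sub>c 0\<^sub>m n0 n2
      @\<^sub>r 0\<^sub>m n1 n0 @\<^sub>c 1\<^sub>m n1    @\<^sub>c 0\<^sub>m n1 n2
      @\<^sub>r 0\<^sub>m n2 n0 @\<^sub>c 0\<^sub>m n2 n1 @\<^sub>c ((fst u - snd u) \<cdot>\<^sub>m 1\<^sub>m n2))"
    by (rule continuous_mat_intros | intro continuous_intros | simp)+
  have D': "continuous_mat square (n1 + n2) n (\<lambda>u. 0\<^sub>m n1 n0 @\<^sub>c 0\<^sub>m n1 n1 @\<^sub>c 0\<^sub>m n1 n2
      @\<^sub>r 0\<^sub>m n2 n0 @\<^sub>c 0\<^sub>m n2 n1 @\<^sub>c 1\<^sub>m n2)"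
    by (rule continuous_mat_intros | intro continuous_intros | simp)+
  note W = continuous_mat_mult[OF continuous_mat_mult[OF continuous_mat_mult[OF _ continuous_mat_const[OF inv_carrier]]
    continuous_mat_const[OF B]] Q]
  show G2: "continuous_mat square n n (\<lambda>u. G2 a b n0 n1 n2 B (fst u) (snd u))"
    unfolding G2_def by (rule continuous_mat_uminus[OF W[OF K]])
  show G5: "continuous_mat square (n1 + n2) n (\<lambda>u. G5 a b n0 n1 n2 B (fst u) (snd u))"
    unfolding G5_def by (rule continuous_mat_uminus[OF W[OF V]])
  show "continuous_mat square n n (\<lambda>u. G1 a b n0 n1 n2 B (fst u) (snd u))"
    unfolding G1_def by (rule continuous_mat_add[OF D G2])
  show "continuous_mat square (n1 + n2) n (\<lambda>u. G4 a b n0 n1 n2 B (fst u) (snd u))"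
    unfolding G4_def by (rule continuous_mat_add[OF D' G5])
qed

text \<open>The operator that recovers the first derivatives of x1 and x2 from \<open>hat x\<close>.
  It is to \<open>G3\<close>, \<open>G4\<close>, \<open>G5\<close> what T is to \<open>G0\<close>,
  \<open>G1\<close>, \<open>G2\<close>.\<close>

definition R_op :: vop where
  "R_op = PI_op a b (n1 + n2) (G3 n0 n1 n2) (G4 a b n0 n1 n2 B) (G5 a b n0 n1 n2 B)"

lemma bounded_T_op: "L2_bounded_op a b n n (T_op a b n0 n1 n2 B)"
  and bounded_R_op: "L2_bounded_op a b n (n1 + n2) R_op"
proof -
  have sq: "compact square" by (intro compact_Times) auto
  have "bounded_measurable_mat square n n (\<lambda>(s, \<theta>). G1 a b n0 n1 n2 B s \<theta>)"
    "bounded_measurable_mat square n n (\<lambda>(s, \<theta>). G2 a b n0 n1 n2 B s \<theta>)"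
    "bounded_measurable_mat square (n1 + n2) n (\<lambda>(s, \<theta>). G4 a b n0 n1 n2 B s \<theta>)"
    "bounded_measurable_mat square (n1 + n2) n (\<lambda>(s, \<theta>). G5 a b n0 n1 n2 B s \<theta>)"
    unfolding case_prod_beta' by (intro continuous_mat_bounded_measurable[OF _ sq] continuous_G)+
  moreover have "bounded_measurable_mat {a..b} n n (G0 n0 n1 n2)" "bounded_measurable_mat {a..b} (n1 + n2) n (G3 n0 n1 n2)"
    by (intro continuous_mat_bounded_measurable continuous_G compact_Icc)+
  ultimately show "L2_bounded_op a b n n (T_op a b n0 n1 n2 B)" "L2_bounded_op a b n (n1 + n2) R_op"
    unfolding T_op_def R_op_def using ab by (auto intro!: L2_bounded_op_PI less_imp_le)
qed

lemma G_section:
  assumes "s \<in> {a..b}" "S \<subseteq> {a..b}"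
  shows "continuous_mat S n n (G1 a b n0 n1 n2 B s)" "continuous_mat S n n (G2 a b n0 n1 n2 B s)"
    "continuous_mat S (n1 + n2) n (G4 a b n0 n1 n2 B s)" "continuous_mat S (n1 + n2) n (G5 a b n0 n1 n2 B s)"
  using continuous_mat_section[OF _ assms] continuous_G by blast+

text \<open>For fixed s the matrices \<open>A0 s\<close> and \<open>A1 s\<close> are constant in the
  integration variable and can be pulled out of the integrals. The kernel sections are continuous,
  so all integrals exist and the identity holds at each s.\<close>

lemma A_op_eq:
  assumes A0: "\<And>s. s \<in> {a..b} \<Longrightarrow> A0 s \<in> carrier_mat n n"
    and A1: "\<And>s. s \<in> {a..b} \<Longrightarrow> A1 s \<in> carrier_mat n (n1 + n2)"
    and A2: "\<And>s. s \<in> {a..b} \<Longrightarrow> A2 s \<in> carrier_mat n n2"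
    and y: "y \<in> L2_space a b n" and s: "s \<in> {a..b}"
  shows "A_op a b n0 n1 n2 B A0 A1 A2 y s =
    A0 s *\<^sub>v T_op a b n0 n1 n2 B y s + A1 s *\<^sub>v R_op y s
      + (0\<^sub>m n n0 @\<^sub>c 0\<^sub>m n n1 @\<^sub>c A2 s) *\<^sub>v y s"
proof -
  note A0 = A0[OF s] and A1 = A1[OF s] and A2 = A2[OF s]
  have ys: "y \<theta> \<in> carrier_vec n" if "\<theta> \<in> {a..b}" for \<theta> using L2_spaceD(1)[OF y that] .
  have sub: "{a..s} \<subseteq> {a..b}" "{s..b} \<subseteq> {a..b}" using s by auto
  have key: "vec_integral n S (\<lambda>\<theta>. (A0 s * F \<theta> + A1 s * G \<theta>) *\<^sub>v y \<theta>)
      = A0 s *\<^sub>v vec_integral n S (\<lambda>\<theta>. F \<theta> *\<^sub>v y \<theta>) + A1 s *\<^sub>v vec_integral (n1 + n2) S (\<lambda>\<theta>. G \<theta> *\<^sub>v y \<theta>)"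
    if S: "S = {c..d}" "S \<subseteq> {a..b}" and F: "continuous_mat S n n F" and G: "continuous_mat S (n1 + n2) n G" for S c d F G
  proof -
    have iF: "vec_integrable n S (\<lambda>\<theta>. F \<theta> *\<^sub>v y \<theta>)" and iG: "vec_integrable (n1 + n2) S (\<lambda>\<theta>. G \<theta> *\<^sub>v y \<theta>)"
      using vec_integrable_mult_continuous L2_vec_integrable[OF y] F G S by auto
    have iA: "vec_integrable n S (\<lambda>\<theta>. A0 s *\<^sub>v (F \<theta> *\<^sub>v y \<theta>))" "vec_integrable n S (\<lambda>\<theta>. A1 s *\<^sub>v (G \<theta> *\<^sub>v y \<theta>))"
      using vec_integrable_mult_continuous[OF continuous_mat_const[OF A0]] iF
        vec_integrable_mult_continuous[OF continuous_mat_const[OF A1]] iG S by auto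
    have "vec_integral n S (\<lambda>\<theta>. (A0 s * F \<theta> + A1 s * G \<theta>) *\<^sub>v y \<theta>)
        = vec_integral n S (\<lambda>\<theta>. A0 s *\<^sub>v (F \<theta> *\<^sub>v y \<theta>) + A1 s *\<^sub>v (G \<theta> *\<^sub>v y \<theta>))"
    proof (rule vec_integral_cong)
      fix \<theta> assume \<theta>: "\<theta> \<in> S"
      then have y: "y \<theta> \<in> carrier_vec n" using ys S(2) by blast
      note F = continuous_matD(1)[OF F \<theta>] and G = continuous_matD(1)[OF G \<theta>]
      show "(A0 s * F \<theta> + A1 s * G \<theta>) *\<^sub>v y \<theta> = A0 s *\<^sub>v (F \<theta> *\<^sub>v y \<theta>) + A1 s *\<^sub>v (G \<theta> *\<^sub>v y \<theta>)"
        by (simp add: add_mult_distrib_mat_vec[OF mult_carrier_mat[OF A0 F] mult_carrier_mat[OF A1 G] y]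
          assoc_mult_mat_vec[OF A0 F y] assoc_mult_mat_vec[OF A1 G y])
    qed
    also have "\<dots> = A0 s *\<^sub>v vec_integral n S (\<lambda>\<theta>. F \<theta> *\<^sub>v y \<theta>) + A1 s *\<^sub>v vec_integral (n1 + n2) S (\<lambda>\<theta>. G \<theta> *\<^sub>v y \<theta>)"
      by (simp add: vec_integral_add[OF iA] vec_integral_mult[OF A0 iF] vec_integral_mult[OF A1 iG])
    finally show ?thesis .
  qed
  have Z: "0\<^sub>m n n0 @\<^sub>c 0\<^sub>m n n1 @\<^sub>c A2 s \<in> carrier_mat n n"
    using A2 by (intro carrier_matI) auto
  note G03 = continuous_matD(1)[OF continuous_G(1) s] continuous_matD(1)[OF continuous_G(4) s]
  have H0: "H0 n0 n1 n2 A0 A1 A2 s *\<^sub>v y s = A0 s *\<^sub>v (G0 n0 n1 n2 s *\<^sub>v y s) + A1 s *\<^sub>v (G3 n0 n1 n2 s *\<^sub>v y s)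
      + (0\<^sub>m n n0 @\<^sub>c 0\<^sub>m n n1 @\<^sub>c A2 s) *\<^sub>v y s"
    unfolding H0_def
    using mult_carrier_mat[OF A0 G03(1)] mult_carrier_mat[OF A1 G03(2)] ys[OF s] Z
      mult_mat_vec_carrier[OF A0 mult_mat_vec_carrier[OF G03(1) ys[OF s]]]
      mult_mat_vec_carrier[OF A1 mult_mat_vec_carrier[OF G03(2) ys[OF s]]]
      mult_mat_vec_carrier[OF Z ys[OF s]]
    by (simp add: add_mult_distrib_mat_vec[of _ n n] assoc_mult_mat_vec[OF A0 G03(1) ys[OF s]]
      assoc_mult_mat_vec[OF A1 G03(2) ys[OF s]])
  let ?n = "\<lambda>S F. vec_integral n S (\<lambda>\<theta>. F s \<theta> *\<^sub>v y \<theta>)" and ?m = "\<lambda>S F. vec_integral (n1 + n2) S (\<lambda>\<theta>. F s \<theta> *\<^sub>v y \<theta>)"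
  have H1: "?n {a..s} (H1 a b n0 n1 n2 B A0 A1) = A0 s *\<^sub>v ?n {a..s} (G1 a b n0 n1 n2 B) + A1 s *\<^sub>v ?m {a..s} (G4 a b n0 n1 n2 B)"
    unfolding H1_def by (rule key[OF refl sub(1) G_section(1,3)[OF s sub(1)]])
  have H2: "?n {s..b} (H2 a b n0 n1 n2 B A0 A1) = A0 s *\<^sub>v ?n {s..b} (G2 a b n0 n1 n2 B) + A1 s *\<^sub>v ?m {s..b} (G5 a b n0 n1 n2 B)"
    unfolding H2_def by (rule key[OF refl sub(2) G_section(2,4)[OF s sub(2)]])
  have c: "G0 n0 n1 n2 s *\<^sub>v y s \<in> carrier_vec n" "G3 n0 n1 n2 s *\<^sub>v y s \<in> carrier_vec (n1 + n2)"
    using mult_mat_vec_carrier[OF G03(1) ys[OF s]] mult_mat_vec_carrier[OF G03(2) ys[OF s]] .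
  have d: "A0 s *\<^sub>v (u + v + w) = A0 s *\<^sub>v u + A0 s *\<^sub>v v + A0 s *\<^sub>v w"
    if "u \<in> carrier_vec n" "v \<in> carrier_vec n" "w \<in> carrier_vec n" for u v w
    using that mult_mat_vec_carrier[OF A0] by (simp add: mult_add_distrib_mat_vec[OF A0] assoc_add_vec[of _ n])
  have e: "A1 s *\<^sub>v (u + v + w) = A1 s *\<^sub>v u + A1 s *\<^sub>v v + A1 s *\<^sub>v w"
    if "u \<in> carrier_vec (n1 + n2)" "v \<in> carrier_vec (n1 + n2)" "w \<in> carrier_vec (n1 + n2)" for u v w
    using that mult_mat_vec_carrier[OF A1] by (simp add: mult_add_distrib_mat_vec[OF A1] assoc_add_vec[of _ n])
  show ?thesis
    unfolding A_op_def T_op_def R_op_def PI_op_def H0 H1 H2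
    unfolding d[OF c(1) vec_integral_carrier vec_integral_carrier] e[OF c(2) vec_integral_carrier vec_integral_carrier]
    by (rule eq_vecI) (use A0 A1 Z in auto)
qed

text \<open>The factorisation in \<open>A_op_eq\<close> presents the operator as a sum of
  compositions. The measurable coefficients enter through multiplication operators, the kernels
  through T and R.\<close>

lemma bounded_A_op:
  assumes A0: "bounded_measurable_mat {a..b} n n A0"
    and A1: "bounded_measurable_mat {a..b} n (n1 + n2) A1"
    and A2: "bounded_measurable_mat {a..b} n n2 A2"
  shows "L2_bounded_op a b n n (A_op a b n0 n1 n2 B A0 A1 A2)"
proof -
  have "bounded_measurable_mat {a..b} n n (\<lambda>s. 0\<^sub>m n n0 @\<^sub>c 0\<^sub>m n n1 @\<^sub>c A2 s)"
    unfolding bounded_measurable_mat_def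
  proof (intro conjI allI impI ballI)
    have A2c: "A2 s \<in> carrier_mat n n2" if "s \<in> {a..b}" for s
      using A2 that by (auto simp: bounded_measurable_mat_def)
    show "0\<^sub>m n n0 @\<^sub>c 0\<^sub>m n n1 @\<^sub>c A2 s \<in> carrier_mat n n" if "s \<in> {a..b}" for s
      using A2c[OF that] by (intro carrier_matI) auto
    have e: "(0\<^sub>m n n0 @\<^sub>c 0\<^sub>m n n1 @\<^sub>c A2 s) $$ (i, j) = (if j < n0 + n1 then 0 else A2 s $$ (i, j - (n0 + n1)))"
      if "s \<in> {a..b}" "i < n" "j < n" for s i j
      using A2c[OF that(1)] that(2,3) by (auto simp: append_cols_def)
    show "(\<lambda>s. (0\<^sub>m n n0 @\<^sub>c 0\<^sub>m n n1 @\<^sub>c A2 s) $$ (i, j)) \<in> borel_measurable (Leb a b)"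
      if ij: "i < n" "j < n" for i j
    proof -
      have "(\<lambda>s. if j < n0 + n1 then 0 else A2 s $$ (i, j - (n0 + n1))) \<in> borel_measurable (Leb a b)"
        using A2 ij by (cases "j < n0 + n1") (auto simp: bounded_measurable_mat_def)
      then show ?thesis
        by (rule measurable_cong[THEN iffD1, rotated]) (simp add: e ij)
    qed
    from A2 obtain C where C: "\<forall>s\<in>{a..b}. \<forall>i<n. \<forall>j<n2. \<bar>A2 s $$ (i, j)\<bar> \<le> C"
      by (auto simp: bounded_measurable_mat_def)
    have "\<bar>(0\<^sub>m n n0 @\<^sub>c 0\<^sub>m n n1 @\<^sub>c A2 s) $$ (i, j)\<bar> \<le> \<bar>C\<bar>" if s: "s \<in> {a..b}" and ij: "i < n" "j < n" for s i j
    proof (cases "j < n0 + n1")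
      case False
      then have "j - (n0 + n1) < n2" using ij by linarith
      from C[rule_format, OF s ij(1) this] False show ?thesis by (simp add: e[OF s ij])
    qed (simp add: e[OF s ij])
    then show "\<exists>C. \<forall>s\<in>{a..b}. \<forall>i<n. \<forall>j<n. \<bar>(0\<^sub>m n n0 @\<^sub>c 0\<^sub>m n n1 @\<^sub>c A2 s) $$ (i, j)\<bar> \<le> C"
      by blast
  qed
  then have "L2_bounded_op a b n n (\<lambda>y s. A0 s *\<^sub>v T_op a b n0 n1 n2 B y s + A1 s *\<^sub>v R_op y s
      + (0\<^sub>m n n0 @\<^sub>c 0\<^sub>m n n1 @\<^sub>c A2 s) *\<^sub>v y s)"
    by (intro L2_bounded_op_add L2_bounded_op_mult
      L2_bounded_op_comp[OF bounded_T_op L2_bounded_op_mult[OF A0]]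
      L2_bounded_op_comp[OF bounded_R_op L2_bounded_op_mult[OF A1]])
  then show ?thesis
    by (rule L2_bounded_op_cong)
      (subst A_op_eq, use A0 A1 A2 in \<open>auto simp: bounded_measurable_mat_def\<close>)
qed

end

section \<open>The map from highest derivatives to \<open>X\<close>\<close>

text \<open>The simplifier would rewrite the derivative order in \<open>wderiv a b m 1\<close> to \<open>Suc 0\<close>.\<close>

declare One_nat_def [simp del]

section \<open>Stacked functions, linear combinations and Taylor's formula\<close>

lemma L2_space_append:
  assumes f: "f \<in> L2_space a b p" and g: "g \<in> L2_space a b q"
  shows "(\<lambda>s. f s @\<^sub>v g s) \<in> L2_space a b (p + q)"
  unfolding L2_space_iff
proof (intro conjI ballI allI impI)
  fix i assume i: "i < p + q"
  have "(\<lambda>s. if i < p then f s $ i else g s $ (i - p)) \<in> square_integrable a b"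
    using L2_spaceD(3)[OF f, of i] L2_spaceD(3)[OF g, of "i - p"] i by (cases "i < p") simp_all
  then show "(\<lambda>s. (f s @\<^sub>v g s) $ i) \<in> square_integrable a b"
    by (rule square_integrable_cong[THEN iffD1, rotated])
      (use L2_spaceD(2)[OF f] L2_spaceD(2)[OF g] i in auto)
qed (use L2_spaceD(1)[OF f] L2_spaceD(1)[OF g] in auto)

lemma L2_inner_append:
  assumes f: "f \<in> L2_space a b p" "f' \<in> L2_space a b p" and g: "g \<in> L2_space a b q" "g' \<in> L2_space a b q"
  shows "L2_inner a b (\<lambda>s. f s @\<^sub>v g s) (\<lambda>s. f' s @\<^sub>v g' s) = L2_inner a b f f' + L2_inner a b g g'"
proof -
  have int: "integrable (Leb a b) (\<lambda>s. u s \<bullet> v s)"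
    if "u \<in> L2_space a b m" "v \<in> L2_space a b m" for u v m
  proof -
    have "integrable (Leb a b) (\<lambda>s. \<Sum>i\<in>{0..<m}. u s $ i * v s $ i)"
      by (intro Bochner_Integration.integrable_sum square_integrable_mult) (use that in \<open>auto intro: L2_spaceD\<close>)
    then show ?thesis
      by (rule Bochner_Integration.integrable_cong[THEN iffD1, rotated -1])
        (use L2_spaceD(2)[OF that(2)] in \<open>auto simp: scalar_prod_def\<close>)
  qed
  have "L2_inner a b (\<lambda>s. f s @\<^sub>v g s) (\<lambda>s. f' s @\<^sub>v g' s)
      = (LINT s|Leb a b. f s \<bullet> f' s + g s \<bullet> g' s)"
    unfolding L2_inner_def
  proof (intro Bochner_Integration.integral_cong refl)
    fix s assume "s \<in> space (Leb a b)"
    then have s: "s \<in> {a..b}" by simp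
    show "(f s @\<^sub>v g s) \<bullet> (f' s @\<^sub>v g' s) = f s \<bullet> f' s + g s \<bullet> g' s"
      by (rule scalar_prod_append) (use s f g L2_spaceD(1) in blast)+
  qed
  also have "\<dots> = L2_inner a b f f' + L2_inner a b g g'"
    unfolding L2_inner_def by (rule Bochner_Integration.integral_add[OF int[OF f] int[OF g]])
  finally show ?thesis .
qed

lemma sobolevD:
  assumes "f \<in> sobolev a b k m" "j \<le> k"
  shows "f \<in> L2_space a b m" "wderiv a b m j f \<in> L2_space a b m" "is_weak_deriv a b m j f (wderiv a b m j f)"
proof -
  from assms obtain g where "f \<in> L2_space a b m" "g \<in> L2_space a b m" "is_weak_deriv a b m j f g"
    by (auto simp: sobolev_def)
  with wderiv[of g a b m j f]
  show "f \<in> L2_space a b m" "wderiv a b m j f \<in> L2_space a b m" "is_weak_deriv a b m j f (wderiv a b m j f)"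
    by auto
qed

lemma L2_eq_of_eq: "(\<And>s. s \<in> {a..b} \<Longrightarrow> f s = g s) \<Longrightarrow> L2_eq a b f g"
  unfolding L2_eq_def by (rule AE_I2) simp

text \<open>The combination has the shape of the remainder in the Frechet derivative.
  \<open>wderiv\<close> is a choice of representative, so its linearity holds up to null sets and
  comes from the uniqueness of weak derivatives.\<close>

lemma wderiv_combination:
  assumes "f \<in> sobolev a b k m" "g \<in> sobolev a b k m" "e \<in> sobolev a b k m" "j \<le> k"
    and F: "\<And>s. s \<in> {a..b} \<Longrightarrow> F s = f s - g s - h \<cdot>\<^sub>v e s"
  shows "wderiv a b m j F \<in> L2_space a b m"
    "L2_eq a b (wderiv a b m j F) (\<lambda>s. wderiv a b m j f s - wderiv a b m j g s - h \<cdot>\<^sub>v wderiv a b m j e s)"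
proof -
  let ?D = "wderiv a b m j"
  note f = sobolevD[OF assms(1,4)] and g = sobolevD[OF assms(2,4)] and e = sobolevD[OF assms(3,4)]
  let ?c = "\<lambda>f g e s. (f s + (-1) \<cdot>\<^sub>v g s) + (- h) \<cdot>\<^sub>v e s :: real Matrix.vec"
  have eq: "?c f g e s = f s - g s - h \<cdot>\<^sub>v e s"
    if "f \<in> L2_space a b m" "g \<in> L2_space a b m" "e \<in> L2_space a b m" "s \<in> {a..b}" for f g e s
    using L2_spaceD(2)[OF that(1,4)] L2_spaceD(2)[OF that(2,4)] L2_spaceD(2)[OF that(3,4)]
    by (auto intro!: eq_vecI)
  have L: "?c (?D f) (?D g) (?D e) \<in> L2_space a b m"
    by (intro L2_space_add L2_space_smult f g e)
  have "is_weak_deriv a b m j (?c f g e) (?c (?D f) (?D g) (?D e))"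
    by (intro is_weak_deriv_linear L2_space_add L2_space_smult f g e)
  then have W: "is_weak_deriv a b m j F (?c (?D f) (?D g) (?D e))"
    by (rule is_weak_deriv_cong[rotated]) (simp add: F eq[OF f(1) g(1) e(1)])
  show DF: "?D F \<in> L2_space a b m" by (rule wderiv[OF L W])
  have "L2_eq a b (?D F) (?c (?D f) (?D g) (?D e))"
    by (rule is_weak_deriv_unique[OF DF L wderiv(2)[OF L W] W])
  also have "L2_eq a b (?c (?D f) (?D g) (?D e)) (\<lambda>s. ?D f s - ?D g s - h \<cdot>\<^sub>v ?D e s)"
    by (rule L2_eq_of_eq) (rule eq[OF f(2) g(2) e(2)])
  finally (L2_eq_trans) show "L2_eq a b (?D F) (\<lambda>s. ?D f s - ?D g s - h \<cdot>\<^sub>v ?D e s)" .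
qed

lemma AE_lebesgue_on_subset:
  assumes "AE s in Leb a b. P s" "{c..d} \<subseteq> {a..b}"
  shows "AE s in Leb c d. P s"
proof -
  have "AE s in lebesgue. s \<in> {a..b} \<longrightarrow> P s"
    using assms(1) by (simp add: AE_restrict_space_iff)
  then have "AE s in lebesgue. s \<in> {c..d} \<longrightarrow> P s"
    by eventually_elim (use assms(2) in blast)
  then show ?thesis by (simp add: AE_restrict_space_iff)
qed

lemma vec_integral_cong_AE:
  assumes f: "f \<in> L2_space a b m" and g: "g \<in> L2_space a b m" and "L2_eq a b f g" and cd: "{c..d} \<subseteq> {a..b}"
  shows "vec_integral m {c..d} f = vec_integral m {c..d} g"
  unfolding vec_integral_def
proof (rule eq_vecI; simp)
  fix i assume i: "i < m"
  show "(LINT \<theta>|Leb c d. f \<theta> $ i) = (LINT \<theta>|Leb c d. g \<theta> $ i)"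
  proof (rule integral_cong_AE)
    show "AE \<theta> in Leb c d. f \<theta> $ i = g \<theta> $ i"
      using AE_lebesgue_on_subset[OF assms(3)[unfolded L2_eq_def] cd] by eventually_elim simp
  qed (use integrable_lebesgue_on_subinterval[OF L2_comp_integrable[OF f i] cd]
      integrable_lebesgue_on_subinterval[OF L2_comp_integrable[OF g i] cd] in auto)
qed

lemma vec_integral_const:
  assumes "dim_vec v = m" "a \<le> s"
  shows "vec_integral m {a..s} (\<lambda>_. v) = (s - a) \<cdot>\<^sub>v v"
  using assms by (auto intro!: eq_vecI simp: vec_integral_def measure_restrict_space)

lemma vec_integrable_const: "dim_vec v = m \<Longrightarrow> vec_integrable m {c..d} (\<lambda>_. v)"
  by (simp add: vec_integrable_def)

lemma vec_integrable_primitive: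
  assumes u: "u \<in> L2_space a b m" and cd: "{c..d} \<subseteq> {a..b}"
  shows "vec_integrable m {c..d} (\<lambda>r. vec_integral m {a..r} u)"
  unfolding vec_integrable_def
proof (intro conjI ballI allI impI)
  fix i assume i: "i < m"
  have "continuous_on {c..d} (\<lambda>r. LINT \<theta>|Leb a r. u \<theta> $ i)"
    by (rule continuous_on_subset[OF continuous_on_primitive[OF L2_comp_integrable[OF u i]] cd])
  from integrable_mult_continuous[OF integrable_const_lebesgue_on[of c d 1] this] i
  show "integrable (Leb c d) (\<lambda>r. vec_integral m {a..r} u $ i)"
    by (simp add: vec_integral_def)
qed simp

text \<open>The primitive formula is used for f and, under the integral sign, for the continuous
  representative of g, which brings in the value of the derivative at \<open>a\<close>. The repeated
  integral of h collapses to a single one with weight s - \<theta>.\<close>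

lemma cont_rep_taylor:
  assumes "a < b" and f: "f \<in> L2_space a b m" and g: "g \<in> L2_space a b m" and h: "h \<in> L2_space a b m"
    and fg: "is_weak_deriv a b m 1 f g" and gh: "is_weak_deriv a b m 1 g h" and s: "s \<in> {a..b}"
  shows "cont_rep a b m f s = cont_rep a b m f a + (s - a) \<cdot>\<^sub>v cont_rep a b m g a
    + vec_integral m {a..s} (\<lambda>\<theta>. (s - \<theta>) \<cdot>\<^sub>v h \<theta>)"
proof -
  let ?f = "cont_rep a b m f" and ?g = "cont_rep a b m g"
  note F = cont_rep[OF \<open>a < b\<close> f g fg] and G = cont_rep[OF \<open>a < b\<close> g h gh]
  have sub: "{a..s} \<subseteq> {a..b}" and as: "a \<in> {a..b}" "a \<le> s" using s by auto
  have gL: "?g \<in> L2_space a b m" by (rule L2_space_cong_AE[OF g G(2) G(1)])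
  have dg: "dim_vec (?g a) = m" and df: "dim_vec (?f a) = m" using G(1)[OF as(1)] F(1)[OF as(1)] by auto
  have "vec_integral m {a..s} g = vec_integral m {a..s} ?g"
    by (rule vec_integral_cong_AE[OF g gL G(2) sub])
  also have "\<dots> = vec_integral m {a..s} (\<lambda>r. ?g a + vec_integral m {a..r} h)"
    by (rule vec_integral_cong) (use G(3) sub in blast)
  also have "\<dots> = (s - a) \<cdot>\<^sub>v ?g a + vec_integral m {a..s} (\<lambda>\<theta>. (s - \<theta>) \<cdot>\<^sub>v h \<theta>)"
    by (simp add: vec_integral_add[OF vec_integrable_const[OF dg] vec_integrable_primitive[OF h sub]]
      vec_integral_const[OF dg as(2)] vec_integral_vec_integral[OF h s])
  finally show ?thesis
    using F(3)[OF s] dg df by (auto intro!: eq_vecI)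
qed

text \<open>As a map on functions, \<open>Q\<close> might separate almost everywhere equal
  representatives. The adjoint shows that inner products with its values cannot.\<close>

lemma L2_bounded_op_inner_cong:
  assumes Q: "L2_bounded_op a b m n Q" and f: "f \<in> L2_space a b m" and g: "g \<in> L2_space a b m"
    and z: "z \<in> L2_space a b n" and eq: "L2_eq a b f g"
  shows "L2_inner a b (Q f) z = L2_inner a b (Q g) z"
proof -
  from Q obtain R where "R z \<in> L2_space a b m"
    "\<And>x. x \<in> L2_space a b m \<Longrightarrow> L2_inner a b (Q x) z = L2_inner a b x (R z)"
    using z unfolding L2_bounded_op_def by blast
  then show ?thesis using f g L2_inner_cong_AE[OF f _ g _ eq L2_eq_refl] by metis
qed

section \<open>Reconstruction of x and its first derivatives from the highest derivatives\<close>

context boundary_conditions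
begin

text \<open>What remains of \<open>G1\<close> after removing \<open>G2\<close>. Since
  \<open>G2\<close> occurs in both integrals of T, it acts over all of [a,b], whereas this part acts
  over [a,s] and produces the integral terms of Taylor's formula. \<open>D4\<close> is the analogue
  for \<open>G4\<close> and \<open>G5\<close>.\<close>

definition D1 :: "real \<Rightarrow> real \<Rightarrow> real mat" where
  "D1 s \<theta> = 0\<^sub>m n0 n0 @\<^sub>c 0\<^sub>m n0 n1 @\<^sub>c 0\<^sub>m n0 n2
      @\<^sub>r 0\<^sub>m n1 n0 @\<^sub>c 1\<^sub>m n1    @\<^sub>c 0\<^sub>m n1 n2
      @\<^sub>r 0\<^sub>m n2 n0 @\<^sub>c 0\<^sub>m n2 n1 @\<^sub>c ((s - \<theta>) \<cdot>\<^sub>m 1\<^sub>m n2)"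

definition D4 :: "real mat" where
  "D4 = 0\<^sub>m n1 n0 @\<^sub>c 0\<^sub>m n1 n1 @\<^sub>c 0\<^sub>m n1 n2
      @\<^sub>r 0\<^sub>m n2 n0 @\<^sub>c 0\<^sub>m n2 n1 @\<^sub>c 1\<^sub>m n2"

lemma continuous_D: "continuous_mat S n n (D1 s)" "continuous_mat S (n1 + n2) n (\<lambda>_. D4)"
  unfolding D1_def[abs_def] D4_def by (rule continuous_mat_intros | intro continuous_intros | simp)+

lemma continuous_Q: "continuous_mat S (2 * n1 + 4 * n2) n (Q_mat b n0 n1 n2 s)"
  unfolding Q_mat_def[abs_def] by (rule continuous_mat_intros | intro continuous_intros | simp)+

definition hat :: "vfun \<Rightarrow> vfun" where
  "hat x = (\<lambda>s. block 0 n0 x s @\<^sub>v wderiv a b n1 1 (block n0 n1 x) s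
     @\<^sub>v wderiv a b n2 2 (block (n0 + n1) n2 x) s)"

abbreviation "X \<equiv> X_space a b n0 n1 n2 B"

lemma X_spaceD:
  assumes "x \<in> X"
  shows "\<And>s. s \<in> {a..b} \<Longrightarrow> x s \<in> carrier_vec n"
    "block 0 n0 x \<in> L2_space a b n0" "block n0 n1 x \<in> sobolev a b 1 n1"
    "block (n0 + n1) n2 x \<in> sobolev a b 2 n2"
  using assms by (auto simp: X_space_def)

lemma hat_L2:
  assumes "x \<in> X"
  shows "hat x \<in> L2_space a b n"
  unfolding hat_def add.assoc
  by (intro L2_space_append X_spaceD[OF assms] sobolevD(2)[OF X_spaceD(3)[OF assms]]
    sobolevD(2)[OF X_spaceD(4)[OF assms]]) auto

lemma block_append:
  assumes "x s \<in> carrier_vec n"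
  shows "block 0 n0 x s @\<^sub>v block n0 n1 x s @\<^sub>v block (n0 + n1) n2 x s = x s"
proof (rule eq_vecI)
  fix i assume "i < dim_vec (x s)"
  then have i: "i < n0 + (n1 + n2)" using assms by simp
  then show "(block 0 n0 x s @\<^sub>v block n0 n1 x s @\<^sub>v block (n0 + n1) n2 x s) $ i = x s $ i"
    using assms by (auto simp: block_def)
qed (use assms in \<open>simp add: block_def\<close>)

lemma X_L2:
  assumes "x \<in> X"
  shows "x \<in> L2_space a b n"
proof -
  have "(\<lambda>s. block 0 n0 x s @\<^sub>v block n0 n1 x s @\<^sub>v block (n0 + n1) n2 x s) \<in> L2_space a b n"
    unfolding add.assoc
    by (intro L2_space_append X_spaceD(2)[OF assms] sobolevD(1)[OF X_spaceD(3)[OF assms] order_refl]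
      sobolevD(1)[OF X_spaceD(4)[OF assms] order_refl])
  then show ?thesis
    by (rule L2_space_cong[THEN iffD1, rotated]) (simp add: block_append[OF X_spaceD(1)[OF assms]])
qed

text \<open>The values \<open>x\<^sub>1(a), x\<^sub>2(a), \<partial>\<^sub>s x\<^sub>2(a)\<close> determine the element of \<open>X\<close> together with its
  highest derivatives; the boundary conditions express them through the latter because \<open>B T\<close>
  is invertible.\<close>

lemma fundamental_identity:
  assumes x: "x \<in> X"
  shows "L2_eq a b (T_op a b n0 n1 n2 B (hat x)) x"
    and "L2_eq a b (R_op (hat x)) (\<lambda>s. wderiv a b n1 1 (block n0 n1 x) s @\<^sub>v wderiv a b n2 1 (block (n0 + n1) n2 x) s)"
proof -
  let ?y0 = "block 0 n0 x" and ?y1 = "block n0 n1 x" and ?y2 = "block (n0 + n1) n2 x"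
  let ?u1 = "wderiv a b n1 1 ?y1" and ?g2 = "wderiv a b n2 1 ?y2" and ?u2 = "wderiv a b n2 2 ?y2"
  let ?x1 = "cont_rep a b n1 ?y1" and ?x2 = "cont_rep a b n2 ?y2" and ?x2s = "cont_rep a b n2 ?g2"
  note y0 = X_spaceD(2)[OF x] and Y1 = sobolevD[OF X_spaceD(3)[OF x] order_refl]
    and Y21 = sobolevD[OF X_spaceD(4)[OF x], of 1, OF one_le_numeral] and Y22 = sobolevD[OF X_spaceD(4)[OF x] order_refl]
  have gh: "is_weak_deriv a b n2 1 ?g2 ?u2" by (rule is_weak_deriv_2[OF Y21(3) Y22(3)])
  note C1 = cont_rep[OF ab Y1] and C2 = cont_rep[OF ab Y21] and C2s = cont_rep[OF ab Y21(2) Y22(2) gh]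
  note taylor = cont_rep_taylor[OF ab Y21(1,2) Y22(2) Y21(3) gh]
  have aab: "a \<in> {a..b}" "b \<in> {a..b}" using ab by auto
  have dims [simp]: "dim_vec (?x1 s) = n1" "dim_vec (?x2 s) = n2" "dim_vec (?x2s s) = n2"
    "dim_vec (?y0 s) = n0" "dim_vec (?u1 s) = n1" "dim_vec (?u2 s) = n2" "dim_vec (?g2 s) = n2" if "s \<in> {a..b}" for s
    using C1(1)[OF that] C2(1)[OF that] C2s(1)[OF that] L2_spaceD(2)[OF y0 that] L2_spaceD(2)[OF Y1(2) that]
      L2_spaceD(2)[OF Y22(2) that] L2_spaceD(2)[OF Y21(2) that] by auto
  note dimsa [simp] = dims[OF aab(1)] dims[OF aab(2)]
  have hatL: "hat x \<in> L2_space a b n" by (rule hat_L2[OF x])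
  have hatc: "hat x s \<in> carrier_vec n" if "s \<in> {a..b}" for s using L2_spaceD(1)[OF hatL that] .
  note hatI = L2_vec_integrable[OF hatL]
  define c where "c = ?x1 a @\<^sub>v ?x2 a @\<^sub>v ?x2s a"
  have c: "c \<in> carrier_vec (n1 + 2 * n2)"
    by (rule carrier_vecI) (simp add: c_def)
  let ?N = "n1 + (n1 + (n2 + (n2 + (n2 + n2))))"
  have N: "2 * n1 + 4 * n2 = ?N" by simp
  let ?J = "\<lambda>s. vec_integral n2 {a..s} (\<lambda>\<theta>. (s - \<theta>) \<cdot>\<^sub>v ?u2 \<theta>)"
  \<comment> \<open>\<open>Q_mat\<close> takes the same value for every first argument, so the
    single vector \<open>q\<close>, formed with 0 there, serves all points s.\<close>
  define q where "q = vec_integral ?N {a..b} (\<lambda>\<theta>. Q_mat b n0 n1 n2 0 \<theta> *\<^sub>v hat x \<theta>)"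
  have qc: "q \<in> carrier_vec (2 * n1 + 4 * n2)" by (simp add: q_def N)
  have "q = vec_integral ?N {a..b} (\<lambda>\<theta>. 0\<^sub>v n1 @\<^sub>v ?u1 \<theta> @\<^sub>v 0\<^sub>v n2 @\<^sub>v ((b - \<theta>) \<cdot>\<^sub>v ?u2 \<theta>) @\<^sub>v 0\<^sub>v n2 @\<^sub>v ?u2 \<theta>)"
    unfolding q_def by (rule vec_integral_cong) (simp add: Q_mat_def hat_def block_simps)
  also have "\<dots> = 0\<^sub>v n1 @\<^sub>v vec_integral n1 {a..b} ?u1 @\<^sub>v 0\<^sub>v n2 @\<^sub>v ?J b @\<^sub>v 0\<^sub>v n2 @\<^sub>v vec_integral n2 {a..b} ?u2"
    by ((subst vec_integral_append, simp, simp)+, simp)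
  finally have q: "q = 0\<^sub>v n1 @\<^sub>v vec_integral n1 {a..b} ?u1 @\<^sub>v 0\<^sub>v n2 @\<^sub>v ?J b @\<^sub>v 0\<^sub>v n2 @\<^sub>v vec_integral n2 {a..b} ?u2" .
  let ?T = "T_mat a b n1 n2" and ?W = "mat_inv (B * T_mat a b n1 n2)"
  have "B *\<^sub>v (?x1 a @\<^sub>v ?x1 b @\<^sub>v ?x2 a @\<^sub>v ?x2 b @\<^sub>v ?x2s a @\<^sub>v ?x2s b) = 0\<^sub>v (n1 + 2 * n2)"
    using x by (simp add: X_space_def Let_def)
  \<comment> \<open>The values at \<open>a\<close> are the components of \<open>c\<close>. Those at
    \<open>b\<close> come from the primitive formula for x1 and for the derivative of x2, and from
    Taylor's formula for x2.\<close>
  also have "?x1 a @\<^sub>v ?x1 b @\<^sub>v ?x2 a @\<^sub>v ?x2 b @\<^sub>v ?x2s a @\<^sub>v ?x2s b = ?T *\<^sub>v c + q"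
    unfolding T_mat_def c_def q C1(3)[OF aab(2)] C2s(3)[OF aab(2)] taylor[OF aab(2)]
    by (simp add: block_simps)
  finally have bc: "B *\<^sub>v (?T *\<^sub>v c + q) = 0\<^sub>v (n1 + 2 * n2)" .
  have Tc: "?T *\<^sub>v c \<in> carrier_vec (2 * n1 + 4 * n2)" by (rule mult_mat_vec_carrier[OF T_mat_carrier c])
  have Bq: "B *\<^sub>v q \<in> carrier_vec (n1 + 2 * n2)" and BTc: "B *\<^sub>v (?T *\<^sub>v c) \<in> carrier_vec (n1 + 2 * n2)"
    by (rule mult_mat_vec_carrier[OF B qc], rule mult_mat_vec_carrier[OF B Tc])
  have WBq: "?W *\<^sub>v (B *\<^sub>v q) \<in> carrier_vec (n1 + 2 * n2)" by (rule mult_mat_vec_carrier[OF inv_carrier Bq])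
  have "?W *\<^sub>v (B *\<^sub>v (?T *\<^sub>v c)) = (?W * (B * ?T)) *\<^sub>v c"
    by (simp add: assoc_mult_mat_vec[OF inv_carrier mult_carrier_mat[OF B T_mat_carrier] c]
      assoc_mult_mat_vec[OF B T_mat_carrier c])
  also have "\<dots> = c" unfolding inv_mult using c by simp
  finally have "c + ?W *\<^sub>v (B *\<^sub>v q) = ?W *\<^sub>v (B *\<^sub>v (?T *\<^sub>v c + q))"
    by (simp add: mult_add_distrib_mat_vec[OF B Tc qc] mult_add_distrib_mat_vec[OF inv_carrier BTc Bq])
  also have "\<dots> = 0\<^sub>v (n1 + 2 * n2)"
    unfolding bc using inv_carrier by (auto intro!: eq_vecI simp: scalar_prod_def)
  finally have sum0: "c + ?W *\<^sub>v (B *\<^sub>v q) = 0\<^sub>v (n1 + 2 * n2)" .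
  have cW: "?W *\<^sub>v (B *\<^sub>v q) = - c"
  proof (rule eq_vecI)
    fix i assume "i < dim_vec (- c)"
    then have i: "i < n1 + 2 * n2" using c by simp
    from arg_cong[OF sum0, of "\<lambda>v. v $ i"] i c inv_carrier show "(?W *\<^sub>v (B *\<^sub>v q)) $ i = (- c) $ i"
      by (simp add: eq_neg_iff_add_eq_0 add.commute)
  qed (use c inv_carrier in simp)
  \<comment> \<open>Integrated over the whole interval, such a kernel sees \<open>hat x\<close> only
    through \<open>q\<close>. As the inverse of B T applied to B q is -c, the minus sign of the
    kernel turns the result into M c.\<close>
  have kernel: "vec_integral p {a..b} (\<lambda>\<theta>. - (M * ?W * B * Q_mat b n0 n1 n2 s \<theta>) *\<^sub>v hat x \<theta>) = M *\<^sub>v c"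
    if M: "M \<in> carrier_mat p (n1 + 2 * n2)" for M p s
  proof -
    have MW: "M * ?W \<in> carrier_mat p (n1 + 2 * n2)" by (rule mult_carrier_mat[OF M inv_carrier])
    have MWB: "M * ?W * B \<in> carrier_mat p (2 * n1 + 4 * n2)" by (rule mult_carrier_mat[OF MW B])
    have "vec_integral p {a..b} (\<lambda>\<theta>. - (M * ?W * B * Q_mat b n0 n1 n2 s \<theta>) *\<^sub>v hat x \<theta>)
        = vec_integral p {a..b} (\<lambda>\<theta>. - (M * ?W * B) *\<^sub>v (Q_mat b n0 n1 n2 0 \<theta> *\<^sub>v hat x \<theta>))"
    proof (rule vec_integral_cong)
      fix \<theta> assume \<theta>: "\<theta> \<in> {a..b}"
      have Q: "Q_mat b n0 n1 n2 s \<theta> \<in> carrier_mat (2 * n1 + 4 * n2) n" "Q_mat b n0 n1 n2 0 \<theta> = Q_mat b n0 n1 n2 s \<theta>"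
        using continuous_matD(1)[OF continuous_Q \<theta>] by (auto simp: Q_mat_def)
      from hatc[OF \<theta>] MWB Q(1) B show "- (M * ?W * B * Q_mat b n0 n1 n2 s \<theta>) *\<^sub>v hat x \<theta>
          = - (M * ?W * B) *\<^sub>v (Q_mat b n0 n1 n2 0 \<theta> *\<^sub>v hat x \<theta>)"
        unfolding Q(2)
        by (simp add: assoc_mult_mat_vec[OF MWB Q(1) hatc[OF \<theta>]] del: assoc_mult_mat)
    qed
    also have "\<dots> = - (M * ?W * B) *\<^sub>v q"
      unfolding q_def N[symmetric]
      by (rule vec_integral_mult[OF uminus_carrier_mat[OF MWB] vec_integrable_mult_continuous[OF continuous_Q hatI]]) simp
    also have "\<dots> = - (M *\<^sub>v (?W *\<^sub>v (B *\<^sub>v q)))"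
      using MWB qc B by (simp add: assoc_mult_mat_vec[OF MW B qc] assoc_mult_mat_vec[OF M inv_carrier Bq] del: assoc_mult_mat)
    also have "\<dots> = M *\<^sub>v c"
      unfolding cW using M c by (auto intro!: eq_vecI)
    finally show ?thesis .
  qed
  \<comment> \<open>Common shape of T, with M = K, and of R, with M = V. The kernel \<open>F\<close>
    stands in the lower and in the upper integral, and the two pieces add up to an integral over
    [a,b].\<close>
  have PI: "PI_op a b p F0 (\<lambda>s \<theta>. D s \<theta> + F s \<theta>) F (hat x) s
      = F0 s *\<^sub>v hat x s + vec_integral p {a..s} (\<lambda>\<theta>. D s \<theta> *\<^sub>v hat x \<theta>) + M *\<^sub>v c"
    if s: "s \<in> {a..b}" and F0: "F0 s \<in> carrier_mat p n" and M: "M \<in> carrier_mat p (n1 + 2 * n2)"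
      and F: "F s = (\<lambda>\<theta>. - (M * ?W * B * Q_mat b n0 n1 n2 s \<theta>))"
      and D: "continuous_mat {a..s} p n (D s)" and cF: "\<And>S. S \<subseteq> {a..b} \<Longrightarrow> continuous_mat S p n (F s)"
    for s p F0 D F M
  proof -
    have sub: "{a..s} \<subseteq> {a..b}" using s by auto
    let ?F = "\<lambda>\<theta>. F s \<theta> *\<^sub>v hat x \<theta>" and ?D = "\<lambda>\<theta>. D s \<theta> *\<^sub>v hat x \<theta>"
    note iF = vec_integrable_mult_continuous[OF cF hatI] and iD = vec_integrable_mult_continuous[OF D hatI[OF sub]]
    have "vec_integral p {a..s} (\<lambda>\<theta>. (D s \<theta> + F s \<theta>) *\<^sub>v hat x \<theta>) = vec_integral p {a..s} (\<lambda>\<theta>. ?D \<theta> + ?F \<theta>)"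
    proof (rule vec_integral_cong)
      fix \<theta> assume \<theta>: "\<theta> \<in> {a..s}"
      show "(D s \<theta> + F s \<theta>) *\<^sub>v hat x \<theta> = ?D \<theta> + ?F \<theta>"
        by (rule add_mult_distrib_mat_vec[OF continuous_matD(1)[OF D \<theta>] continuous_matD(1)[OF cF[OF sub] \<theta>]
          hatc[OF subsetD[OF sub \<theta>]]])
    qed
    also have "\<dots> = vec_integral p {a..s} ?D + vec_integral p {a..s} ?F"
      by (rule vec_integral_add[OF iD iF[OF sub sub]])
    finally have "PI_op a b p F0 (\<lambda>s \<theta>. D s \<theta> + F s \<theta>) F (hat x) s
        = F0 s *\<^sub>v hat x s + vec_integral p {a..s} ?D + (vec_integral p {a..s} ?F + vec_integral p {s..b} ?F)"
      using F0 by (auto intro!: eq_vecI simp: PI_op_def)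
    also have "vec_integral p {a..s} ?F + vec_integral p {s..b} ?F = M *\<^sub>v c"
      unfolding vec_integral_split[OF iF[OF order_refl order_refl] s] unfolding F by (rule kernel[OF M])
    finally show ?thesis .
  qed
  have Tid: "T_op a b n0 n1 n2 B (hat x) s = ?y0 s @\<^sub>v ?x1 s @\<^sub>v ?x2 s" if s: "s \<in> {a..b}" for s
  proof -
    note [simp] = dims[OF s]
    have sub: "{a..s} \<subseteq> {a..b}" using s by auto
    note dims' = dims[OF subsetD[OF sub]]
    have n: "n = n0 + (n1 + n2)" by simp
    have "vec_integral n {a..s} (\<lambda>\<theta>. D1 s \<theta> *\<^sub>v hat x \<theta>)
        = vec_integral (n0 + (n1 + n2)) {a..s} (\<lambda>\<theta>. 0\<^sub>v n0 @\<^sub>v ?u1 \<theta> @\<^sub>v ((s - \<theta>) \<cdot>\<^sub>v ?u2 \<theta>))"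
      unfolding n by (rule vec_integral_cong) (simp add: D1_def hat_def block_simps dims')
    also have "\<dots> = 0\<^sub>v n0 @\<^sub>v vec_integral n1 {a..s} ?u1 @\<^sub>v ?J s"
      by ((subst vec_integral_append, simp add: dims', simp add: dims')+, simp)
    finally have Dx: "vec_integral n {a..s} (\<lambda>\<theta>. D1 s \<theta> *\<^sub>v hat x \<theta>) = 0\<^sub>v n0 @\<^sub>v vec_integral n1 {a..s} ?u1 @\<^sub>v ?J s" .
    have "T_op a b n0 n1 n2 B (hat x) s
        = G0 n0 n1 n2 s *\<^sub>v hat x s + vec_integral n {a..s} (\<lambda>\<theta>. D1 s \<theta> *\<^sub>v hat x \<theta>) + K_mat a n0 n1 n2 s *\<^sub>v c"
      unfolding T_op_def G1_def[abs_def] D1_def[symmetric]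
      by (rule PI[where D = D1 and F = "G2 a b n0 n1 n2 B" and M = "K_mat a n0 n1 n2 s" and ?F0.0 = "G0 n0 n1 n2", OF s continuous_matD(1)[OF continuous_G(1) s]
          carrier_matI ext continuous_D(1) G_section(2)[OF s]])
        (simp_all add: K_mat_def G2_def)
    \<comment> \<open>\<open>K_mat\<close> applied to \<open>c\<close> gives the Taylor polynomials
      at \<open>a\<close> of x1 (degree 0) and x2 (degree 1); \<open>D1\<close> has contributed the
      integral remainders.\<close>
    also have "\<dots> = (?y0 s @\<^sub>v 0\<^sub>v n1 @\<^sub>v 0\<^sub>v n2) + (0\<^sub>v n0 @\<^sub>v vec_integral n1 {a..s} ?u1 @\<^sub>v ?J s)
        + (0\<^sub>v n0 @\<^sub>v ?x1 a @\<^sub>v (?x2 a + (s - a) \<cdot>\<^sub>v ?x2s a))"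
      unfolding Dx by (simp add: G0_def hat_def K_mat_def c_def block_simps)
    also have "\<dots> = ?y0 s @\<^sub>v (vec_integral n1 {a..s} ?u1 + ?x1 a) @\<^sub>v (?J s + (?x2 a + (s - a) \<cdot>\<^sub>v ?x2s a))"
      by (simp add: append_vec_add_dim add_zero_vec)
    also have "vec_integral n1 {a..s} ?u1 + ?x1 a = ?x1 s"
      unfolding C1(3)[OF s] by (auto intro!: eq_vecI)
    also have "?J s + (?x2 a + (s - a) \<cdot>\<^sub>v ?x2s a) = ?x2 s"
      unfolding taylor[OF s] by (auto intro!: eq_vecI)
    finally show ?thesis .
  qed
  \<comment> \<open>The second component comes out as the continuous representative of the
    derivative of x2; it agrees with the chosen weak derivative almost everywhere.\<close>
  have Rid: "R_op (hat x) s = ?u1 s @\<^sub>v ?x2s s" if s: "s \<in> {a..b}" for s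
  proof -
    note [simp] = dims[OF s]
    have sub: "{a..s} \<subseteq> {a..b}" using s by auto
    note dims' = dims[OF subsetD[OF sub]]
    have "vec_integral (n1 + n2) {a..s} (\<lambda>\<theta>. D4 *\<^sub>v hat x \<theta>) = vec_integral (n1 + n2) {a..s} (\<lambda>\<theta>. 0\<^sub>v n1 @\<^sub>v ?u2 \<theta>)"
      by (rule vec_integral_cong) (simp add: D4_def hat_def block_simps dims')
    also have "\<dots> = 0\<^sub>v n1 @\<^sub>v vec_integral n2 {a..s} ?u2"
      by ((subst vec_integral_append, simp add: dims', simp add: dims')+, simp)
    finally have Dx: "vec_integral (n1 + n2) {a..s} (\<lambda>\<theta>. D4 *\<^sub>v hat x \<theta>) = 0\<^sub>v n1 @\<^sub>v vec_integral n2 {a..s} ?u2" .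
    have "R_op (hat x) s
        = G3 n0 n1 n2 s *\<^sub>v hat x s + vec_integral (n1 + n2) {a..s} (\<lambda>\<theta>. D4 *\<^sub>v hat x \<theta>) + V_mat n1 n2 *\<^sub>v c"
      unfolding R_op_def G4_def[abs_def] D4_def[symmetric]
      by (rule PI[where D = "\<lambda>_ _. D4" and F = "G5 a b n0 n1 n2 B" and M = "V_mat n1 n2" and ?F0.0 = "G3 n0 n1 n2", OF s continuous_matD(1)[OF continuous_G(4) s]
          carrier_matI ext continuous_D(2) G_section(4)[OF s]])
        (simp_all add: V_mat_def G5_def)
    also have "\<dots> = (?u1 s @\<^sub>v 0\<^sub>v n2) + (0\<^sub>v n1 @\<^sub>v vec_integral n2 {a..s} ?u2) + (0\<^sub>v n1 @\<^sub>v ?x2s a)"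
      unfolding Dx by (simp add: G3_def hat_def V_mat_def c_def block_simps)
    also have "\<dots> = ?u1 s @\<^sub>v (vec_integral n2 {a..s} ?u2 + ?x2s a)"
      by (simp add: append_vec_add_dim add_zero_vec)
    also have "vec_integral n2 {a..s} ?u2 + ?x2s a = ?x2s s"
      unfolding C2s(3)[OF s] by (auto intro!: eq_vecI)
    finally show ?thesis .
  qed
  have inS: "AE s in Leb a b. s \<in> {a..b}" by (rule AE_I2) simp
  show "L2_eq a b (T_op a b n0 n1 n2 B (hat x)) x"
    unfolding L2_eq_def using inS C1(2)[unfolded L2_eq_def] C2(2)[unfolded L2_eq_def]
  proof eventually_elim
    case (elim s)
    with Tid[OF elim(1)] block_append[of x s, OF X_spaceD(1)[OF x elim(1)]] show ?case by simp
  qed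
  show "L2_eq a b (R_op (hat x)) (\<lambda>s. ?u1 s @\<^sub>v ?g2 s)"
    unfolding L2_eq_def using inS C2s(2)[unfolded L2_eq_def]
    by eventually_elim (simp add: Rid)
qed

text \<open>In the factorisation of A, the operators T and R return x and its first derivatives, and
  the last summand reads off the second derivative stored in \<open>hat x\<close>.\<close>

lemma A_op_hat:
  assumes x: "x \<in> X"
    and A0: "\<And>s. s \<in> {a..b} \<Longrightarrow> A0 s \<in> carrier_mat n n"
    and A1: "\<And>s. s \<in> {a..b} \<Longrightarrow> A1 s \<in> carrier_mat n (n1 + n2)"
    and A2: "\<And>s. s \<in> {a..b} \<Longrightarrow> A2 s \<in> carrier_mat n n2"
  shows "L2_eq a b (A_op a b n0 n1 n2 B A0 A1 A2 (hat x)) (\<lambda>s.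
          A0 s *\<^sub>v x s
          + A1 s *\<^sub>v (wderiv a b n1 1 (block n0 n1 x) s @\<^sub>v wderiv a b n2 1 (block (n0 + n1) n2 x) s)
          + A2 s *\<^sub>v wderiv a b n2 2 (block (n0 + n1) n2 x) s)"
proof -
  have inS: "AE s in Leb a b. s \<in> {a..b}" by (rule AE_I2) simp
  show ?thesis
    unfolding L2_eq_def
    using inS fundamental_identity[OF x, unfolded L2_eq_def]
  proof eventually_elim
    case (elim s)
    have d: "dim_vec (wderiv a b n1 1 (block n0 n1 x) s) = n1"
      "dim_vec (wderiv a b n2 2 (block (n0 + n1) n2 x) s) = n2" "dim_vec (block 0 n0 x s) = n0"
      using elim(1) L2_spaceD(2)[OF sobolevD(2)[OF X_spaceD(3)[OF x] order_refl]]
        L2_spaceD(2)[OF sobolevD(2)[OF X_spaceD(4)[OF x] order_refl]] by (auto simp: block_def)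
    have m: "dim_row (A2 s) = n" "dim_col (A2 s) = n2" using A2[OF elim(1)] by auto
    have "(0\<^sub>m n n0 @\<^sub>c 0\<^sub>m n n1 @\<^sub>c A2 s) *\<^sub>v hat x s = A2 s *\<^sub>v wderiv a b n2 2 (block (n0 + n1) n2 x) s"
      unfolding hat_def by (simp add: append_cols_mult_vec zero_mult_vec add_zero_vec d m)
    moreover have "A_op a b n0 n1 n2 B A0 A1 A2 (hat x) s = A0 s *\<^sub>v T_op a b n0 n1 n2 B (hat x) s
        + A1 s *\<^sub>v R_op (hat x) s + (0\<^sub>m n n0 @\<^sub>c 0\<^sub>m n n1 @\<^sub>c A2 s) *\<^sub>v hat x s"
      by (rule A_op_eq[OF A0 A1 A2 hat_L2[OF x] elim(1)])
    ultimately show ?case using elim by simp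
  qed
qed

text \<open>The inner product of stacked functions is the sum over the blocks, so \<open>hat\<close>
  carries the norm of X to the norm of L2. Since \<open>hat\<close> contains chosen weak
  derivatives, its linearity holds almost everywhere.\<close>

lemma hat_combination:
  fixes h :: real
  assumes x: "x \<in> X" and y: "y \<in> X" and v: "v \<in> X"
  defines "w \<equiv> \<lambda>s. x s - y s - h \<cdot>\<^sub>v v s"
  shows "hat w \<in> L2_space a b n" "X_norm a b n0 n1 n2 w = L2_norm a b (hat w)"
    "L2_eq a b (hat w) (\<lambda>s. hat x s - hat y s - h \<cdot>\<^sub>v hat v s)"
proof -
  have blk: "block off m w s = block off m x s - block off m y s - h \<cdot>\<^sub>v block off m v s"
    if "s \<in> {a..b}" "off + m \<le> n" for off m s
    using X_spaceD(1)[OF x that(1)] X_spaceD(1)[OF y that(1)] X_spaceD(1)[OF v that(1)] that(2)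
    by (auto intro!: eq_vecI simp: block_def w_def)
  have w0: "block 0 n0 w \<in> L2_space a b n0"
  proof (rule L2_space_cong[THEN iffD1])
    show "(\<lambda>s. block 0 n0 x s - block 0 n0 y s - h \<cdot>\<^sub>v block 0 n0 v s) \<in> L2_space a b n0"
      by (intro L2_space_diff L2_space_smult X_spaceD(2) x y v)
  qed (simp add: blk)
  note w1 = wderiv_combination[OF X_spaceD(3)[OF x] X_spaceD(3)[OF y] X_spaceD(3)[OF v] order_refl, of "block n0 n1 w" h,
    OF blk, simplified]
  note w2 = wderiv_combination[OF X_spaceD(4)[OF x] X_spaceD(4)[OF y] X_spaceD(4)[OF v] order_refl, of "block (n0 + n1) n2 w" h,
    OF blk, simplified]
  show L: "hat w \<in> L2_space a b n"
    unfolding hat_def add.assoc by (intro L2_space_append w0 w1 w2)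
  show "X_norm a b n0 n1 n2 w = L2_norm a b (hat w)"
    unfolding X_norm_def X_inner_def L2_norm_def hat_def
    by (simp add: L2_inner_append[OF w0 w0 L2_space_append[OF w1(1) w2(1)] L2_space_append[OF w1(1) w2(1)]]
      L2_inner_append[OF w1(1) w1(1) w2(1) w2(1)])
  have inS: "AE s in Leb a b. s \<in> {a..b}" by (rule AE_I2) simp
  show "L2_eq a b (hat w) (\<lambda>s. hat x s - hat y s - h \<cdot>\<^sub>v hat v s)"
    unfolding L2_eq_def using inS w1(2)[unfolded L2_eq_def] w2(2)[unfolded L2_eq_def]
  proof eventually_elim
    case (elim s)
    have d: "dim_vec (wderiv a b n1 1 (block n0 n1 z) s) = n1" "dim_vec (wderiv a b n2 2 (block (n0 + n1) n2 z) s) = n2"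
      if "z \<in> X" for z
      using elim(1) L2_spaceD(2)[OF sobolevD(2)[OF X_spaceD(3)[OF that] order_refl]]
        L2_spaceD(2)[OF sobolevD(2)[OF X_spaceD(4)[OF that] order_refl]] by auto
    have d0: "dim_vec (block 0 n0 z s) = n0" for z by (simp add: block_def)
    show ?case
      unfolding hat_def using elim
      by (auto intro!: eq_vecI simp: blk d[OF x] d[OF y] d[OF v] d0)
  qed
qed

text \<open>Since \<open>\<T>\<close> is bounded and \<open>w = \<T> (hat w)\<close>, convergence in \<open>X\<close> implies convergence in
  \<open>L\<^sub>2\<close>.\<close>

lemma L2_norm_le_X_norm:
  obtains C where "C \<ge> 0" "\<And>x y v h. x \<in> X \<Longrightarrow> y \<in> X \<Longrightarrow> v \<in> X \<Longrightarrow>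
    L2_norm a b (\<lambda>s. x s - y s - h \<cdot>\<^sub>v v s) \<le> C * X_norm a b n0 n1 n2 (\<lambda>s. x s - y s - h \<cdot>\<^sub>v v s)"
proof -
  let ?T = "T_op a b n0 n1 n2 B"
  from bounded_T_op obtain C where C: "C \<ge> 0"
    "\<And>x. x \<in> L2_space a b n \<Longrightarrow> L2_norm a b (?T x) \<le> C * L2_norm a b x"
    "\<And>x. x \<in> L2_space a b n \<Longrightarrow> ?T x \<in> L2_space a b n"
    unfolding L2_bounded_op_def by blast
  show ?thesis
  proof (rule that[OF C(1)])
    fix x y v :: vfun and h :: real
    assume x: "x \<in> X" and y: "y \<in> X" and v: "v \<in> X"
    let ?w = "\<lambda>s. x s - y s - h \<cdot>\<^sub>v v s"
    note H = hat_combination[OF x y v, of h]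
    have hx: "hat x \<in> L2_space a b n" and hy: "hat y \<in> L2_space a b n" and hv: "hat v \<in> L2_space a b n"
      using hat_L2 x y v by auto
    have Lx: "x \<in> L2_space a b n" and Ly: "y \<in> L2_space a b n" and Lv: "v \<in> L2_space a b n"
      using X_L2 x y v by auto
    have w: "?w \<in> L2_space a b n" by (intro L2_space_diff L2_space_smult Lx Ly Lv)
    \<comment> \<open>T is linear after pairing, so \<open>w = T (hat w)\<close> is not formed as an
      equation between functions. Pairing \<open>T (hat w)\<close> with \<open>w\<close> gives the
      squared norm of \<open>w\<close>, and Cauchy-Schwarz lets one factor cancel.\<close>
    have T: "L2_inner a b (?T (hat u)) ?w = L2_inner a b u ?w" if "u \<in> X" for u
      by (rule L2_inner_cong_AE[OF C(3)[OF hat_L2[OF that]] w X_L2[OF that] w fundamental_identity(1)[OF that] L2_eq_refl])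
    have "L2_inner a b (?T (hat ?w)) ?w = L2_inner a b (?T (\<lambda>s. (hat x s + (-1) \<cdot>\<^sub>v hat y s) + (- h) \<cdot>\<^sub>v hat v s)) ?w"
    proof (rule L2_bounded_op_inner_cong[OF bounded_T_op H(1) _ w])
      have "L2_eq a b (\<lambda>s. hat x s - hat y s - h \<cdot>\<^sub>v hat v s) (\<lambda>s. (hat x s + (-1) \<cdot>\<^sub>v hat y s) + (- h) \<cdot>\<^sub>v hat v s)"
      proof (rule L2_eq_of_eq)
        fix s assume "s \<in> {a..b}"
        from L2_spaceD(2)[OF hx this] L2_spaceD(2)[OF hy this] L2_spaceD(2)[OF hv this]
        show "hat x s - hat y s - h \<cdot>\<^sub>v hat v s = (hat x s + (-1) \<cdot>\<^sub>v hat y s) + (- h) \<cdot>\<^sub>v hat v s"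
          by (auto intro!: eq_vecI)
      qed
      then show "L2_eq a b (hat ?w) (\<lambda>s. (hat x s + (-1) \<cdot>\<^sub>v hat y s) + (- h) \<cdot>\<^sub>v hat v s)"
        by (rule L2_eq_trans[OF H(3)])
    qed (intro L2_space_add L2_space_smult hx hy hv)
    also have "\<dots> = L2_inner a b x ?w - L2_inner a b y ?w - h * L2_inner a b v ?w"
      using hx hy hv by (simp add: L2_bounded_op_linear[OF bounded_T_op _ _ w] L2_space_add L2_space_smult T x y v)
    also have "\<dots> = L2_inner a b ?w ?w"
      using Lx Ly Lv w by (simp add: L2_inner_diff_left[OF L2_space_diff[OF Lx Ly] L2_space_smult[OF Lv]]
        L2_inner_diff_left[OF Lx Ly] L2_inner_smult_left)
    finally have "(L2_norm a b ?w)\<^sup>2 \<le> L2_norm a b (?T (hat ?w)) * L2_norm a b ?w"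
      using L2_Cauchy_Schwarz[OF C(3)[OF H(1)] w] by (simp add: L2_norm_power2[OF w])
    then have "L2_norm a b ?w \<le> L2_norm a b (?T (hat ?w))"
      using L2_norm_nonneg[OF w] L2_norm_nonneg[OF C(3)[OF H(1)]]
      by (cases "L2_norm a b ?w = 0") (auto simp: power2_eq_square)
    also have "\<dots> \<le> C * X_norm a b n0 n1 n2 ?w"
      using C(2)[OF H(1)] H(2) by simp
    finally show "L2_norm a b ?w \<le> C * X_norm a b n0 n1 n2 ?w" .
  qed
qed

end

section \<open>Exponential stability\<close>

text \<open>The integrating factor exp(k s) turns the differential inequality into a nonpositive
  derivative of V(s) exp(k s), and the mean value theorem on [0,t] compares the endpoints.\<close>

lemma exponential_decay:
  fixes V V' :: "real \<Rightarrow> real"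
  assumes der: "\<And>s. s \<ge> 0 \<Longrightarrow> (V has_real_derivative V' s) (at s within {0..})"
    and le: "\<And>s. s \<ge> 0 \<Longrightarrow> V' s \<le> - k * V s" and "t \<ge> 0"
  shows "V t \<le> V 0 * exp (- k * t)"
proof (cases "t = 0")
  case False
  with \<open>t \<ge> 0\<close> have t: "0 < t" by simp
  let ?E = "\<lambda>s. V s * exp (k * s)" and ?E' = "\<lambda>s. (V' s + k * V s) * exp (k * s)"
  have E: "(?E has_derivative (*) (?E' s)) (at s within {0..t})" if "0 \<le> s" "s \<le> t" for s
  proof -
    have "(?E has_real_derivative ?E' s) (at s within {0..})"
      using that by (auto intro!: derivative_eq_intros der simp: algebra_simps)
    then have "(?E has_real_derivative ?E' s) (at s within {0..t})"
      by (rule has_field_derivative_subset) auto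
    then show ?thesis by (simp add: has_field_derivative_def)
  qed
  obtain s where s: "s \<in> {0<..<t}" "?E t - ?E 0 = ?E' s * (t - 0)"
    using mvt_simple[OF t E] by blast
  have "?E' s * (t - 0) \<le> 0"
    using le[of s] s(1) t by (intro mult_nonpos_nonneg) auto
  with s(2) have "V t * exp (k * t) \<le> V 0" by simp
  then have "V t * exp (k * t) * exp (- k * t) \<le> V 0 * exp (- k * t)"
    by (intro mult_right_mono) auto
  then show ?thesis by (simp add: mult.assoc exp_add[symmetric])
qed simp

theorem theorem16:
  fixes a b \<alpha> \<delta> :: real
    and n0 n1 n2 n :: nat
    and B :: "real mat"
    and A0 A1 A2 N0 :: "real \<Rightarrow> real mat"
    and N1 N2 :: "real \<Rightarrow> real \<Rightarrow> real mat"
    and P T A :: vop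
    and xinit :: vfun
    and x :: "real \<Rightarrow> vfun"
    and \<zeta> t :: real
  assumes "a < b"
    and "n = n0 + n1 + n2"
    and "B \<in> carrier_mat (n1 + 2 * n2) (2 * n1 + 4 * n2)"
    and "invertible_mat (B * T_mat a b n1 n2)"
    and "bounded_measurable_mat {a..b} n n A0"
    and "bounded_measurable_mat {a..b} n (n1 + n2) A1"
    and "bounded_measurable_mat {a..b} n n2 A2"
    and "T = T_op a b n0 n1 n2 B"
    and "A = A_op a b n0 n1 n2 B A0 A1 A2"
    and "\<alpha> > 0" and "\<delta> > 0"
    and "bounded_measurable_mat {a..b} n n N0"
    and "bounded_measurable_mat ({a..b} \<times> {a..b}) n n (\<lambda>(s, \<theta>). N1 s \<theta>)"
    and "bounded_measurable_mat ({a..b} \<times> {a..b}) n n (\<lambda>(s, \<theta>). N2 s \<theta>)"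
    and "P = PI_op a b n N0 N1 N2"
    and "L2_op_eq a b n P (L2_adj a b n P)"
    and "L2_op_le a b n (op_smult \<alpha> id) P"
    and "L2_op_le a b n
           (op_add (L2_adj a b n A \<circ> P \<circ> T) (L2_adj a b n T \<circ> P \<circ> A))
           (op_smult (- \<delta>) (L2_adj a b n T \<circ> T))"
    and "\<zeta> = L2_onorm a b n P"
    and "xinit \<in> X_space a b n0 n1 n2 B"
    and "PDE_solution a b n0 n1 n2 B A0 A1 A2 xinit x"
    and "t \<ge> 0"
  shows "(L2_norm a b (x t))\<^sup>2 \<le> \<zeta> / \<alpha> * (L2_norm a b (x 0))\<^sup>2 * exp (- (\<delta> / \<zeta>) * t)"
proof -
  note ab = assms(1) and n = assms(2)
  interpret boundary_conditions a b n0 n1 n2 B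
    by unfold_locales (use assms(1,3,4) in auto)
  let ?L = "L2_space a b n" and ?N = "L2_norm a b" and ?I = "L2_inner a b"
  have bT: "L2_bounded_op a b n n T" unfolding assms(8) n by (rule bounded_T_op)
  have bA: "L2_bounded_op a b n n A"
    unfolding assms(9) n by (rule bounded_A_op) (use assms(5-7) n in auto)
  have bP: "L2_bounded_op a b n n P"
    unfolding assms(15) by (rule L2_bounded_op_PI) (use assms(1,12-14) in auto)
  have TL: "T f \<in> ?L" and AL: "A f \<in> ?L" and PL: "P f \<in> ?L" if "f \<in> ?L" for f
    using bT bA bP that unfolding L2_bounded_op_def by auto
  have sym: "?I f (P g) = ?I (P f) g" if f: "f \<in> ?L" and g: "g \<in> ?L" for f g
  proof -
    have "L2_eq a b (P g) (L2_adj a b n P g)"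
      using assms(16) g by (auto simp: L2_op_eq_def)
    then have "?I f (P g) = ?I f (L2_adj a b n P g)"
      by (intro L2_inner_cong_AE[OF f PL[OF g] f L2_adj(1)[OF bP f g]]) auto
    also have "\<dots> = ?I (P f) g" by (rule L2_adj(2)[OF bP f g])
    finally show ?thesis .
  qed
  \<comment> \<open>P is linear only up to null sets, yet this form is exactly bilinear on L2:
    linearity in the first argument is that of the inner product, and symmetry transfers it to the
    second.\<close>
  define \<beta> where "\<beta> f g = ?I f (P g)" for f g
  have \<beta>_sym: "\<beta> f g = \<beta> g f" if "f \<in> ?L" "g \<in> ?L" for f g
    unfolding \<beta>_def using sym[OF that] L2_inner_commute[OF PL[OF that(1)] that(2)] by simp
  have \<beta>_add: "\<beta> (\<lambda>s. f s + g s) e = \<beta> f e + \<beta> g e" if "f \<in> ?L" "g \<in> ?L" "e \<in> ?L" for f g e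
    unfolding \<beta>_def by (rule L2_inner_add_left[OF that(1,2) PL[OF that(3)]])
  have \<beta>_smult: "\<beta> (\<lambda>s. c \<cdot>\<^sub>v f s) e = c * \<beta> f e" if "f \<in> ?L" "e \<in> ?L" for f c e
    unfolding \<beta>_def by (rule L2_inner_smult_left[OF that(1) PL[OF that(2)]])
  have \<beta>_cong: "\<beta> f g = \<beta> f' g" if "f \<in> ?L" "f' \<in> ?L" "g \<in> ?L" "L2_eq a b f f'" for f f' g
    unfolding \<beta>_def by (rule L2_inner_cong_AE[OF that(1) PL[OF that(3)] that(2) PL[OF that(3)] that(4) L2_eq_refl])
  have \<zeta>P: "?N (P f) \<le> \<zeta> * ?N f" if "f \<in> ?L" for f
    unfolding assms(19) by (rule L2_norm_le_onorm[OF bP that])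
  have \<beta>_bound: "\<bar>\<beta> f g\<bar> \<le> \<zeta> * ?N f * ?N g" if f: "f \<in> ?L" and g: "g \<in> ?L" for f g
  proof -
    have "\<bar>\<beta> f g\<bar> \<le> ?N f * ?N (P g)"
      unfolding \<beta>_def by (rule L2_Cauchy_Schwarz[OF f PL[OF g]])
    also have "\<dots> \<le> ?N f * (\<zeta> * ?N g)"
      by (rule mult_left_mono[OF \<zeta>P[OF g] L2_norm_nonneg[OF f]])
    finally show ?thesis by (simp add: mult_ac)
  qed
  have coercive: "\<alpha> * (?N f)\<^sup>2 \<le> \<beta> f f" if f: "f \<in> ?L" for f
  proof -
    have "0 \<le> ?I f (\<lambda>s. P f s - \<alpha> \<cdot>\<^sub>v f s)"
      using assms(17) f by (auto simp: L2_op_le_def op_smult_def)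
    then show ?thesis
      using L2_inner_diff_right[OF PL[OF f] L2_space_smult[OF f] f] L2_inner_smult_right[OF f f]
      by (simp add: \<beta>_def L2_norm_power2[OF f])
  qed
  \<comment> \<open>The operator inequality is paired with f; each adjoint then moves to the other
    factor.\<close>
  have LMI: "\<beta> (A f) (T f) + \<beta> (T f) (A f) \<le> - \<delta> * (?N (T f))\<^sup>2" if f: "f \<in> ?L" for f
  proof -
    let ?Ta = "L2_adj a b n T" and ?Aa = "L2_adj a b n A"
    note TT = L2_adj[OF bT f TL[OF f]] and TPA = L2_adj[OF bT f PL[OF AL[OF f]]]
      and APT = L2_adj[OF bA f PL[OF TL[OF f]]]
    have "0 \<le> ?I f (\<lambda>s. (- \<delta>) \<cdot>\<^sub>v ?Ta (T f) s - (?Aa (P (T f)) s + ?Ta (P (A f)) s))"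
      using assms(18) f by (auto simp: L2_op_le_def op_smult_def op_add_def)
    also have "\<dots> = - \<delta> * ?I f (?Ta (T f)) - (?I f (?Aa (P (T f))) + ?I f (?Ta (P (A f))))"
      using TT(1) TPA(1) APT(1) f
      by (simp add: L2_inner_diff_right[OF L2_space_smult L2_space_add] L2_inner_smult_right L2_inner_add_right)
    also have "\<dots> = - \<delta> * (?N (T f))\<^sup>2 - (\<beta> (A f) (T f) + \<beta> (T f) (A f))"
      unfolding TT(2) TPA(2) APT(2) \<beta>_def L2_norm_power2[OF TL[OF f]] by simp
    finally show ?thesis by simp
  qed
  have sol: "x s \<in> X" "\<exists>v. has_X_derivative a b n0 n1 n2 B x v s \<and>
        L2_eq a b v (\<lambda>r.
          A0 r *\<^sub>v x s r
          + A1 r *\<^sub>v (wderiv a b n1 1 (block n0 n1 (x s)) r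
                     @\<^sub>v wderiv a b n2 1 (block (n0 + n1) n2 (x s)) r)
          + A2 r *\<^sub>v wderiv a b n2 2 (block (n0 + n1) n2 (x s)) r)" if "s \<ge> 0" for s
    using assms(21) that unfolding PDE_solution_def by auto
  have xL: "x s \<in> ?L" if "s \<ge> 0" for s
    unfolding n by (rule X_L2[OF sol(1)[OF that]])
  obtain C where C: "C \<ge> 0" "\<And>x y v h. x \<in> X \<Longrightarrow> y \<in> X \<Longrightarrow> v \<in> X \<Longrightarrow>
    ?N (\<lambda>s. x s - y s - h \<cdot>\<^sub>v v s) \<le> C * X_norm a b n0 n1 n2 (\<lambda>s. x s - y s - h \<cdot>\<^sub>v v s)"
    using L2_norm_le_X_norm by blast
  define V where "V s = \<beta> (x s) (x s)" for s
  have V_le: "V s \<le> \<zeta> * (?N (x s))\<^sup>2" if "s \<ge> 0" for s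
    using \<beta>_bound[OF xL[OF that] xL[OF that]] by (simp add: V_def power2_eq_square mult.assoc)
  have V_deriv: "\<exists>D. (V has_real_derivative D) (at s within {0..}) \<and> D \<le> - \<delta> * (?N (x s))\<^sup>2" if s: "s \<ge> 0" for s
  proof -
    from sol(2)[OF s] obtain v where v: "has_X_derivative a b n0 n1 n2 B x v s"
      and veq: "L2_eq a b v (\<lambda>r.
          A0 r *\<^sub>v x s r
          + A1 r *\<^sub>v (wderiv a b n1 1 (block n0 n1 (x s)) r
                     @\<^sub>v wderiv a b n2 1 (block (n0 + n1) n2 (x s)) r)
          + A2 r *\<^sub>v wderiv a b n2 2 (block (n0 + n1) n2 (x s)) r)" by blast
    from v have vX: "v \<in> X" and lim: "((\<lambda>\<tau>. X_norm a b n0 n1 n2 (\<lambda>r. x \<tau> r - x s r - (\<tau> - s) \<cdot>\<^sub>v v r) / \<bar>\<tau> - s\<bar>)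
        \<longlongrightarrow> 0) (at s within {0..})"
      by (auto simp: has_X_derivative_def)
    have vL: "v \<in> ?L" unfolding n by (rule X_L2[OF vX])
    note xs = xL[OF s]
    let ?f = "hat (x s)"
    have f: "?f \<in> ?L" unfolding n by (rule hat_L2[OF sol(1)[OF s]])
    have Tf: "L2_eq a b (T ?f) (x s)"
      unfolding assms(8) by (rule fundamental_identity(1)[OF sol(1)[OF s]])
    have "L2_eq a b (A ?f) v"
      unfolding assms(9)
      by (rule L2_eq_trans[OF A_op_hat[OF sol(1)[OF s]] L2_eq_sym[OF veq]])
        (use assms(5-7) n in \<open>auto simp: bounded_measurable_mat_def\<close>)
    note Af = this
    \<comment> \<open>For \<open>f = hat (x s)\<close>, up to null sets \<open>T f\<close> is the
      state and \<open>A f\<close> its time derivative v; by symmetry both terms of the inequality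
      become \<beta>(v, x(s)).\<close>
    have "\<beta> (A ?f) (T ?f) = \<beta> v (x s)" "\<beta> (T ?f) (A ?f) = \<beta> v (x s)"
      using \<beta>_cong[OF AL[OF f] vL TL[OF f] Af] \<beta>_cong[OF TL[OF f] xs vL Tf]
        \<beta>_sym[OF vL TL[OF f]] \<beta>_sym[OF xs vL] \<beta>_sym[OF TL[OF f] AL[OF f]] by simp_all
    moreover have "(?N (T ?f))\<^sup>2 = (?N (x s))\<^sup>2"
      using L2_inner_cong_AE[OF TL[OF f] TL[OF f] xs xs Tf Tf] by (simp add: L2_norm_power2[OF TL[OF f]] L2_norm_power2[OF xs])
    ultimately have D: "2 * \<beta> v (x s) \<le> - \<delta> * (?N (x s))\<^sup>2"
      using LMI[OF f] by simp
    let ?r = "\<lambda>\<tau>. X_norm a b n0 n1 n2 (\<lambda>r. x \<tau> r - x s r - (\<tau> - s) \<cdot>\<^sub>v v r) / \<bar>\<tau> - s\<bar>"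
    \<comment> \<open>Error bound for the difference quotient of V: the first summand comes from
      pairing the Frechet remainder with x(s), the second from the quadratic term in the increment.
      The factor is |\<zeta>| because the sign of \<zeta> is settled only at the end.\<close>
    let ?g = "\<lambda>\<tau>. 2 * \<bar>\<zeta>\<bar> * (C * ?r \<tau>) * ?N (x s) + \<bar>\<zeta>\<bar> * (?N v + C * ?r \<tau>)\<^sup>2 * \<bar>\<tau> - s\<bar>"
    have g0: "(?g \<longlongrightarrow> 2 * \<bar>\<zeta>\<bar> * (C * 0) * ?N (x s) + \<bar>\<zeta>\<bar> * (?N v + C * 0)\<^sup>2 * \<bar>s - s\<bar>) (at s within {0..})"
      by (intro tendsto_intros lim)
    have est: "\<bar>(V \<tau> - V s) / (\<tau> - s) - 2 * \<beta> v (x s)\<bar> \<le> ?g \<tau>" if \<tau>: "\<tau> \<ge> 0" "\<tau> \<noteq> s" for \<tau>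
    proof -
      let ?h = "\<tau> - s"
      let ?w = "\<lambda>r. x \<tau> r - x s r - ?h \<cdot>\<^sub>v v r"
      \<comment> \<open>The increment of the solution, as its first-order part plus the Frechet
        remainder; expanding V bilinearly isolates 2 \<beta>(v, x(s)).\<close>
      let ?e = "\<lambda>r. ?h \<cdot>\<^sub>v v r + ?w r"
      note x\<tau> = xL[OF \<tau>(1)]
      have hv: "(\<lambda>r. ?h \<cdot>\<^sub>v v r) \<in> ?L" by (rule L2_space_smult[OF vL])
      have w: "?w \<in> ?L" by (intro L2_space_diff x\<tau> xs hv)
      have e: "?e \<in> ?L" by (rule L2_space_add[OF hv w])
      have xe: "L2_eq a b (x \<tau>) (\<lambda>r. x s r + ?e r)"
      proof (rule L2_eq_of_eq)
        fix r assume "r \<in> {a..b}"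
        from L2_spaceD(2)[OF xs this] L2_spaceD(2)[OF x\<tau> this] L2_spaceD(2)[OF vL this]
        show "x \<tau> r = x s r + ?e r" by (auto intro!: eq_vecI)
      qed
      have xeL: "(\<lambda>r. x s r + ?e r) \<in> ?L" by (rule L2_space_add[OF xs e])
      have "V \<tau> = \<beta> (\<lambda>r. x s r + ?e r) (\<lambda>r. x s r + ?e r)"
        unfolding V_def using \<beta>_cong[OF x\<tau> xeL x\<tau> xe] \<beta>_cong[OF x\<tau> xeL xeL xe] \<beta>_sym[OF x\<tau> xeL] by simp
      also have "\<dots> = V s + 2 * \<beta> ?e (x s) + \<beta> ?e ?e"
        unfolding V_def using \<beta>_add[OF xs e xeL] \<beta>_add[OF xs e xs] \<beta>_add[OF xs e e]
          \<beta>_sym[OF xs xeL] \<beta>_sym[OF e xeL] \<beta>_sym[OF xs e] by simp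
      also have "\<beta> ?e (x s) = ?h * \<beta> v (x s) + \<beta> ?w (x s)"
        using \<beta>_add[OF hv w xs] \<beta>_smult[OF vL xs] by simp
      finally have eq: "V \<tau> - V s - ?h * (2 * \<beta> v (x s)) = 2 * \<beta> ?w (x s) + \<beta> ?e ?e"
        by (simp add: algebra_simps)
      have h: "\<bar>?h\<bar> > 0" using \<tau>(2) by simp
      have wC: "?N ?w \<le> \<bar>?h\<bar> * (C * ?r \<tau>)"
        using C(2)[OF sol(1)[OF \<tau>(1)] sol(1)[OF s] vX, of ?h] h by simp
      have \<zeta>0: "\<zeta> * ?N u * ?N z \<le> \<bar>\<zeta>\<bar> * p * q" if "0 \<le> ?N u" "?N u \<le> p" "0 \<le> ?N z" "?N z \<le> q" for u z p q
      proof -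
        have "\<zeta> * ?N u * ?N z \<le> \<bar>\<zeta>\<bar> * ?N u * ?N z"
          using that by (intro mult_right_mono) auto
        also have "\<dots> \<le> \<bar>\<zeta>\<bar> * p * q"
          using that by (intro mult_mono mult_nonneg_nonneg) auto
        finally show ?thesis .
      qed
      let ?R = "C * ?r \<tau>"
      have "?N ?e \<le> ?N (\<lambda>r. ?h \<cdot>\<^sub>v v r) + ?N ?w" by (rule L2_norm_triangle[OF hv w])
      also have "?N (\<lambda>r. ?h \<cdot>\<^sub>v v r) = \<bar>?h\<bar> * ?N v"
        using L2_inner_smult_left[OF vL hv, of ?h] L2_inner_smult_right[OF vL vL, of ?h]
        by (simp add: L2_norm_def mult.assoc[symmetric] real_sqrt_mult)
      finally have eC: "?N ?e \<le> \<bar>?h\<bar> * (?N v + ?R)"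
        using wC by (simp add: distrib_left)
      have "\<bar>2 * \<beta> ?w (x s) + \<beta> ?e ?e\<bar> \<le> 2 * \<bar>\<beta> ?w (x s)\<bar> + \<bar>\<beta> ?e ?e\<bar>" by linarith
      also have "\<dots> \<le> 2 * (\<bar>\<zeta>\<bar> * (\<bar>?h\<bar> * ?R) * ?N (x s)) + \<bar>\<zeta>\<bar> * (\<bar>?h\<bar> * (?N v + ?R)) * (\<bar>?h\<bar> * (?N v + ?R))"
        using \<beta>_bound[OF w xs] \<beta>_bound[OF e e] L2_norm_nonneg[OF w] L2_norm_nonneg[OF xs] L2_norm_nonneg[OF e]
          \<zeta>0[OF _ wC _ order_refl, of "x s"] \<zeta>0[OF _ eC _ eC] by linarith
      also have "\<dots> = \<bar>?h\<bar> * ?g \<tau>"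
      proof -
        have "2 * (z * (h * R) * y) + z * (h * (p + R)) * (h * (p + R)) = h * (2 * z * R * y + z * (p + R)\<^sup>2 * h)"
          for z h R y p :: real by (simp add: power2_eq_square algebra_simps)
        then show ?thesis .
      qed
      finally have bound: "\<bar>V \<tau> - V s - ?h * (2 * \<beta> v (x s))\<bar> \<le> \<bar>?h\<bar> * ?g \<tau>" unfolding eq .
      have "(V \<tau> - V s) / ?h - 2 * \<beta> v (x s) = (V \<tau> - V s - ?h * (2 * \<beta> v (x s))) / ?h"
        using \<tau>(2) by (simp add: diff_divide_distrib)
      then have "\<bar>(V \<tau> - V s) / ?h - 2 * \<beta> v (x s)\<bar> = \<bar>V \<tau> - V s - ?h * (2 * \<beta> v (x s))\<bar> / \<bar>?h\<bar>"
        by (simp only: abs_divide)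
      also have "\<dots> \<le> ?g \<tau>"
        using bound h by (simp only: pos_divide_le_eq mult.commute)
      finally show ?thesis .
    qed
    have "((\<lambda>\<tau>. (V \<tau> - V s) / (\<tau> - s) - 2 * \<beta> v (x s)) \<longlongrightarrow> 0) (at s within {0..})"
    proof (rule Lim_null_comparison)
      show "\<forall>\<^sub>F \<tau> in at s within {0..}. norm ((V \<tau> - V s) / (\<tau> - s) - 2 * \<beta> v (x s)) \<le> ?g \<tau>"
        using est by (auto simp: eventually_at_filter)
      show "(?g \<longlongrightarrow> 0) (at s within {0..})" using g0 by simp
    qed
    then have "(V has_real_derivative 2 * \<beta> v (x s)) (at s within {0..})"
      unfolding has_field_derivative_iff by (rule Lim_null[THEN iffD2])
    with D show ?thesis by blast
  qed
  show ?thesis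
  proof (cases "\<forall>f\<in>?L. ?N f = 0")
    \<comment> \<open>This happens only for n = 0. Both norms in the claim vanish, so it holds
      whatever value the division by \<zeta> takes.\<close>
    case True
    then show ?thesis using xL[OF \<open>t \<ge> 0\<close>] xL[of 0] by simp
  next
    case False
    then obtain f where f: "f \<in> ?L" "?N f \<noteq> 0" by blast
    \<comment> \<open>One element of nonzero norm already forces \<alpha> \<le> \<zeta>, which makes
      \<zeta> a positive divisor.\<close>
    have "\<alpha> * (?N f)\<^sup>2 \<le> \<zeta> * (?N f)\<^sup>2"
      using coercive[OF f(1)] \<beta>_bound[OF f(1) f(1)] by (simp add: power2_eq_square mult.assoc)
    with f(2) \<open>\<alpha> > 0\<close> have \<zeta>: "\<zeta> > 0" by simp
    \<comment> \<open>The derivative is known at each time separately; choice assembles the values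
      into the function that \<open>exponential_decay\<close> expects.\<close>
    define V' where "V' s = (SOME D. (V has_real_derivative D) (at s within {0..}) \<and> D \<le> - \<delta> * (?N (x s))\<^sup>2)" for s
    have V': "(V has_real_derivative V' s) (at s within {0..})" "V' s \<le> - \<delta> * (?N (x s))\<^sup>2" if "s \<ge> 0" for s
      using someI_ex[OF V_deriv[OF that]] unfolding V'_def by auto
    have "V t \<le> V 0 * exp (- (\<delta> / \<zeta>) * t)"
    proof (rule exponential_decay[OF V'(1) _ \<open>t \<ge> 0\<close>])
      fix s :: real assume s: "s \<ge> 0"
      have "\<delta> / \<zeta> * V s \<le> \<delta> / \<zeta> * (\<zeta> * (?N (x s))\<^sup>2)"
        using V_le[OF s] \<open>\<delta> > 0\<close> \<zeta> by (intro mult_left_mono) auto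
      also have "\<dots> = \<delta> * (?N (x s))\<^sup>2" using \<zeta> by simp
      finally show "V' s \<le> - (\<delta> / \<zeta>) * V s" using V'(2)[OF s] by simp
    qed
    also have "\<dots> \<le> \<zeta> * (?N (x 0))\<^sup>2 * exp (- (\<delta> / \<zeta>) * t)"
      by (intro mult_right_mono V_le) auto
    finally have "\<alpha> * (?N (x t))\<^sup>2 \<le> \<zeta> * (?N (x 0))\<^sup>2 * exp (- (\<delta> / \<zeta>) * t)"
      using coercive[OF xL[OF \<open>t \<ge> 0\<close>]] by (simp add: V_def)
    then show ?thesis using \<open>\<alpha> > 0\<close> by (simp add: field_simps)
  qed
qed

end
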